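(* Let $\Lambda$ be a finitely aligned $k$-graph, let $\mathcal{E}\subseteq\mathrm{FE}(\Lambda^1)$ be efficient, and let $\{s^{\mathcal{E}}_\lambda:\lambda\in\Lambda\}$ be the universal relative Cuntz-Krieger $(\Lambda;\mathcal{E})$-family. (1) For every $v\in\Lambda^0$, $s_v^{\mathcal{E}}\neq0$. (2) For every $v\in\Lambda^0$ and every finite $E\subseteq v\Lambda^1$, we have $E\in\widehat{\mathcal{E}}$ if and only if $\prod_{e\in E}(s_v^{\mathcal{E}}-s_e^{\mathcal{E}}s_e^{\mathcal{E}*})=0$.
   Context: A $k$-graph ($k\ge 1$) is a countable category $\Lambda$ with a functor $d:\Lambda\to\mathbb{N}^k$ such that whenever $d(\lambda)=m+n$ there are unique $\mu,\nu\in\Lambda$ with $\lambda=\mu\nu$, $d(\mu)=m$, $d(\nu)=n$; write $\lambda(0,m)=\mu$. $\Lambda^n:=d^{-1}(n)$; $\Lambda^0$ is identified with the objects (vertices); $r,s:\Lambda\to\Lambda^0$ are codomain and domain, so $\lambda\mu$ is defined iff $s(\lambda)=r(\mu)$. $\Lambda^1:=\bigcup_{i=1}^k\Lambda^{e_i}$ is the set of edges ($e_i$ the standard basis of $\mathbb{N}^k$). For $v\in\Lambda^0$, $E\subseteq\Lambda$: $vE:=\{\mu\in E:r(\mu)=v\}$. With $\vee$ the coordinatewise maximum, $\mathrm{MCE}(\lambda,\mu):=\{\tau\in\Lambda^{d(\lambda)\vee d(\mu)}:\tau(0,d(\lambda))=\lambda,\ \tau(0,d(\mu))=\mu\}$ and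 $\Lambda^{\min}(\lambda,\mu):=\{(\lambda',\mu'):\lambda\lambda'=\mu\mu'\in\mathrm{MCE}(\lambda,\mu)\}$. $\Lambda$ is finitely aligned if every $\Lambda^{\min}(\lambda,\mu)$ is finite. A set $E\subseteq v\Lambda$ is exhaustive if for every $\lambda\in v\Lambda$ there is $\mu\in E$ with $\Lambda^{\min}(\lambda,\mu)\neq\emptyset$. $\mathrm{FE}(\Lambda)$ is the collection of all finite exhaustive sets $E\subseteq v\Lambda\setminus\{v\}$, $v\in\Lambda^0$; for such $E$ put $r(E):=v$. $\mathrm{FE}(\Lambda^1):=\{E\in\mathrm{FE}(\Lambda):E\subseteq\Lambda^1\}$. For a collection $\mathcal{E}\subseteq\mathrm{FE}(\Lambda)$, $v\mathcal{E}:=\{E\in\mathcal{E}:r(E)=v\}$. For $E\subseteq r(\lambda)\Lambda$, $\mathrm{Ext}_\Lambda(\lambda;E):=\{g\in s(\lambda)\Lambda:\lambda g\in\mathrm{MCE}(\lambda,e)\text{ for some }e\in E\}$. A subset $\mathcal{E}\subseteq\mathrm{FE}(\Lambda^1)$ is efficient if: (E1) $E,F\in\mathcal{E}$, $E\subseteq F$ imply $E=F$; (E2) if $E\in\mathcal{E}$ and $f\in r(E)\Lambda^1\setminus E$, there is $F\in\mathcal{E}$ with $F\subseteq\mathrm{Ext}_\Lambda(f;E)$; (E3) if $E\in\mathcal{E}$, $e\in E$ and $F\in s(e)\mathcal{E}$, there is $G\in\mathcal{E}$ with $G\subseteq(E\setminus\{e\})\cup\{(ef)(0,d(f)):f\in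 F\}$. The edge satiation of $\mathcal{E}\subseteq\mathrm{FE}(\Lambda^1)$ is $\widehat{\mathcal{E}}:=\{E\in\mathrm{FE}(\Lambda^1):\text{there exists }F\in\mathcal{E}\text{ with }F\subseteq E\}$. A Toeplitz-Cuntz-Krieger $\Lambda$-family in a $C^*$-algebra is a collection $\{T_\lambda:\lambda\in\Lambda\}$ of partial isometries such that: (TCK1) $\{T_v:v\in\Lambda^0\}$ are mutually orthogonal projections; (TCK2) $T_\lambda T_\mu=T_{\lambda\mu}$ whenever $s(\lambda)=r(\mu)$; (TCK3) $T_\lambda^*T_\mu=\sum_{(\lambda',\mu')\in\Lambda^{\min}(\lambda,\mu)}T_{\lambda'}T_{\mu'}^*$ for all $\lambda,\mu$ (empty sums are $0$). The projections $T_\lambda T_\lambda^*$ commute. A relative Cuntz-Krieger $(\Lambda;\mathcal{E})$-family is a Toeplitz-Cuntz-Krieger $\Lambda$-family with $\prod_{\lambda\in E}(T_{r(E)}-T_\lambda T_\lambda^* )=0$ for all $E\in\mathcal{E}$. $C^*(\Lambda;\mathcal{E})$ is the $C^*$-algebra generated by a universal such family $\{s^{\mathcal{E}}_\lambda\}$. For $E=\emptyset\subseteq v\Lambda^1$ the product $\prod_{e\in E}(s_v^{\mathcal{E}}-s_e^{\mathcal{E}}s_e^{\mathcal{E}*})$ is read as $s_v^{\mathcal{E}}$. *)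

theory Defs
  imports "HOL-Analysis.Analysis" "HOL-Algebra.Module"
begin

section \<open>Higher-rank graphs\<close>

text \<open>
  A \<open>k\<close>-graph is a small category presented by its morphisms only: objects are identified with
  identity morphisms, \<open>rng\<close> and \<open>src\<close> are codomain and domain, and \<open>cmp L \<mu> \<nu>\<close> is the composite
  \<open>\<mu>\<nu>\<close>, meaningful when \<open>src L \<mu> = rng L \<nu>\<close>.  The rank \<open>k \<ge> 1\<close> is the cardinality of the
  finite type \<open>'k\<close>.
\<close>

record ('a, 'k) kgraph =
  mor :: "'a set"
  rng :: "'a \<Rightarrow> 'a"
  src :: "'a \<Rightarrow> 'a"
  cmp :: "'a \<Rightarrow> 'a \<Rightarrow> 'a"
  deg :: "'a \<Rightarrow> nat ^ 'k"

locale k_graph =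
  fixes L :: "('a, 'k::finite) kgraph"
  assumes countable_mor: "countable (mor L)"
    and rng_closed: "\<mu> \<in> mor L \<Longrightarrow> rng L \<mu> \<in> mor L"
    and src_closed: "\<mu> \<in> mor L \<Longrightarrow> src L \<mu> \<in> mor L"
    and rng_rng: "\<mu> \<in> mor L \<Longrightarrow> rng L (rng L \<mu>) = rng L \<mu>"
    and src_rng: "\<mu> \<in> mor L \<Longrightarrow> src L (rng L \<mu>) = rng L \<mu>"
    and rng_src: "\<mu> \<in> mor L \<Longrightarrow> rng L (src L \<mu>) = src L \<mu>"
    and src_src: "\<mu> \<in> mor L \<Longrightarrow> src L (src L \<mu>) = src L \<mu>"
    and cmp_closed: "\<lbrakk>\<mu> \<in> mor L; \<nu> \<in> mor L; src L \<mu> = rng L \<nu>\<rbrakk> \<Longrightarrow> cmp L \<mu> \<nu> \<in> mor L"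
    and rng_cmp: "\<lbrakk>\<mu> \<in> mor L; \<nu> \<in> mor L; src L \<mu> = rng L \<nu>\<rbrakk> \<Longrightarrow> rng L (cmp L \<mu> \<nu>) = rng L \<mu>"
    and src_cmp: "\<lbrakk>\<mu> \<in> mor L; \<nu> \<in> mor L; src L \<mu> = rng L \<nu>\<rbrakk> \<Longrightarrow> src L (cmp L \<mu> \<nu>) = src L \<nu>"
    and cmp_assoc: "\<lbrakk>\<mu> \<in> mor L; \<nu> \<in> mor L; \<tau> \<in> mor L; src L \<mu> = rng L \<nu>; src L \<nu> = rng L \<tau>\<rbrakk>
      \<Longrightarrow> cmp L (cmp L \<mu> \<nu>) \<tau> = cmp L \<mu> (cmp L \<nu> \<tau>)"
    and cmp_rng: "\<mu> \<in> mor L \<Longrightarrow> cmp L (rng L \<mu>) \<mu> = \<mu>"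
    and cmp_src: "\<mu> \<in> mor L \<Longrightarrow> cmp L \<mu> (src L \<mu>) = \<mu>"
    and deg_rng: "\<mu> \<in> mor L \<Longrightarrow> deg L (rng L \<mu>) = 0"
    and deg_cmp: "\<lbrakk>\<mu> \<in> mor L; \<nu> \<in> mor L; src L \<mu> = rng L \<nu>\<rbrakk>
      \<Longrightarrow> deg L (cmp L \<mu> \<nu>) = deg L \<mu> + deg L \<nu>"
    and unique_factorization: "\<lbrakk>\<tau> \<in> mor L; deg L \<tau> = m + n\<rbrakk>
      \<Longrightarrow> \<exists>!(\<mu>, \<nu>). \<mu> \<in> mor L \<and> \<nu> \<in> mor L \<and> src L \<mu> = rng L \<nu> \<and>
            \<tau> = cmp L \<mu> \<nu> \<and> deg L \<mu> = m \<and> deg L \<nu> = n"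

definition paths_of_degree :: "('a, 'k::finite) kgraph \<Rightarrow> nat ^ 'k \<Rightarrow> 'a set" where
  "paths_of_degree L n = {\<mu> \<in> mor L. deg L \<mu> = n}"

definition vertices :: "('a, 'k::finite) kgraph \<Rightarrow> 'a set" where
  "vertices L = paths_of_degree L 0"

lemma (in k_graph) vertices_eq_identities: "vertices L = rng L ` mor L"
proof -
  have "\<mu> = rng L \<mu>" if \<mu>: "\<mu> \<in> mor L" and d: "deg L \<mu> = 0" for \<mu>
  proof -
    obtain p where p: "\<And>\<alpha> \<beta>. \<lbrakk>\<alpha> \<in> mor L; \<beta> \<in> mor L; src L \<alpha> = rng L \<beta>; \<mu> = cmp L \<alpha> \<beta>;
        deg L \<alpha> = 0; deg L \<beta> = 0\<rbrakk> \<Longrightarrow> (\<alpha>, \<beta>) = p"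
      using unique_factorization[OF \<mu>, of 0 0] d by (auto simp: Ex1_def)
    have "(rng L \<mu>, \<mu>) = p"
      using \<mu> d rng_closed src_rng cmp_rng deg_rng by (intro p) simp_all
    moreover have "(\<mu>, src L \<mu>) = p"
      using \<mu> d src_closed rng_src cmp_src deg_rng[of "src L \<mu>"] by (intro p) simp_all
    ultimately have "(rng L \<mu>, \<mu>) = (\<mu>, src L \<mu>)" by simp
    then show ?thesis by simp
  qed
  then show ?thesis
    using deg_rng rng_closed by (auto simp: vertices_def paths_of_degree_def)
qed

definition edges :: "('a, 'k::finite) kgraph \<Rightarrow> 'a set" where
  "edges L = (\<Union>i. paths_of_degree L (axis i 1))"

text \<open>\<open>into L v E\<close> is \<open>vE\<close>.\<close>

definition into :: "('a, 'k::finite) kgraph \<Rightarrow> 'a \<Rightarrow> 'a set \<Rightarrow> 'a set" where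
  "into L v E = {\<mu> \<in> E. rng L \<mu> = v}"

text \<open>\<open>initial L \<tau> m\<close> is \<open>\<tau>(0,m)\<close>, meaningful when \<open>m \<le> deg L \<tau>\<close>.\<close>

definition initial :: "('a, 'k::finite) kgraph \<Rightarrow> 'a \<Rightarrow> nat ^ 'k \<Rightarrow> 'a" where
  "initial L \<tau> m = (THE \<mu>. \<mu> \<in> mor L \<and> deg L \<mu> = m \<and>
     (\<exists>\<nu> \<in> mor L. src L \<mu> = rng L \<nu> \<and> \<tau> = cmp L \<mu> \<nu>))"

definition deg_join :: "nat ^ 'k \<Rightarrow> nat ^ 'k \<Rightarrow> nat ^ ('k::finite)" where
  "deg_join m n = (\<chi> i. max (m $ i) (n $ i))"

definition MCE :: "('a, 'k::finite) kgraph \<Rightarrow> 'a \<Rightarrow> 'a \<Rightarrow> 'a set" where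
  "MCE L \<mu> \<nu> = {\<tau> \<in> paths_of_degree L (deg_join (deg L \<mu>) (deg L \<nu>)).
     initial L \<tau> (deg L \<mu>) = \<mu> \<and> initial L \<tau> (deg L \<nu>) = \<nu>}"

definition Lmin :: "('a, 'k::finite) kgraph \<Rightarrow> 'a \<Rightarrow> 'a \<Rightarrow> ('a \<times> 'a) set" where
  "Lmin L \<mu> \<nu> = {(\<mu>', \<nu>'). \<mu>' \<in> mor L \<and> \<nu>' \<in> mor L \<and> src L \<mu> = rng L \<mu>' \<and> src L \<nu> = rng L \<nu>' \<and>
     cmp L \<mu> \<mu>' = cmp L \<nu> \<nu>' \<and> cmp L \<mu> \<mu>' \<in> MCE L \<mu> \<nu>}"

definition finitely_aligned :: "('a, 'k::finite) kgraph \<Rightarrow> bool" where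
  "finitely_aligned L \<longleftrightarrow> (\<forall>\<mu> \<in> mor L. \<forall>\<nu> \<in> mor L. finite (Lmin L \<mu> \<nu>))"

section \<open>Finite exhaustive sets\<close>

definition exhaustive :: "('a, 'k::finite) kgraph \<Rightarrow> 'a \<Rightarrow> 'a set \<Rightarrow> bool" where
  "exhaustive L v E \<longleftrightarrow> E \<subseteq> into L v (mor L) \<and>
     (\<forall>\<mu> \<in> into L v (mor L). \<exists>\<nu> \<in> E. Lmin L \<mu> \<nu> \<noteq> {})"

definition FE :: "('a, 'k::finite) kgraph \<Rightarrow> 'a set set" where
  "FE L = {E. finite E \<and> (\<exists>v \<in> vertices L. E \<subseteq> into L v (mor L) - {v} \<and> exhaustive L v E)}"

definition FE_edges :: "('a, 'k::finite) kgraph \<Rightarrow> 'a set set" where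
  "FE_edges L = {E \<in> FE L. E \<subseteq> edges L}"

text \<open>
  The common range \<open>r(E)\<close> of the members of \<open>E \<in> FE L\<close>; such an \<open>E\<close> is nonempty, because \<open>v\<close>
  itself lies in \<open>v\<Lambda>\<close> and must have a common extension with some member of \<open>E\<close>.
\<close>

definition range_of :: "('a, 'k::finite) kgraph \<Rightarrow> 'a set \<Rightarrow> 'a" where
  "range_of L E = the_elem (rng L ` E)"

definition sets_at :: "('a, 'k::finite) kgraph \<Rightarrow> 'a \<Rightarrow> 'a set set \<Rightarrow> 'a set set" where
  "sets_at L v \<E> = {E \<in> \<E>. range_of L E = v}"

definition Ext :: "('a, 'k::finite) kgraph \<Rightarrow> 'a \<Rightarrow> 'a set \<Rightarrow> 'a set" where
  "Ext L \<mu> E = {g \<in> into L (src L \<mu>) (mor L). \<exists>e \<in> E. cmp L \<mu> g \<in> MCE L \<mu> e}"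

definition efficient :: "('a, 'k::finite) kgraph \<Rightarrow> 'a set set \<Rightarrow> bool" where
  "efficient L \<E> \<longleftrightarrow> \<E> \<subseteq> FE_edges L \<and>
     (\<forall>E \<in> \<E>. \<forall>F \<in> \<E>. E \<subseteq> F \<longrightarrow> E = F) \<and>
     (\<forall>E \<in> \<E>. \<forall>f \<in> into L (range_of L E) (edges L) - E. \<exists>F \<in> \<E>. F \<subseteq> Ext L f E) \<and>
     (\<forall>E \<in> \<E>. \<forall>e \<in> E. \<forall>F \<in> sets_at L (src L e) \<E>.
        \<exists>G \<in> \<E>. G \<subseteq> (E - {e}) \<union> (\<lambda>f. initial L (cmp L e f) (deg L f)) ` F)"

definition edge_satiation :: "('a, 'k::finite) kgraph \<Rightarrow> 'a set set \<Rightarrow> 'a set set" where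
  "edge_satiation L \<E> = {E \<in> FE_edges L. \<exists>F \<in> \<E>. F \<subseteq> E}"

section \<open>C*-algebras\<close>

text \<open>
  C*-algebras are carrier-based, so that one can quantify over all C*-algebra structures on
  subsets of a given type.  They need not be unital: the field \<open>one\<close> inherited from the ring
  record is not constrained and never used.
\<close>

record 'b cstar = "(complex, 'b) module" +
  star :: "'b \<Rightarrow> 'b"
  cnorm :: "'b \<Rightarrow> real"

definition complex_ring :: "complex ring" where
  "complex_ring = \<lparr>carrier = UNIV, mult = (*), one = 1, zero = 0, add = (+)\<rparr>"

text \<open>The value off the carrier is irrelevant; it is fixed because \<^locale>\<open>Metric_space\<close>
  demands nonnegativity and symmetry on the whole type.\<close>

definition cdist :: "'b cstar \<Rightarrow> 'b \<Rightarrow> 'b \<Rightarrow> real" where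
  "cdist A x y = (if x \<in> carrier A \<and> y \<in> carrier A then cnorm A (x \<ominus>\<^bsub>A\<^esub> y) else 0)"

locale cstar_algebra = Module.module complex_ring A for A :: "'b cstar" (structure) +
  assumes mult_closed: "\<lbrakk>x \<in> carrier A; y \<in> carrier A\<rbrakk> \<Longrightarrow> x \<otimes> y \<in> carrier A"
    and mult_assoc: "\<lbrakk>x \<in> carrier A; y \<in> carrier A; z \<in> carrier A\<rbrakk> \<Longrightarrow> (x \<otimes> y) \<otimes> z = x \<otimes> (y \<otimes> z)"
    and mult_l_distr: "\<lbrakk>x \<in> carrier A; y \<in> carrier A; z \<in> carrier A\<rbrakk>
      \<Longrightarrow> (x \<oplus> y) \<otimes> z = x \<otimes> z \<oplus> y \<otimes> z"
    and mult_r_distr: "\<lbrakk>x \<in> carrier A; y \<in> carrier A; z \<in> carrier A\<rbrakk>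
      \<Longrightarrow> z \<otimes> (x \<oplus> y) = z \<otimes> x \<oplus> z \<otimes> y"
    and smult_mult_l: "\<lbrakk>x \<in> carrier A; y \<in> carrier A\<rbrakk> \<Longrightarrow> (c \<odot> x) \<otimes> y = c \<odot> (x \<otimes> y)"
    and smult_mult_r: "\<lbrakk>x \<in> carrier A; y \<in> carrier A\<rbrakk> \<Longrightarrow> x \<otimes> (c \<odot> y) = c \<odot> (x \<otimes> y)"
    and star_closed: "x \<in> carrier A \<Longrightarrow> star A x \<in> carrier A"
    and star_star: "x \<in> carrier A \<Longrightarrow> star A (star A x) = x"
    and star_add: "\<lbrakk>x \<in> carrier A; y \<in> carrier A\<rbrakk> \<Longrightarrow> star A (x \<oplus> y) = star A x \<oplus> star A y"
    and star_smult: "x \<in> carrier A \<Longrightarrow> star A (c \<odot> x) = cnj c \<odot> star A x"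
    and star_mult: "\<lbrakk>x \<in> carrier A; y \<in> carrier A\<rbrakk> \<Longrightarrow> star A (x \<otimes> y) = star A y \<otimes> star A x"
    and cnorm_nonneg: "x \<in> carrier A \<Longrightarrow> 0 \<le> cnorm A x"
    and cnorm_eq_0: "x \<in> carrier A \<Longrightarrow> cnorm A x = 0 \<longleftrightarrow> x = \<zero>"
    and cnorm_triangle: "\<lbrakk>x \<in> carrier A; y \<in> carrier A\<rbrakk> \<Longrightarrow> cnorm A (x \<oplus> y) \<le> cnorm A x + cnorm A y"
    and cnorm_smult: "x \<in> carrier A \<Longrightarrow> cnorm A (c \<odot> x) = cmod c * cnorm A x"
    and cnorm_mult: "\<lbrakk>x \<in> carrier A; y \<in> carrier A\<rbrakk> \<Longrightarrow> cnorm A (x \<otimes> y) \<le> cnorm A x * cnorm A y"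
    and cnorm_star_mult: "x \<in> carrier A \<Longrightarrow> cnorm A (star A x \<otimes> x) = (cnorm A x)\<^sup>2"
    and complete: "Metric_space.mcomplete (carrier A) (cdist A)"

definition cstar_subalgebra :: "'b cstar \<Rightarrow> 'b set \<Rightarrow> bool" where
  "cstar_subalgebra A B \<longleftrightarrow> B \<subseteq> carrier A \<and> \<zero>\<^bsub>A\<^esub> \<in> B \<and>
     (\<forall>x \<in> B. \<forall>y \<in> B. x \<oplus>\<^bsub>A\<^esub> y \<in> B \<and> x \<otimes>\<^bsub>A\<^esub> y \<in> B) \<and>
     (\<forall>x \<in> B. star A x \<in> B \<and> (\<forall>c. c \<odot>\<^bsub>A\<^esub> x \<in> B)) \<and>
     closedin (Metric_space.mtopology (carrier A) (cdist A)) B"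

definition cstar_generated :: "'b cstar \<Rightarrow> 'b set \<Rightarrow> bool" where
  "cstar_generated A S \<longleftrightarrow> S \<subseteq> carrier A \<and> (\<forall>B. cstar_subalgebra A B \<and> S \<subseteq> B \<longrightarrow> B = carrier A)"

definition star_hom :: "'b cstar \<Rightarrow> 'c cstar \<Rightarrow> ('b \<Rightarrow> 'c) \<Rightarrow> bool" where
  "star_hom A B \<pi> \<longleftrightarrow> \<pi> \<in> carrier A \<rightarrow> carrier B \<and>
     (\<forall>x \<in> carrier A. \<forall>y \<in> carrier A.
        \<pi> (x \<oplus>\<^bsub>A\<^esub> y) = \<pi> x \<oplus>\<^bsub>B\<^esub> \<pi> y \<and> \<pi> (x \<otimes>\<^bsub>A\<^esub> y) = \<pi> x \<otimes>\<^bsub>B\<^esub> \<pi> y) \<and>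
     (\<forall>x \<in> carrier A. \<pi> (star A x) = star B (\<pi> x) \<and> (\<forall>c. \<pi> (c \<odot>\<^bsub>A\<^esub> x) = c \<odot>\<^bsub>B\<^esub> \<pi> x))"

definition projection :: "'b cstar \<Rightarrow> 'b \<Rightarrow> bool" where
  "projection A p \<longleftrightarrow> p \<in> carrier A \<and> star A p = p \<and> p \<otimes>\<^bsub>A\<^esub> p = p"

definition partial_isometry :: "'b cstar \<Rightarrow> 'b \<Rightarrow> bool" where
  "partial_isometry A x \<longleftrightarrow> x \<in> carrier A \<and> x \<otimes>\<^bsub>A\<^esub> star A x \<otimes>\<^bsub>A\<^esub> x = x"

section \<open>Relative Cuntz-Krieger families\<close>

text \<open>Families are functions on the whole type; only their values on \<^term>\<open>mor L\<close> matter.\<close>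

definition TCK_family :: "('a, 'k::finite) kgraph \<Rightarrow> 'b cstar \<Rightarrow> ('a \<Rightarrow> 'b) \<Rightarrow> bool" where
  "TCK_family L A T \<longleftrightarrow>
     (\<forall>\<mu> \<in> mor L. partial_isometry A (T \<mu>)) \<and>
     (\<forall>v \<in> vertices L. projection A (T v)) \<and>
     (\<forall>v \<in> vertices L. \<forall>w \<in> vertices L. v \<noteq> w \<longrightarrow> T v \<otimes>\<^bsub>A\<^esub> T w = \<zero>\<^bsub>A\<^esub>) \<and>
     (\<forall>\<mu> \<in> mor L. \<forall>\<nu> \<in> mor L. src L \<mu> = rng L \<nu> \<longrightarrow> T \<mu> \<otimes>\<^bsub>A\<^esub> T \<nu> = T (cmp L \<mu> \<nu>)) \<and>
     (\<forall>\<mu> \<in> mor L. \<forall>\<nu> \<in> mor L. star A (T \<mu>) \<otimes>\<^bsub>A\<^esub> T \<nu> =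
        (\<Oplus>\<^bsub>A\<^esub>p\<in>Lmin L \<mu> \<nu>. T (fst p) \<otimes>\<^bsub>A\<^esub> star A (T (snd p))))"

text \<open>
  \<open>gap_prod A T v E\<close> is the product over \<open>e \<in> E\<close> of the projections \<open>T\<^sub>v - T\<^sub>e T\<^sub>e\<^sup>*\<close>, for a finite
  \<open>E \<subseteq> v\<Lambda>\<close>.  The factors commute and lie below \<open>T\<^sub>v\<close>, so folding from \<open>T\<^sub>v\<close> neither depends
  on the order nor changes a nonempty product, and it gives the empty product the value \<open>T\<^sub>v\<close>.
\<close>

definition gap_prod :: "'b cstar \<Rightarrow> ('a \<Rightarrow> 'b) \<Rightarrow> 'a \<Rightarrow> 'a set \<Rightarrow> 'b" where
  "gap_prod A T v E =
     foldD (carrier A) (\<lambda>e x. (T v \<ominus>\<^bsub>A\<^esub> T e \<otimes>\<^bsub>A\<^esub> star A (T e)) \<otimes>\<^bsub>A\<^esub> x) (T v) E"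

definition relative_CK_family ::
    "('a, 'k::finite) kgraph \<Rightarrow> 'a set set \<Rightarrow> 'b cstar \<Rightarrow> ('a \<Rightarrow> 'b) \<Rightarrow> bool" where
  "relative_CK_family L \<E> A T \<longleftrightarrow> TCK_family L A T \<and>
     (\<forall>E \<in> \<E>. gap_prod A T (range_of L E) E = \<zero>\<^bsub>A\<^esub>)"

text \<open>
  A universal property cannot quantify over the types carrying the test algebras.  One fixed
  type suffices: a family is indexed by the countable set \<^term>\<open>mor L\<close>, so the C*-algebra it generates
  has at most continuum many elements and is isomorphic to one carried by a subset of the type
  \<open>test\<close> below, into which the continuum injects.
\<close>

type_synonym test = "(nat \<Rightarrow> complex) \<Rightarrow> (nat \<Rightarrow> complex)"

text \<open>
  \<open>universal_family L \<E> A s\<close>: the C*-algebra \<open>A\<close> is generated by the universal relative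
  Cuntz-Krieger family \<open>s\<close>, i.e. \<open>(A, s)\<close> is \<open>(C*(\<Lambda>; \<E>), s\<^sup>\<E>)\<close>.  The homomorphism \<open>\<pi>\<close> is unique on
  the carrier because \<open>s\<close> generates \<open>A\<close>.
\<close>

definition universal_family ::
    "('a, 'k::finite) kgraph \<Rightarrow> 'a set set \<Rightarrow> 'b cstar \<Rightarrow> ('a \<Rightarrow> 'b) \<Rightarrow> bool" where
  "universal_family L \<E> A s \<longleftrightarrow>
     cstar_algebra A \<and> relative_CK_family L \<E> A s \<and> cstar_generated A (s ` mor L) \<and>
     (\<forall>(B :: test cstar) T. cstar_algebra B \<and> relative_CK_family L \<E> B T \<longrightarrow>
        (\<exists>\<pi>. star_hom A B \<pi> \<and> (\<forall>\<mu> \<in> mor L. \<pi> (s \<mu>) = T \<mu>)))"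

end

(*
  The implication from left to right in (2) is monotonicity of the gap product, and (1) is the case
  where E is empty of (2).  For the converse in (2), call a (finite or infinite) path x compatible
  if for every vertex w on x and every F in w\<E>, the part of x starting at w begins with an
  edge of F.  By (E2), prepending a path to a compatible path gives a compatible path, so the compatible
  paths carry a representation of \<Lambda> by shift operators on l^2, and compatibility makes it a
  relative Cuntz-Krieger family.  The gap product of E becomes the projection onto the paths with
  range v whose first edges avoid E.  By (E3), if E contains no member of \<E>, then a
  path from v that avoids E can be extended so as to meet one more compatibility requirement
  without being forced into E later on; meeting all countably many requirements in turn gives a
  compatible path avoiding E, so that the gap product of E is nonzero.
*)
theory Submission
  imports Defs
begin

section \<open>The Hilbert space of square-summable families\<close>

text \<open>The universal property is tested only against algebras carried by the type
  \<open>test\<close>, that is, by maps of complex sequences to themselves. Hence the Hilbert space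
  of the representation has to be indexed by \<open>nat\<close>, whereas the compatible paths may be
  uncountably many. The way out is to keep one compatible path avoiding E together with the
  countably many paths obtained from it by deleting and prepending finite segments; this set is
  already invariant under all shift operators. Operators are built from relations on the index set,
  so that each Cuntz-Krieger relation becomes a statement about partial injections. Compatibility is
  demanded at every vertex of a path, not only at its range, because deleting an initial segment
  moves the range along the path. A path that may be infinite in some directions and finite in
  others is treated uniformly as a filter of finite paths; the limit of the successive extensions is
  then a downward closure, whether or not it stops growing in some direction.\<close>

typedef 'i ell2 = "{f :: 'i \<Rightarrow> complex. (\<lambda>i. (cmod (f i))\<^sup>2) summable_on UNIV}"
  morphisms coord Abs_ell2
  by (rule exI[of _ "\<lambda>_. 0"]) simp

setup_lifting type_definition_ell2

lemma square_summable_add: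
  fixes f g :: "'i \<Rightarrow> complex"
  assumes "(\<lambda>i. (cmod (f i))\<^sup>2) summable_on UNIV" "(\<lambda>i. (cmod (g i))\<^sup>2) summable_on UNIV"
  shows "(\<lambda>i. (cmod (f i + g i))\<^sup>2) summable_on UNIV"
proof (rule summable_on_comparison_test)
  show "(\<lambda>i. 2 * (cmod (f i))\<^sup>2 + 2 * (cmod (g i))\<^sup>2) summable_on UNIV"
    using assms by (intro summable_on_add summable_on_cmult_right)
  show "(cmod (f i + g i))\<^sup>2 \<le> 2 * (cmod (f i))\<^sup>2 + 2 * (cmod (g i))\<^sup>2" for i
  proof -
    have "(cmod (f i + g i))\<^sup>2 \<le> (cmod (f i) + cmod (g i))\<^sup>2"
      by (simp add: norm_triangle_ineq power_mono)
    also have "\<dots> \<le> 2 * (cmod (f i))\<^sup>2 + 2 * (cmod (g i))\<^sup>2"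
      using sum_squares_bound[of "cmod (f i)" "cmod (g i)"] by (simp add: power2_sum)
    finally show ?thesis .
  qed
qed simp

lemma square_summable_cmult:
  fixes f :: "'i \<Rightarrow> complex"
  assumes "(\<lambda>i. (cmod (f i))\<^sup>2) summable_on UNIV"
  shows "(\<lambda>i. (cmod (c * f i))\<^sup>2) summable_on UNIV"
  using summable_on_cmult_right[OF assms, of "(cmod c)\<^sup>2"] by (simp add: norm_mult power_mult_distrib)

lemma square_summable_inner:
  fixes f g :: "'i \<Rightarrow> complex"
  assumes "(\<lambda>i. (cmod (f i))\<^sup>2) summable_on UNIV" "(\<lambda>i. (cmod (g i))\<^sup>2) summable_on UNIV"
  shows "(\<lambda>i. f i \<bullet> g i) summable_on UNIV"
proof -
  have "(\<lambda>i. norm (f i \<bullet> g i)) summable_on UNIV"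
  proof (rule summable_on_comparison_test)
    show "(\<lambda>i. (cmod (f i))\<^sup>2 + (cmod (g i))\<^sup>2) summable_on UNIV"
      using assms by (rule summable_on_add)
    show "norm (f i \<bullet> g i) \<le> (cmod (f i))\<^sup>2 + (cmod (g i))\<^sup>2" for i
    proof -
      have "norm (f i \<bullet> g i) \<le> cmod (f i) * cmod (g i)"
        by (simp add: Cauchy_Schwarz_ineq2)
      then show ?thesis
        using sum_squares_bound[of "cmod (f i)" "cmod (g i)"]
          mult_nonneg_nonneg[OF norm_ge_zero[of "f i"] norm_ge_zero[of "g i"]] by linarith
    qed
  qed simp
  then show ?thesis by (rule abs_summable_summable)
qed

instantiation ell2 :: (type) real_inner
begin

lift_definition zero_ell2 :: "'a ell2" is "\<lambda>_. 0" by simp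
lift_definition plus_ell2 :: "'a ell2 \<Rightarrow> 'a ell2 \<Rightarrow> 'a ell2" is "\<lambda>f g i. f i + g i"
  by (rule square_summable_add)
lift_definition uminus_ell2 :: "'a ell2 \<Rightarrow> 'a ell2" is "\<lambda>f i. - f i" by simp
lift_definition minus_ell2 :: "'a ell2 \<Rightarrow> 'a ell2 \<Rightarrow> 'a ell2" is "\<lambda>f g i. f i - g i"
  using square_summable_add[where g = "\<lambda>i. - g i" for g] by simp
lift_definition scaleR_ell2 :: "real \<Rightarrow> 'a ell2 \<Rightarrow> 'a ell2" is "\<lambda>c f i. c *\<^sub>R f i"
  using square_summable_cmult[where c = "complex_of_real c" for c] by (simp add: scaleR_conv_of_real)
lift_definition inner_ell2 :: "'a ell2 \<Rightarrow> 'a ell2 \<Rightarrow> real"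
  is "\<lambda>f g. \<Sum>\<^sub>\<infinity>i. f i \<bullet> g i" .

definition norm_ell2 :: "'a ell2 \<Rightarrow> real" where "norm_ell2 x = sqrt (x \<bullet> x)"
definition dist_ell2 :: "'a ell2 \<Rightarrow> 'a ell2 \<Rightarrow> real" where "dist_ell2 x y = norm (x - y)"
definition sgn_ell2 :: "'a ell2 \<Rightarrow> 'a ell2" where "sgn_ell2 x = inverse (norm x) *\<^sub>R x"
definition uniformity_ell2 :: "('a ell2 \<times> 'a ell2) filter" where
  "uniformity_ell2 = (INF e\<in>{0<..}. principal {(x, y). dist x y < e})"
definition open_ell2 :: "'a ell2 set \<Rightarrow> bool" where
  "open_ell2 U = (\<forall>x\<in>U. \<forall>\<^sub>F (x', y) in uniformity. x' = x \<longrightarrow> y \<in> U)"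

instance
proof
  fix x y z :: "'a ell2" and a b :: real and U :: "'a ell2 set"
  show "x + y + z = x + (y + z)" by transfer (simp add: add.assoc)
  show "x + y = y + x" by transfer (simp add: add.commute)
  show "0 + x = x" by transfer simp
  show "- x + x = 0" by transfer simp
  show "x - y = x + - y" by transfer simp
  show "a *\<^sub>R (x + y) = a *\<^sub>R x + a *\<^sub>R y" by transfer (simp add: scaleR_add_right)
  show "(a + b) *\<^sub>R x = a *\<^sub>R x + b *\<^sub>R x" by transfer (simp add: scaleR_add_left)
  show "a *\<^sub>R b *\<^sub>R x = (a * b) *\<^sub>R x" by transfer simp
  show "1 *\<^sub>R x = x" by transfer simp
  show "dist x y = norm (x - y)" by (simp add: dist_ell2_def)
  show "sgn x = inverse (norm x) *\<^sub>R x" by (simp add: sgn_ell2_def)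
  show "uniformity = (INF e\<in>{0<..}. principal {(x, y :: 'a ell2). dist x y < e})"
    by (simp add: uniformity_ell2_def)
  show "open U = (\<forall>x\<in>U. \<forall>\<^sub>F (x', y) in uniformity. x' = x \<longrightarrow> y \<in> U)"
    by (simp add: open_ell2_def)
  show "x \<bullet> y = y \<bullet> x" by transfer (simp add: inner_commute)
  show "(x + y) \<bullet> z = x \<bullet> z + y \<bullet> z"
    by transfer (simp add: inner_add_left infsum_add square_summable_inner)
  show "(a *\<^sub>R x) \<bullet> y = a * (x \<bullet> y)"
    by transfer (simp add: infsum_cmult_right square_summable_inner)
  show "0 \<le> x \<bullet> x" by transfer (simp add: infsum_nonneg)
  show "(x \<bullet> x = 0) = (x = 0)"
  proof
    assume "x \<bullet> x = 0"
    then have "coord x i \<bullet> coord x i = 0" for i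
      using coord[of x]
      by (intro nonneg_infsum_le_0D[where A = UNIV])
        (auto simp: inner_ell2.rep_eq square_summable_inner)
    then show "x = 0" by (auto simp: coord_inject[symmetric] zero_ell2.rep_eq)
  qed (transfer, simp)
  show "norm x = sqrt (x \<bullet> x)" by (simp add: norm_ell2_def)
qed

end

lemma square_summable_coord: "(\<lambda>i. (cmod (coord x i))\<^sup>2) summable_on UNIV"
  using coord[of x] by simp

lemma ell2_eqI: "(\<And>i. coord x i = coord y i) \<Longrightarrow> x = y"
  by (auto simp: coord_inject[symmetric])

lemma norm_ell2_square: "(norm x)\<^sup>2 = (\<Sum>\<^sub>\<infinity>i. (cmod (coord x i))\<^sup>2)"
  by (simp add: power2_norm_eq_inner inner_ell2.rep_eq)

lemma sum_coord_le_norm: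
  assumes "finite F"
  shows "(\<Sum>i\<in>F. (cmod (coord x i))\<^sup>2) \<le> (norm x)\<^sup>2"
  unfolding norm_ell2_square using assms square_summable_coord
  by (intro finite_sum_le_infsum) auto

lemma norm_coord_le: "cmod (coord x i) \<le> norm x"
  by (rule power2_le_imp_le) (use sum_coord_le_norm[of "{i}" x] in simp_all)

text \<open>Nonnegative series are controlled by their finite partial sums; this one bound serves
  both the completeness of the space and the boundedness of the operators built from
  relations.\<close>

lemma bounded_sums_in_ell2:
  assumes "\<And>F. finite F \<Longrightarrow> (\<Sum>i\<in>F. (cmod (f i))\<^sup>2) \<le> B"
  shows "(\<lambda>i. (cmod (f i))\<^sup>2) summable_on UNIV" and "(\<Sum>\<^sub>\<infinity>i. (cmod (f i))\<^sup>2) \<le> B"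
proof -
  show *: "(\<lambda>i. (cmod (f i))\<^sup>2) summable_on UNIV"
    using assms by (intro nonneg_bdd_above_summable_on bdd_aboveI[where M = B]) auto
  show "(\<Sum>\<^sub>\<infinity>i. (cmod (f i))\<^sup>2) \<le> B"
    using * assms by (intro infsum_le_finite_sums) auto
qed

instance ell2 :: (type) banach
proof
  fix X :: "nat \<Rightarrow> 'a ell2"
  assume X: "Cauchy X"
  have "Cauchy (\<lambda>n. coord (X n) i)" for i
  proof (rule CauchyI)
    fix e :: real assume "0 < e"
    then obtain M where M: "\<And>m n. M \<le> m \<Longrightarrow> M \<le> n \<Longrightarrow> norm (X m - X n) < e"
      using CauchyD[OF X] by blast
    show "\<exists>M. \<forall>m\<ge>M. \<forall>n\<ge>M. norm (coord (X m) i - coord (X n) i) < e"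
    proof (intro exI allI impI)
      fix m n assume "M \<le> m" "M \<le> n"
      then show "norm (coord (X m) i - coord (X n) i) < e"
        using M[of m n] norm_coord_le[of "X m - X n" i] by (simp add: minus_ell2.rep_eq)
    qed
  qed
  then have "\<exists>l. (\<lambda>n. coord (X n) i) \<longlonglongrightarrow> l" for i
    using Cauchy_convergent_iff convergentD by blast
  then obtain f where f: "\<And>i. (\<lambda>n. coord (X n) i) \<longlonglongrightarrow> f i" by metis
  \<comment> \<open>The limit in m is taken inside a finite sum, hence termwise; as e does not
    depend on F, the bound then passes to the full sum.\<close>
  have tail: "(\<Sum>i\<in>F. (cmod (f i - coord (X n) i))\<^sup>2) \<le> e\<^sup>2"
    if M: "\<forall>m\<ge>M. \<forall>n\<ge>M. norm (X m - X n) < e" and n: "M \<le> n" and F: "finite F" for M n e F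
  proof (rule LIMSEQ_le_const2)
    show "(\<lambda>m. \<Sum>i\<in>F. (cmod (coord (X m) i - coord (X n) i))\<^sup>2)
        \<longlonglongrightarrow> (\<Sum>i\<in>F. (cmod (f i - coord (X n) i))\<^sup>2)"
      by (intro tendsto_intros f)
    have "(\<Sum>i\<in>F. (cmod (coord (X m) i - coord (X n) i))\<^sup>2) \<le> e\<^sup>2" if "M \<le> m" for m
    proof -
      have "(\<Sum>i\<in>F. (cmod (coord (X m) i - coord (X n) i))\<^sup>2) \<le> (norm (X m - X n))\<^sup>2"
        using sum_coord_le_norm[OF F, of "X m - X n"] by (simp add: minus_ell2.rep_eq)
      also have "\<dots> \<le> e\<^sup>2"
        using M n that by (intro power_mono) (auto intro: less_imp_le)
      finally show ?thesis .
    qed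
    then show "\<exists>N. \<forall>m\<ge>N. (\<Sum>i\<in>F. (cmod (coord (X m) i - coord (X n) i))\<^sup>2) \<le> e\<^sup>2" by blast
  qed
  \<comment> \<open>The constant 1 is arbitrary: one tail bound suffices to see that f is
    square-summable.\<close>
  obtain M0 where M0: "\<forall>m\<ge>M0. \<forall>n\<ge>M0. norm (X m - X n) < 1"
    using CauchyD[OF X, of 1] by auto
  have "(\<lambda>i. (cmod (f i - coord (X M0) i))\<^sup>2) summable_on UNIV"
    using tail[OF M0 order_refl] by (intro bounded_sums_in_ell2(1)) blast
  from square_summable_add[OF this square_summable_coord[of "X M0"]]
  have "(\<lambda>i. (cmod (f i))\<^sup>2) summable_on UNIV" by simp
  then obtain x where x: "coord x = f"
    using Abs_ell2_inverse[of f] by auto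
  have "X \<longlonglongrightarrow> x"
  proof (rule LIMSEQ_I)
    fix r :: real assume "0 < r"
    then obtain M where M: "\<forall>m\<ge>M. \<forall>n\<ge>M. norm (X m - X n) < r / 2"
      using CauchyD[OF X, of "r / 2"] by auto
    have "norm (X n - x) < r" if "M \<le> n" for n
    proof -
      have "(norm (x - X n))\<^sup>2 \<le> (r / 2)\<^sup>2"
        unfolding norm_ell2_square using tail[OF M that] x
        by (intro bounded_sums_in_ell2(2)) (simp add: minus_ell2.rep_eq)
      then have "norm (x - X n) \<le> r / 2"
        by (rule power2_le_imp_le) (use \<open>0 < r\<close> in simp)
      then show ?thesis using \<open>0 < r\<close> by (simp add: norm_minus_commute)
    qed
    then show "\<exists>M. \<forall>n\<ge>M. norm (X n - x) < r" by blast
  qed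
  then show "convergent X" by (rule convergentI)
qed

section \<open>A C*-algebra of adjointable operators\<close>

lift_definition ell2_scale :: "complex \<Rightarrow> 'i ell2 \<Rightarrow> 'i ell2" is "\<lambda>c f i. c * f i"
  by (rule square_summable_cmult)

lemma inner_ell2_scale: "ell2_scale c x \<bullet> y = x \<bullet> ell2_scale (cnj c) y"
  by (simp add: inner_ell2.rep_eq ell2_scale.rep_eq inner_complex_def algebra_simps)

lemma norm_ell2_scale: "norm (ell2_scale c x) = cmod c * norm x"
proof -
  have "(norm (ell2_scale c x))\<^sup>2 = (cmod c * norm x)\<^sup>2"
    unfolding power_mult_distrib norm_ell2_square
    using infsum_cmult_right[OF square_summable_coord, of "(cmod c)\<^sup>2" x]
    by (simp add: ell2_scale.rep_eq norm_mult power_mult_distrib)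
  then show ?thesis by (simp add: power2_eq_iff_nonneg)
qed

text \<open>The space carries only a real inner product structure, so complex scalars act as
  operators; commuting with all of them is what complex-linearity means for a real-linear
  map.\<close>

lift_definition scale_op :: "complex \<Rightarrow> 'i ell2 \<Rightarrow>\<^sub>L 'i ell2" is ell2_scale
proof (rule bounded_linear_intro)
  fix c a :: complex and r :: real and x y :: "'i ell2"
  show "ell2_scale c (x + y) = ell2_scale c x + ell2_scale c y"
    by transfer (simp add: algebra_simps)
  show "ell2_scale c (r *\<^sub>R x) = r *\<^sub>R ell2_scale c x"
    by transfer simp
  show "norm (ell2_scale c x) \<le> norm x * cmod c"
    by (simp add: norm_ell2_scale)
qed

lemma coord_scale_op: "coord (scale_op c x) i = c * coord x i"
  by (simp add: scale_op.rep_eq ell2_scale.rep_eq)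

section \<open>Adjoints and the C*-identity\<close>

definition is_adjoint :: "('x::real_inner \<Rightarrow>\<^sub>L 'x) \<Rightarrow> ('x \<Rightarrow>\<^sub>L 'x) \<Rightarrow> bool" where
  "is_adjoint T S \<longleftrightarrow> (\<forall>x y. T x \<bullet> y = x \<bullet> S y)"

lemma is_adjoint_sym: "is_adjoint T S \<Longrightarrow> is_adjoint S T"
  unfolding is_adjoint_def by (metis inner_commute)

lemma is_adjoint_unique:
  assumes "is_adjoint T S" "is_adjoint T S'"
  shows "S = S'"
  using assms by (intro blinfun_eqI) (metis is_adjoint_def vector_eq_ldot)

lemma is_adjoint_compose:
  "is_adjoint T S \<Longrightarrow> is_adjoint T' S' \<Longrightarrow> is_adjoint (T o\<^sub>L T') (S' o\<^sub>L S)"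
  by (simp add: is_adjoint_def)

lemma is_adjoint_add: "is_adjoint T S \<Longrightarrow> is_adjoint T' S' \<Longrightarrow> is_adjoint (T + T') (S + S')"
  by (simp add: is_adjoint_def blinfun.add_left inner_add_left inner_add_right)

lemma is_adjoint_scale_op: "is_adjoint (scale_op c) (scale_op (cnj c))"
  by (simp add: is_adjoint_def scale_op.rep_eq inner_ell2_scale)

text \<open>This is the half of the C*-identity that submultiplicativity does not give: the square
  of the norm of T x is the inner product of x with S T x, to which Cauchy-Schwarz applies.\<close>

lemma norm_square_le_adjoint_compose:
  assumes "is_adjoint T S"
  shows "(norm T)\<^sup>2 \<le> norm (S o\<^sub>L T)"
proof -
  have "norm (T x) \<le> sqrt (norm (S o\<^sub>L T)) * norm x" for x
  proof (rule power2_le_imp_le)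
    have "(norm (T x))\<^sup>2 = x \<bullet> (S o\<^sub>L T) x"
      using assms by (simp add: power2_norm_eq_inner is_adjoint_def)
    also have "\<dots> \<le> norm x * norm ((S o\<^sub>L T) x)" by (rule norm_cauchy_schwarz)
    also have "\<dots> \<le> norm x * (norm (S o\<^sub>L T) * norm x)"
      by (intro mult_left_mono norm_blinfun) simp
    finally show "(norm (T x))\<^sup>2 \<le> (sqrt (norm (S o\<^sub>L T)) * norm x)\<^sup>2"
      by (simp add: power_mult_distrib power2_eq_square mult_ac)
  qed simp
  then have "norm T \<le> sqrt (norm (S o\<^sub>L T))"
    by (intro norm_blinfun_bound) simp_all
  then have "(norm T)\<^sup>2 \<le> (sqrt (norm (S o\<^sub>L T)))\<^sup>2"
    by (intro power_mono) simp_all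
  then show ?thesis by simp
qed

lemma norm_le_adjoint:
  assumes "is_adjoint T S"
  shows "norm T \<le> norm S"
proof (cases "norm T = 0")
  case False
  have "norm T * norm T \<le> norm S * norm T"
    using norm_square_le_adjoint_compose[OF assms] norm_blinfun_compose[of S T]
    by (simp add: power2_eq_square)
  then show ?thesis using False by simp
qed simp

lemma norm_adjoint: "is_adjoint T S \<Longrightarrow> norm S = norm T"
  using norm_le_adjoint is_adjoint_sym by (metis antisym)

lemma norm_adjoint_compose:
  assumes "is_adjoint T S"
  shows "norm (S o\<^sub>L T) = (norm T)\<^sup>2"
  using norm_square_le_adjoint_compose[OF assms] norm_blinfun_compose[of S T] norm_adjoint[OF assms]
  by (simp add: power2_eq_square)

definition adj :: "('x::real_inner \<Rightarrow>\<^sub>L 'x) \<Rightarrow> 'x \<Rightarrow>\<^sub>L 'x" where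
  "adj T = (THE S. is_adjoint T S)"

lemma adj_eqI: "is_adjoint T S \<Longrightarrow> adj T = S"
  unfolding adj_def using is_adjoint_unique by blast

text \<open>
  The inner product of \<^typ>\<open>'i ell2\<close> is the real part of the usual complex one, which has the same
  adjoints on complex-linear operators.  The adjoint is required rather than derived, which avoids
  the Riesz representation theorem.
\<close>

definition ell2_ops :: "('i ell2 \<Rightarrow>\<^sub>L 'i ell2) set" where
  "ell2_ops = {T. (\<forall>c. T o\<^sub>L scale_op c = scale_op c o\<^sub>L T) \<and> (\<exists>S. is_adjoint T S)}"

lemma is_adjoint_adj: "T \<in> ell2_ops \<Longrightarrow> is_adjoint T (adj T)"
  unfolding ell2_ops_def using adj_eqI by auto

lemma ell2_ops_scale: "T \<in> ell2_ops \<Longrightarrow> T o\<^sub>L scale_op c = scale_op c o\<^sub>L T"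
  by (simp add: ell2_ops_def)

text \<open>The two sides of the commutation relation for \<open>adj T\<close> are adjoints of one
  and the same operator, T followed by multiplication by the conjugate scalar, so uniqueness of
  adjoints identifies them.\<close>

lemma ell2_ops_adj:
  assumes "T \<in> ell2_ops"
  shows "adj T \<in> ell2_ops"
proof -
  have "adj T o\<^sub>L scale_op c = scale_op c o\<^sub>L adj T" for c
  proof (rule is_adjoint_unique)
    show "is_adjoint (scale_op (cnj c) o\<^sub>L T) (adj T o\<^sub>L scale_op c)"
      using is_adjoint_compose[OF is_adjoint_scale_op[of "cnj c"] is_adjoint_adj[OF assms]] by simp
    show "is_adjoint (scale_op (cnj c) o\<^sub>L T) (scale_op c o\<^sub>L adj T)"
      using is_adjoint_compose[OF is_adjoint_adj[OF assms] is_adjoint_scale_op[of "cnj c"]]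
      by (simp add: ell2_ops_scale[OF assms])
  qed
  then show ?thesis
    using is_adjoint_sym[OF is_adjoint_adj[OF assms]] by (auto simp: ell2_ops_def)
qed

section \<open>Closure and completeness of the operator algebra\<close>

lemma scale_op_add: "scale_op (a + b) = scale_op a + scale_op b"
  by (intro blinfun_eqI ell2_eqI) (simp add: coord_scale_op plus_ell2.rep_eq blinfun.add_left algebra_simps)

lemma scale_op_mult: "scale_op (a * b) = scale_op a o\<^sub>L scale_op b"
  by (intro blinfun_eqI ell2_eqI) (simp add: coord_scale_op algebra_simps)

lemma scale_op_1: "scale_op 1 = id_blinfun"
  by (intro blinfun_eqI ell2_eqI) (simp add: coord_scale_op)

lemma norm_scale_op_compose: "norm (scale_op c o\<^sub>L T) = cmod c * norm T"
proof (rule antisym)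
  show "norm (scale_op c o\<^sub>L T) \<le> cmod c * norm T"
    by (rule norm_blinfun_bound)
      (auto simp: scale_op.rep_eq norm_ell2_scale mult.assoc intro!: mult_left_mono norm_blinfun)
  show "cmod c * norm T \<le> norm (scale_op c o\<^sub>L T)"
  proof (cases "c = 0")
    case False
    have "norm T \<le> norm (scale_op c o\<^sub>L T) / cmod c"
    proof (rule norm_blinfun_bound)
      fix x
      have "cmod c * norm (T x) \<le> norm (scale_op c o\<^sub>L T) * norm x"
        using norm_blinfun[of "scale_op c o\<^sub>L T" x] by (simp add: scale_op.rep_eq norm_ell2_scale)
      then show "norm (T x) \<le> norm (scale_op c o\<^sub>L T) / cmod c * norm x"
        using False by (simp add: field_simps)
    qed simp
    then show ?thesis using False by (simp add: field_simps)
  qed simp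
qed

lemma ell2_ops_0: "0 \<in> ell2_ops"
  by (auto simp: ell2_ops_def is_adjoint_def intro!: exI[of _ 0] blinfun_eqI)

lemma blinfun_compose_assoc: "(T o\<^sub>L S) o\<^sub>L R = T o\<^sub>L (S o\<^sub>L R)"
  by (rule blinfun_eqI) simp

lemma ell2_ops_compose:
  assumes T: "T \<in> ell2_ops" and S: "S \<in> ell2_ops"
  shows "T o\<^sub>L S \<in> ell2_ops"
proof -
  have "(T o\<^sub>L S) o\<^sub>L scale_op c = scale_op c o\<^sub>L (T o\<^sub>L S)" for c
    by (simp add: blinfun_compose_assoc ell2_ops_scale[OF S])
      (simp add: blinfun_compose_assoc[symmetric] ell2_ops_scale[OF T])
  moreover have "is_adjoint (T o\<^sub>L S) (adj S o\<^sub>L adj T)"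
    using T S by (intro is_adjoint_compose is_adjoint_adj)
  ultimately show ?thesis unfolding ell2_ops_def by blast
qed

lemma ell2_ops_add: "T \<in> ell2_ops \<Longrightarrow> S \<in> ell2_ops \<Longrightarrow> T + S \<in> ell2_ops"
  unfolding ell2_ops_def
  by (auto intro: is_adjoint_add simp: bounded_bilinear.add_left[OF bounded_bilinear_blinfun_compose]
      bounded_bilinear.add_right[OF bounded_bilinear_blinfun_compose])

lemma ell2_ops_scale_op: "scale_op c \<in> ell2_ops"
  unfolding ell2_ops_def using is_adjoint_scale_op
  by (auto simp: scale_op_mult[symmetric] mult.commute)

lemma ell2_ops_uminus:
  assumes "T \<in> ell2_ops"
  shows "- T \<in> ell2_ops"
proof -
  have "- T = scale_op (-1) o\<^sub>L T"
    by (intro blinfun_eqI ell2_eqI) (simp add: coord_scale_op uminus_ell2.rep_eq blinfun.minus_left)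
  then show ?thesis using ell2_ops_compose[OF ell2_ops_scale_op assms] by simp
qed

text \<open>Passing to adjoints preserves the norms of differences, so the adjoints form a Cauchy
  sequence too, and their limit is an adjoint of the limit. Thus demanding an adjoint in
  \<open>ell2_ops\<close> costs no completeness.\<close>

lemma ell2_ops_complete:
  assumes T: "\<And>n. T n \<in> ell2_ops" and "Cauchy T"
  obtains T' where "T' \<in> ell2_ops" "T \<longlonglongrightarrow> T'"
proof -
  obtain T' where T': "T \<longlonglongrightarrow> T'"
    using \<open>Cauchy T\<close> Cauchy_convergent_iff convergentD by blast
  have dist: "norm (adj (T m) - adj (T n)) = norm (T m - T n)" for m n
  proof (rule norm_adjoint)
    show "is_adjoint (T m - T n) (adj (T m) - adj (T n))"
      using is_adjoint_adj[OF T]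
      by (simp add: is_adjoint_def blinfun.diff_left inner_diff_left inner_diff_right)
  qed
  have "Cauchy (\<lambda>n. adj (T n))"
    using \<open>Cauchy T\<close> by (simp add: Cauchy_def dist_norm dist)
  then obtain S where S: "(\<lambda>n. adj (T n)) \<longlonglongrightarrow> S"
    using Cauchy_convergent_iff convergentD by blast
  have "is_adjoint T' S"
    unfolding is_adjoint_def
  proof (intro allI)
    fix x y
    have "(\<lambda>n. T n x \<bullet> y) \<longlonglongrightarrow> T' x \<bullet> y"
      by (intro tendsto_intros T')
    moreover have "(\<lambda>n. T n x \<bullet> y) \<longlonglongrightarrow> x \<bullet> S y"
      using is_adjoint_adj[OF T] by (simp add: is_adjoint_def) (intro tendsto_intros S)
    ultimately show "T' x \<bullet> y = x \<bullet> S y" by (rule LIMSEQ_unique)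
  qed
  moreover have "T' o\<^sub>L scale_op c = scale_op c o\<^sub>L T'" for c
  proof (rule LIMSEQ_unique)
    show "(\<lambda>n. T n o\<^sub>L scale_op c) \<longlonglongrightarrow> (T' o\<^sub>L scale_op c)"
      by (intro bounded_bilinear.tendsto[OF bounded_bilinear_blinfun_compose] T' tendsto_const)
    show "(\<lambda>n. T n o\<^sub>L scale_op c) \<longlonglongrightarrow> (scale_op c o\<^sub>L T')"
      unfolding ell2_ops_scale[OF T]
      by (intro bounded_bilinear.tendsto[OF bounded_bilinear_blinfun_compose] T' tendsto_const)
  qed
  ultimately have "T' \<in> ell2_ops" by (auto simp: ell2_ops_def)
  then show thesis using T' that by blast
qed

text \<open>Test algebras have carriers in the type \<open>test\<close>, so an operator is stored as
  its action on coordinate sequences. Sequences that are not square-summable lie outside its domain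
  and are sent to themselves; only the other values distinguish operators.\<close>

definition enc :: "(nat ell2 \<Rightarrow>\<^sub>L nat ell2) \<Rightarrow> test" where
  "enc T f = (if f \<in> range coord then coord (T (Abs_ell2 f)) else f)"

lemma inj_enc: "inj enc"
proof (intro injI blinfun_eqI)
  fix T S x assume "enc T = enc S"
  then have "enc T (coord x) = enc S (coord x)" by simp
  then show "blinfun_apply T x = blinfun_apply S x"
    by (simp add: enc_def coord_inverse coord_inject)
qed

abbreviation "dec \<equiv> the_inv enc"

lemma dec_enc [simp]: "dec (enc T) = T"
  by (rule the_inv_f_f[OF inj_enc])

lemma enc_eq_iff [simp]: "enc T = enc S \<longleftrightarrow> T = S"
  using inj_enc by (auto dest: injD)

definition ell2_cstar :: "test cstar" where
  "ell2_cstar = \<lparr>carrier = enc ` ell2_ops, mult = (\<lambda>x y. enc (dec x o\<^sub>L dec y)),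
     one = enc id_blinfun, zero = enc 0, add = (\<lambda>x y. enc (dec x + dec y)),
     smult = (\<lambda>c x. enc (scale_op c o\<^sub>L dec x)), star = (\<lambda>x. enc (adj (dec x))),
     cnorm = (\<lambda>x. norm (dec x))\<rparr>"

lemma ell2_cstar_simps [simp]:
  "carrier ell2_cstar = enc ` ell2_ops"
  "enc T \<otimes>\<^bsub>ell2_cstar\<^esub> enc S = enc (T o\<^sub>L S)"
  "\<zero>\<^bsub>ell2_cstar\<^esub> = enc 0"
  "enc T \<oplus>\<^bsub>ell2_cstar\<^esub> enc S = enc (T + S)"
  "c \<odot>\<^bsub>ell2_cstar\<^esub> enc T = enc (scale_op c o\<^sub>L T)"
  "star ell2_cstar (enc T) = enc (adj T)"
  "cnorm ell2_cstar (enc T) = norm T"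
  by (simp_all add: ell2_cstar_def)

section \<open>The C*-algebra axioms on the test type\<close>

lemma cring_complex_ring: "cring complex_ring"
proof (rule cringI)
  show "abelian_group complex_ring"
    by (rule abelian_groupI) (auto simp: complex_ring_def intro: exI[of _ "- x" for x])
  show "Group.comm_monoid complex_ring"
    by (rule comm_monoidI) (auto simp: complex_ring_def)
qed (auto simp: complex_ring_def algebra_simps)

lemma abelian_group_ell2_cstar: "abelian_group ell2_cstar"
proof (rule abelian_groupI)
  fix x assume "x \<in> carrier ell2_cstar"
  then obtain T where "x = enc T" "T \<in> ell2_ops" by auto
  then show "\<exists>y\<in>carrier ell2_cstar. y \<oplus>\<^bsub>ell2_cstar\<^esub> x = \<zero>\<^bsub>ell2_cstar\<^esub>"
    by (auto intro!: bexI[of _ "- T"] ell2_ops_uminus)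
qed (auto simp: ell2_ops_add ell2_ops_0 ac_simps)

lemma ell2_cstar_minus [simp]:
  assumes "T \<in> ell2_ops" "S \<in> ell2_ops"
  shows "enc T \<ominus>\<^bsub>ell2_cstar\<^esub> enc S = enc (T - S)"
proof -
  interpret abelian_group ell2_cstar by (rule abelian_group_ell2_cstar)
  have "\<ominus>\<^bsub>ell2_cstar\<^esub> enc S = enc (- S)"
    by (rule minus_equality) (use assms ell2_ops_uminus in auto)
  then show ?thesis by (simp add: a_minus_def)
qed

lemma ell2_cstar_finsum:
  assumes "finite I" "\<And>i. i \<in> I \<Longrightarrow> T i \<in> ell2_ops"
  shows "(\<Oplus>\<^bsub>ell2_cstar\<^esub>i\<in>I. enc (T i)) = enc (\<Sum>i\<in>I. T i)"
proof -
  interpret abelian_group ell2_cstar by (rule abelian_group_ell2_cstar)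
  show ?thesis
    using assms by (induction I) (auto simp: Pi_iff)
qed

lemma mcomplete_ell2_cstar:
  "Metric_space.mcomplete (carrier ell2_cstar) (cdist ell2_cstar)"
proof -
  have dist: "cdist ell2_cstar (enc T) (enc S) = norm (T - S)"
    if "T \<in> ell2_ops" "S \<in> ell2_ops" for T S
    using that by (simp add: cdist_def)
  interpret Metric_space "carrier ell2_cstar" "cdist ell2_cstar"
  proof
    fix x y z
    show "0 \<le> cdist ell2_cstar x y"
      by (auto simp: cdist_def)
    show "cdist ell2_cstar x y = cdist ell2_cstar y x"
      by (auto simp: cdist_def norm_minus_commute)
    assume x: "x \<in> carrier ell2_cstar" and y: "y \<in> carrier ell2_cstar"
    then show "cdist ell2_cstar x y = 0 \<longleftrightarrow> x = y"
      by (auto simp: dist)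
    assume "z \<in> carrier ell2_cstar"
    with x y show "cdist ell2_cstar x z \<le> cdist ell2_cstar x y + cdist ell2_cstar y z"
      by (auto simp: dist intro: norm_diff_triangle_le)
  qed
  show ?thesis
    unfolding mcomplete_def
  proof (intro allI impI)
    fix \<sigma> assume \<sigma>: "MCauchy \<sigma>"
    define T where "T n = dec (\<sigma> n)" for n
    have "\<sigma> n \<in> enc ` ell2_ops" for n
      using \<sigma> unfolding MCauchy_def by (metis ell2_cstar_simps(1) range_subsetD)
    then have T: "T n \<in> ell2_ops" "\<sigma> n = enc (T n)" for n
      unfolding T_def by (metis dec_enc imageE)+
    have "Cauchy T"
      using \<sigma> unfolding MCauchy_def Cauchy_def by (auto simp: T dist dist_norm)
    then obtain T' where T': "T' \<in> ell2_ops" "T \<longlonglongrightarrow> T'"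
      using ell2_ops_complete T(1) by blast
    have "limitin mtopology \<sigma> (enc T') sequentially"
      using T' unfolding limitin_metric by (simp add: T dist tendsto_iff dist_norm)
    then show "\<exists>x. limitin mtopology \<sigma> x sequentially" by blast
  qed
qed

lemma cstar_algebra_ell2_cstar: "cstar_algebra ell2_cstar"
proof (intro cstar_algebra.intro cstar_algebra_axioms.intro)
  show "Module.module complex_ring ell2_cstar"
  proof (rule moduleI)
    show "cring complex_ring" by (rule cring_complex_ring)
    show "abelian_group ell2_cstar" by (rule abelian_group_ell2_cstar)
  qed (auto simp: complex_ring_def ell2_ops_compose ell2_ops_scale_op scale_op_add scale_op_mult
      scale_op_1 blinfun_compose_assoc blinfun_eqI[of "id_blinfun o\<^sub>L T" T for T]
      bounded_bilinear.add_left[OF bounded_bilinear_blinfun_compose]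
      bounded_bilinear.add_right[OF bounded_bilinear_blinfun_compose])
  show "Metric_space.mcomplete (carrier ell2_cstar) (cdist ell2_cstar)"
    by (rule mcomplete_ell2_cstar)
  fix x y z and c :: complex
  assume "x \<in> carrier ell2_cstar"
  then obtain T where x: "x = enc T" and T: "T \<in> ell2_ops" by auto
  show "star ell2_cstar x \<in> carrier ell2_cstar" using T by (simp add: x ell2_ops_adj)
  show "star ell2_cstar (star ell2_cstar x) = x"
    using T by (simp add: x adj_eqI is_adjoint_adj is_adjoint_sym)
  show "star ell2_cstar (c \<odot>\<^bsub>ell2_cstar\<^esub> x) = cnj c \<odot>\<^bsub>ell2_cstar\<^esub> star ell2_cstar x"
  proof -
    have "is_adjoint (T o\<^sub>L scale_op c) (scale_op (cnj c) o\<^sub>L adj T)"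
      using T by (intro is_adjoint_compose is_adjoint_adj is_adjoint_scale_op)
    then show ?thesis by (simp add: x ell2_ops_scale[OF T, symmetric] adj_eqI)
  qed
  show "0 \<le> cnorm ell2_cstar x" by (simp add: x)
  show "cnorm ell2_cstar x = 0 \<longleftrightarrow> x = \<zero>\<^bsub>ell2_cstar\<^esub>" by (simp add: x)
  show "cnorm ell2_cstar (c \<odot>\<^bsub>ell2_cstar\<^esub> x) = cmod c * cnorm ell2_cstar x"
    by (simp add: x norm_scale_op_compose)
  show "cnorm ell2_cstar (star ell2_cstar x \<otimes>\<^bsub>ell2_cstar\<^esub> x) = (cnorm ell2_cstar x)\<^sup>2"
    using T by (simp add: x norm_adjoint_compose is_adjoint_adj)
  assume "y \<in> carrier ell2_cstar"
  then obtain S where y: "y = enc S" and S: "S \<in> ell2_ops" by auto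
  show "x \<otimes>\<^bsub>ell2_cstar\<^esub> y \<in> carrier ell2_cstar"
    using T S by (simp add: x y ell2_ops_compose)
  show "(c \<odot>\<^bsub>ell2_cstar\<^esub> x) \<otimes>\<^bsub>ell2_cstar\<^esub> y = c \<odot>\<^bsub>ell2_cstar\<^esub> (x \<otimes>\<^bsub>ell2_cstar\<^esub> y)"
    by (simp add: x y blinfun_compose_assoc)
  show "x \<otimes>\<^bsub>ell2_cstar\<^esub> (c \<odot>\<^bsub>ell2_cstar\<^esub> y) = c \<odot>\<^bsub>ell2_cstar\<^esub> (x \<otimes>\<^bsub>ell2_cstar\<^esub> y)"
    by (simp add: x y blinfun_compose_assoc[symmetric] ell2_ops_scale[OF T])
  show "star ell2_cstar (x \<oplus>\<^bsub>ell2_cstar\<^esub> y) = star ell2_cstar x \<oplus>\<^bsub>ell2_cstar\<^esub> star ell2_cstar y"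
    using T S by (simp add: x y adj_eqI is_adjoint_add is_adjoint_adj)
  show "star ell2_cstar (x \<otimes>\<^bsub>ell2_cstar\<^esub> y) = star ell2_cstar y \<otimes>\<^bsub>ell2_cstar\<^esub> star ell2_cstar x"
    using T S by (simp add: x y adj_eqI is_adjoint_compose is_adjoint_adj)
  show "cnorm ell2_cstar (x \<oplus>\<^bsub>ell2_cstar\<^esub> y) \<le> cnorm ell2_cstar x + cnorm ell2_cstar y"
    by (simp add: x y norm_triangle_ineq)
  show "cnorm ell2_cstar (x \<otimes>\<^bsub>ell2_cstar\<^esub> y) \<le> cnorm ell2_cstar x * cnorm ell2_cstar y"
    by (simp add: x y norm_blinfun_compose)
  assume "z \<in> carrier ell2_cstar"
  then obtain R where z: "z = enc R" by auto
  show "(x \<otimes>\<^bsub>ell2_cstar\<^esub> y) \<otimes>\<^bsub>ell2_cstar\<^esub> z = x \<otimes>\<^bsub>ell2_cstar\<^esub> (y \<otimes>\<^bsub>ell2_cstar\<^esub> z)"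
    by (simp add: x y z blinfun_compose_assoc)
  show "(x \<oplus>\<^bsub>ell2_cstar\<^esub> y) \<otimes>\<^bsub>ell2_cstar\<^esub> z =
      x \<otimes>\<^bsub>ell2_cstar\<^esub> z \<oplus>\<^bsub>ell2_cstar\<^esub> y \<otimes>\<^bsub>ell2_cstar\<^esub> z"
    by (simp add: x y z bounded_bilinear.add_left[OF bounded_bilinear_blinfun_compose])
  show "z \<otimes>\<^bsub>ell2_cstar\<^esub> (x \<oplus>\<^bsub>ell2_cstar\<^esub> y) =
      z \<otimes>\<^bsub>ell2_cstar\<^esub> x \<oplus>\<^bsub>ell2_cstar\<^esub> z \<otimes>\<^bsub>ell2_cstar\<^esub> y"
    by (simp add: x y z bounded_bilinear.add_right[OF bounded_bilinear_blinfun_compose])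
qed

section \<open>Operators of partial injections\<close>

definition partial_inj :: "('i \<times> 'i) set \<Rightarrow> bool" where
  "partial_inj R \<longleftrightarrow> single_valued R \<and> single_valued (R\<inverse>)"

lemma partial_injI:
  assumes "\<And>n m m'. \<lbrakk>(n, m) \<in> R; (n, m') \<in> R\<rbrakk> \<Longrightarrow> m = m'"
    and "\<And>n n' m. \<lbrakk>(n, m) \<in> R; (n', m) \<in> R\<rbrakk> \<Longrightarrow> n = n'"
  shows "partial_inj R"
  unfolding partial_inj_def single_valued_def using assms by blast

lemma partial_inj_converse: "partial_inj R \<Longrightarrow> partial_inj (R\<inverse>)"
  by (simp add: partial_inj_def)

lemma partial_inj_subset: "partial_inj R \<Longrightarrow> S \<subseteq> R \<Longrightarrow> partial_inj S"
  unfolding partial_inj_def single_valued_def by blast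

lemma partial_inj_comp: "partial_inj R \<Longrightarrow> partial_inj S \<Longrightarrow> partial_inj (R O S)"
  by (simp add: partial_inj_def converse_relcomp single_valued_relcomp)

lemma partial_inj_Id_on: "partial_inj (Id_on V)"
  by (simp add: partial_inj_def single_valued_Id_on)

lemma partial_inj_triple:
  assumes "partial_inj R"
  shows "R O R\<inverse> O R = R"
proof (intro equalityI subrelI)
  fix m n assume "(m, n) \<in> R O R\<inverse> O R"
  then obtain a b where "(m, a) \<in> R" "(b, a) \<in> R" "(b, n) \<in> R" by auto
  then show "(m, n) \<in> R" using assms unfolding partial_inj_def single_valued_def by blast
next
  fix m n assume "(m, n) \<in> R"
  then show "(m, n) \<in> R O R\<inverse> O R" by blast
qed

lemma Id_on_comp: "Id_on V O Id_on W = Id_on (V \<inter> W)"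
  by auto

lemma preimage_eq: "partial_inj R \<Longrightarrow> (n, m) \<in> R \<Longrightarrow> R\<inverse> `` {m} = {n}"
  unfolding partial_inj_def single_valued_def by auto

lemma preimage_cases:
  assumes "partial_inj R"
  obtains "R\<inverse> `` {m} = {}" | n where "R\<inverse> `` {m} = {n}"
proof (cases "R\<inverse> `` {m} = {}")
  case False
  then obtain n where "(n, m) \<in> R" by auto
  then show thesis using that(2) preimage_eq[OF assms] by blast
qed

lemma finite_preimage: "partial_inj R \<Longrightarrow> finite (R\<inverse> `` {m})"
  by (rule preimage_cases[of R m]) auto

text \<open>
  The basis vector at \<open>n\<close> goes to the one at \<open>m\<close> whenever \<open>(n, m) \<in> R\<close>, so that products of
  operators are relational composites in the opposite order.  Only partial injections yield a
  bounded operator; other relations give a junk value.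
\<close>

definition rel_op :: "('i \<times> 'i) set \<Rightarrow> 'i ell2 \<Rightarrow>\<^sub>L 'i ell2" where
  "rel_op R = Blinfun (\<lambda>x. Abs_ell2 (\<lambda>m. \<Sum>n\<in>R\<inverse> `` {m}. coord x n))"

text \<open>The junk value is excluded by showing the map to be a contraction. Each preimage has at
  most one element, so the square may be taken inside the inner sum; preimages of distinct points
  are disjoint, so the squares add up to a sum over distinct coordinates of x.\<close>

lemma coord_rel_op:
  assumes R: "partial_inj R"
  shows "coord (rel_op R x) m = (\<Sum>n\<in>R\<inverse> `` {m}. coord x n)"
proof -
  let ?f = "\<lambda>x m. \<Sum>n\<in>R\<inverse> `` {m}. coord x n"
  have le: "(\<Sum>m\<in>F. (cmod (?f x m))\<^sup>2) \<le> (norm x)\<^sup>2" if F: "finite F" for x F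
  proof -
    have "(cmod (?f x m))\<^sup>2 = (\<Sum>n\<in>R\<inverse> `` {m}. (cmod (coord x n))\<^sup>2)" for m
      by (rule preimage_cases[OF R, of m]) simp_all
    then have "(\<Sum>m\<in>F. (cmod (?f x m))\<^sup>2) = (\<Sum>m\<in>F. \<Sum>n\<in>R\<inverse> `` {m}. (cmod (coord x n))\<^sup>2)"
      by simp
    also have "\<dots> = (\<Sum>n\<in>(\<Union>m\<in>F. R\<inverse> `` {m}). (cmod (coord x n))\<^sup>2)"
    proof (rule sum.UNION_disjoint[symmetric])
      show "\<forall>i\<in>F. \<forall>j\<in>F. i \<noteq> j \<longrightarrow> R\<inverse> `` {i} \<inter> R\<inverse> `` {j} = {}"
        using R by (auto simp: partial_inj_def single_valued_def)
    qed (use F finite_preimage[OF R] in auto)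
    also have "\<dots> \<le> (norm x)\<^sup>2"
      using F finite_preimage[OF R] by (intro sum_coord_le_norm) blast
    finally show ?thesis .
  qed
  define A where "A x = Abs_ell2 (?f x)" for x
  have coord: "coord (A x) = ?f x" for x
    unfolding A_def using bounded_sums_in_ell2(1)[OF le] by (intro Abs_ell2_inverse) auto
  have "bounded_linear A"
  proof (rule bounded_linear_intro)
    fix x y and r :: real
    show "A (x + y) = A x + A y"
      by (rule ell2_eqI) (simp add: coord plus_ell2.rep_eq sum.distrib)
    show "A (r *\<^sub>R x) = r *\<^sub>R A x"
      by (rule ell2_eqI) (simp add: coord scaleR_ell2.rep_eq scaleR_sum_right)
    have "(norm (A x))\<^sup>2 \<le> (norm x)\<^sup>2"
      unfolding norm_ell2_square[of "A x"] coord by (rule bounded_sums_in_ell2(2)) (rule le)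
    then have "norm (A x) \<le> norm x"
      by (rule power2_le_imp_le) simp
    then show "norm (A x) \<le> norm x * 1" by simp
  qed
  then show ?thesis
    by (simp add: rel_op_def A_def[symmetric] bounded_linear_Blinfun_apply coord)
qed

lemma coord_rel_op_in: "partial_inj R \<Longrightarrow> (n, m) \<in> R \<Longrightarrow> coord (rel_op R x) m = coord x n"
  by (simp add: coord_rel_op preimage_eq)

lemma coord_rel_op_notin: "partial_inj R \<Longrightarrow> m \<notin> Range R \<Longrightarrow> coord (rel_op R x) m = 0"
  by (rule preimage_cases[of R m]) (auto simp: coord_rel_op)

text \<open>Both inner products equal the sum, over all pairs (n, m) in R, of the inner product of
  the n-th coordinate of x and the m-th coordinate of y; exchanging the roles of x and y amounts to
  reversing the pairs.\<close>

lemma is_adjoint_rel_op: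
  assumes R: "partial_inj R"
  shows "is_adjoint (rel_op R) (rel_op (R\<inverse>))"
proof -
  have *: "rel_op S x \<bullet> y = (\<Sum>\<^sub>\<infinity>p\<in>S. coord x (fst p) \<bullet> coord y (snd p))"
    if S: "partial_inj S" for S :: "('a \<times> 'a) set" and x y
  proof -
    have "rel_op S x \<bullet> y = (\<Sum>\<^sub>\<infinity>m\<in>snd ` S. coord (rel_op S x) m \<bullet> coord y m)"
      unfolding inner_ell2.rep_eq
      using coord_rel_op_notin[OF S] by (intro infsum_cong_neutral) (auto simp: Range_snd)
    also have "\<dots> = (\<Sum>\<^sub>\<infinity>p\<in>S. coord (rel_op S x) (snd p) \<bullet> coord y (snd p))"
      using S by (subst infsum_reindex)
        (auto simp: o_def inj_on_def partial_inj_def single_valued_def)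
    also have "\<dots> = (\<Sum>\<^sub>\<infinity>p\<in>S. coord x (fst p) \<bullet> coord y (snd p))"
      using coord_rel_op_in[OF S] by (intro infsum_cong) auto
    finally show ?thesis .
  qed
  have swap_R: "R\<inverse> = prod.swap ` R" by force
  have "rel_op R x \<bullet> y = x \<bullet> rel_op (R\<inverse>) y" for x y
  proof -
    have "rel_op (R\<inverse>) y \<bullet> x = (\<Sum>\<^sub>\<infinity>p\<in>prod.swap ` R. coord y (fst p) \<bullet> coord x (snd p))"
      unfolding swap_R by (rule *[OF partial_inj_converse[OF R], unfolded swap_R])
    also have "\<dots> = (\<Sum>\<^sub>\<infinity>p\<in>R. coord x (fst p) \<bullet> coord y (snd p))"
      by (subst infsum_reindex) (auto simp: o_def inner_commute)
    finally show ?thesis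
      using *[OF R, of x y] by (simp only: inner_commute[of x])
  qed
  then show ?thesis by (simp add: is_adjoint_def)
qed

lemma adj_rel_op: "partial_inj R \<Longrightarrow> adj (rel_op R) = rel_op (R\<inverse>)"
  by (rule adj_eqI[OF is_adjoint_rel_op])

lemma rel_op_in_ell2_ops:
  assumes "partial_inj R"
  shows "rel_op R \<in> ell2_ops"
proof -
  have "rel_op R o\<^sub>L scale_op c = scale_op c o\<^sub>L rel_op R" for c
    by (intro blinfun_eqI ell2_eqI) (simp add: coord_scale_op coord_rel_op[OF assms] sum_distrib_left)
  then show ?thesis using is_adjoint_rel_op[OF assms] by (auto simp: ell2_ops_def)
qed

lemma rel_op_compose:
  assumes R: "partial_inj R" and S: "partial_inj S"
  shows "rel_op S o\<^sub>L rel_op R = rel_op (R O S)"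
proof (intro blinfun_eqI ell2_eqI)
  fix x m
  note RS = partial_inj_comp[OF R S]
  \<comment> \<open>Going backwards from m, the trail breaks off at S, breaks off at R, or goes
    through; in the first two cases both sides vanish at m.\<close>
  consider "m \<notin> Range S" | k where "(k, m) \<in> S" "k \<notin> Range R"
    | k n where "(k, m) \<in> S" "(n, k) \<in> R"
    by blast
  then show "coord ((rel_op S o\<^sub>L rel_op R) x) m = coord (rel_op (R O S) x) m"
  proof cases
    case 1
    then have "m \<notin> Range (R O S)" by blast
    with 1 show ?thesis using coord_rel_op_notin[OF S] coord_rel_op_notin[OF RS] by simp
  next
    case 2
    then have "m \<notin> Range (R O S)"
      using S unfolding partial_inj_def single_valued_def by blast
    with 2 show ?thesis
      using coord_rel_op_in[OF S] coord_rel_op_notin[OF R] coord_rel_op_notin[OF RS] by simp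
  next
    case 3
    then have "(n, m) \<in> R O S" by blast
    with 3 show ?thesis
      using coord_rel_op_in[OF S] coord_rel_op_in[OF R] coord_rel_op_in[OF RS] by simp
  qed
qed

lemma coord_sum: "coord (\<Sum>i\<in>I. x i) m = (\<Sum>i\<in>I. coord (x i) m)"
  by (induction I rule: infinite_finite_induct) (simp_all add: zero_ell2.rep_eq plus_ell2.rep_eq)

text \<open>This produces the finite sums of (TCK3). Since the ranges are disjoint, each coordinate
  of the output receives a contribution from at most one index.\<close>

lemma rel_op_UNION:
  assumes I: "finite I" and inj: "partial_inj (\<Union>i\<in>I. R i)"
    and disj: "\<And>i j. \<lbrakk>i \<in> I; j \<in> I; Range (R i) \<inter> Range (R j) \<noteq> {}\<rbrakk> \<Longrightarrow> i = j"
  shows "rel_op (\<Union>i\<in>I. R i) = (\<Sum>i\<in>I. rel_op (R i))"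
proof (intro blinfun_eqI ell2_eqI)
  fix x m
  have R: "partial_inj (R i)" if "i \<in> I" for i
    using partial_inj_subset[OF inj] that by blast
  have "coord (rel_op (\<Union>i\<in>I. R i) x) m = (\<Sum>n\<in>(\<Union>i\<in>I. (R i)\<inverse> `` {m}). coord x n)"
    unfolding coord_rel_op[OF inj] by (intro sum.cong) auto
  also have "\<dots> = (\<Sum>i\<in>I. \<Sum>n\<in>(R i)\<inverse> `` {m}. coord x n)"
  proof (rule sum.UNION_disjoint)
    show "\<forall>i\<in>I. finite ((R i)\<inverse> `` {m})"
      by (intro ballI finite_preimage R)
    show "\<forall>i\<in>I. \<forall>j\<in>I. i \<noteq> j \<longrightarrow> (R i)\<inverse> `` {m} \<inter> (R j)\<inverse> `` {m} = {}"
    proof (intro ballI impI)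
      fix i j assume "i \<in> I" "j \<in> I" "i \<noteq> j"
      then have "Range (R i) \<inter> Range (R j) = {}" by (meson disj)
      then show "(R i)\<inverse> `` {m} \<inter> (R j)\<inverse> `` {m} = {}" by blast
    qed
  qed (rule I)
  also have "\<dots> = coord ((\<Sum>i\<in>I. rel_op (R i)) x) m"
    by (simp add: blinfun.sum_left coord_sum coord_rel_op R)
  finally show "coord (rel_op (\<Union>i\<in>I. R i) x) m = coord ((\<Sum>i\<in>I. rel_op (R i)) x) m" .
qed

text \<open>Applied to identity relations, this turns a factor of a gap product back into the
  operator of a relation.\<close>

lemma rel_op_diff:
  assumes R: "partial_inj R" and S: "S \<subseteq> R"
  shows "rel_op R - rel_op S = rel_op (R - S)"
proof (intro blinfun_eqI ell2_eqI)
  fix x m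
  have "(R - S)\<inverse> `` {m} = R\<inverse> `` {m} - S\<inverse> `` {m}" by blast
  moreover have "S\<inverse> `` {m} \<subseteq> R\<inverse> `` {m}" using S by blast
  ultimately show "coord ((rel_op R - rel_op S) x) m = coord (rel_op (R - S) x) m"
    using R S by (simp add: blinfun.diff_left minus_ell2.rep_eq coord_rel_op
        partial_inj_subset[of R] sum_diff finite_preimage)
qed

lemma rel_op_empty [simp]: "rel_op {} = 0"
  by (intro blinfun_eqI ell2_eqI)
    (simp add: coord_rel_op partial_inj_def single_valued_def zero_ell2.rep_eq)

lemma rel_op_nonzero:
  assumes R: "partial_inj R" and "(n, m) \<in> R"
  shows "rel_op R \<noteq> 0"
proof
  assume 0: "rel_op R = 0"
  have "(\<lambda>i. (cmod (if i = n then 1 else 0))\<^sup>2) summable_on UNIV"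
    by (rule finite_nonzero_values_imp_summable_on) (rule finite_subset[of _ "{n}"], auto)
  then have "coord (Abs_ell2 (\<lambda>i. if i = n then 1 else 0)) n = 1"
    by (simp add: Abs_ell2_inverse)
  then show False
    using coord_rel_op_in[OF assms] 0 by (metis blinfun.zero_left zero_ell2.rep_eq zero_neq_one)
qed

section \<open>Prefixes in a higher-rank graph\<close>

context k_graph
begin

text \<open>The prefix order takes the place of the definite description \<open>initial\<close>: it
  is transitive and needs no side condition on degrees. \<open>initial_eqI\<close> and
  \<open>MCE_iff\<close> translate between the two.\<close>

definition pre :: "'a \<Rightarrow> 'a \<Rightarrow> bool" where
  "pre \<mu> \<tau> \<longleftrightarrow> \<mu> \<in> mor L \<and> (\<exists>\<nu> \<in> mor L. src L \<mu> = rng L \<nu> \<and> \<tau> = cmp L \<mu> \<nu>)"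

lemma preI: "\<lbrakk>\<mu> \<in> mor L; \<nu> \<in> mor L; src L \<mu> = rng L \<nu>\<rbrakk> \<Longrightarrow> pre \<mu> (cmp L \<mu> \<nu>)"
  by (auto simp: pre_def)

lemma preE:
  assumes "pre \<mu> \<tau>"
  obtains \<nu> where "\<mu> \<in> mor L" "\<nu> \<in> mor L" "src L \<mu> = rng L \<nu>" "\<tau> = cmp L \<mu> \<nu>"
  using assms by (auto simp: pre_def)

lemma pre_mor: "pre \<mu> \<tau> \<Longrightarrow> \<mu> \<in> mor L \<and> \<tau> \<in> mor L"
  by (auto simp: pre_def cmp_closed)

lemma pre_rng: "pre \<mu> \<tau> \<Longrightarrow> rng L \<mu> = rng L \<tau>"
  by (auto simp: pre_def rng_cmp)

lemma pre_refl: "\<mu> \<in> mor L \<Longrightarrow> pre \<mu> \<mu>"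
  using preI[of \<mu> "src L \<mu>"] by (simp add: src_closed rng_src cmp_src)

lemma pre_trans: "pre \<mu> \<nu> \<Longrightarrow> pre \<nu> \<tau> \<Longrightarrow> pre \<mu> \<tau>"
proof -
  assume "pre \<mu> \<nu>" "pre \<nu> \<tau>"
  then obtain a b where "\<mu> \<in> mor L" "a \<in> mor L" "src L \<mu> = rng L a" "\<nu> = cmp L \<mu> a"
    "b \<in> mor L" "src L \<nu> = rng L b" "\<tau> = cmp L \<nu> b" by (auto elim!: preE)
  then show "pre \<mu> \<tau>"
    using preI[of \<mu> "cmp L a b"] by (simp add: cmp_assoc src_cmp rng_cmp cmp_closed)
qed

lemma pre_cmp_right:
  assumes "pre \<mu> \<nu>" "\<alpha> \<in> mor L" "src L \<alpha> = rng L \<mu>"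
  shows "pre (cmp L \<alpha> \<mu>) (cmp L \<alpha> \<nu>)"
proof -
  obtain a where "\<mu> \<in> mor L" "a \<in> mor L" "src L \<mu> = rng L a" "\<nu> = cmp L \<mu> a"
    using assms(1) by (rule preE)
  then show ?thesis
    using preI[of "cmp L \<alpha> \<mu>" a] assms by (simp add: cmp_assoc src_cmp cmp_closed)
qed

section \<open>Unique factorization and comparison of prefixes\<close>

lemma factorization_unique:
  assumes "\<mu> \<in> mor L" "\<nu> \<in> mor L" "src L \<mu> = rng L \<nu>"
    and "\<mu>' \<in> mor L" "\<nu>' \<in> mor L" "src L \<mu>' = rng L \<nu>'"
    and "cmp L \<mu> \<nu> = cmp L \<mu>' \<nu>'" and "deg L \<mu> = deg L \<mu>'"
  shows "\<mu> = \<mu>' \<and> \<nu> = \<nu>'"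
proof -
  have "deg L \<mu> + deg L \<nu> = deg L \<mu>' + deg L \<nu>'"
    using assms deg_cmp by metis
  then have "deg L \<nu> = deg L \<nu>'" using assms(8) by simp
  obtain p where p: "\<And>\<alpha> \<beta>. \<lbrakk>\<alpha> \<in> mor L; \<beta> \<in> mor L; src L \<alpha> = rng L \<beta>;
      cmp L \<mu> \<nu> = cmp L \<alpha> \<beta>; deg L \<alpha> = deg L \<mu>; deg L \<beta> = deg L \<nu>\<rbrakk> \<Longrightarrow> (\<alpha>, \<beta>) = p"
    using unique_factorization[OF cmp_closed[OF assms(1-3)] deg_cmp[OF assms(1-3)]]
    by (auto simp: Ex1_def)
  have "(\<mu>, \<nu>) = p" "(\<mu>', \<nu>') = p"
    using assms \<open>deg L \<nu> = deg L \<nu>'\<close> by (intro p; simp)+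
  then show ?thesis by auto
qed

lemma cancel:
  assumes "\<mu> \<in> mor L" "\<nu> \<in> mor L" "src L \<mu> = rng L \<nu>" "\<nu>' \<in> mor L" "src L \<mu> = rng L \<nu>'"
    and "cmp L \<mu> \<nu> = cmp L \<mu> \<nu>'"
  shows "\<nu> = \<nu>'"
  using factorization_unique[of \<mu> \<nu> \<mu> \<nu>'] assms by simp

lemma pre_deg: "pre \<mu> \<tau> \<Longrightarrow> deg L \<mu> \<le> deg L \<tau>"
  by (auto simp: pre_def deg_cmp less_eq_vec_def)

lemma pre_deg_unique:
  assumes "pre \<mu> \<tau>" "pre \<nu> \<tau>" "deg L \<mu> = deg L \<nu>"
  shows "\<mu> = \<nu>"
  using assms factorization_unique by (auto elim!: preE)

lemma pre_exists:
  assumes "\<tau> \<in> mor L" "m \<le> deg L \<tau>"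
  obtains \<mu> where "pre \<mu> \<tau>" "deg L \<mu> = m"
proof -
  have "deg L \<tau> = m + (\<chi> i. deg L \<tau> $ i - m $ i)"
    using assms(2) by (simp add: vec_eq_iff less_eq_vec_def)
  from unique_factorization[OF assms(1) this] show thesis
    using that by (auto simp: Ex1_def pre_def)
qed

text \<open>A prefix of a fixed path is determined by its degree. Cutting \<nu> at the degree of
  \<mu> gives a prefix of \<tau> of the same degree as \<mu>, which must be \<mu>.\<close>

lemma pre_of_deg_le:
  assumes "pre \<mu> \<tau>" "pre \<nu> \<tau>" "deg L \<mu> \<le> deg L \<nu>"
  shows "pre \<mu> \<nu>"
proof -
  obtain \<mu>' where \<mu>': "pre \<mu>' \<nu>" "deg L \<mu>' = deg L \<mu>"
    using pre_exists[of \<nu> "deg L \<mu>"] assms pre_mor by blast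
  then show ?thesis using pre_deg_unique[of \<mu>' \<tau> \<mu>] pre_trans assms by blast
qed

section \<open>Initial segments and minimal common extensions\<close>

lemma initial_eqI:
  assumes "pre \<mu> \<tau>"
  shows "initial L \<tau> (deg L \<mu>) = \<mu>"
proof -
  have "initial L \<tau> (deg L \<mu>) = (THE \<mu>'. pre \<mu>' \<tau> \<and> deg L \<mu>' = deg L \<mu>)"
    unfolding initial_def pre_def by (rule arg_cong[of _ _ The]) auto
  also have "\<dots> = \<mu>"
    by (rule the_equality) (use assms pre_deg_unique in blast)+
  finally show ?thesis .
qed

lemma initial_pre:
  assumes "\<tau> \<in> mor L" "m \<le> deg L \<tau>"
  shows "pre (initial L \<tau> m) \<tau>" "deg L (initial L \<tau> m) = m"
  using pre_exists[OF assms] initial_eqI by metis+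

lemma le_deg_join: "deg L \<mu> \<le> deg_join (deg L \<mu>) (deg L \<nu>)" "deg L \<nu> \<le> deg_join (deg L \<mu>) (deg L \<nu>)"
  by (simp_all add: deg_join_def less_eq_vec_def)

lemma deg_join_least: "m \<le> n \<Longrightarrow> m' \<le> n \<Longrightarrow> deg_join m m' \<le> n"
  by (simp add: deg_join_def less_eq_vec_def)

lemma MCE_iff: "\<tau> \<in> MCE L \<mu> \<nu> \<longleftrightarrow> pre \<mu> \<tau> \<and> pre \<nu> \<tau> \<and> deg L \<tau> = deg_join (deg L \<mu>) (deg L \<nu>)"
proof
  assume "\<tau> \<in> MCE L \<mu> \<nu>"
  then have *: "\<tau> \<in> mor L" "deg L \<tau> = deg_join (deg L \<mu>) (deg L \<nu>)"
    "initial L \<tau> (deg L \<mu>) = \<mu>" "initial L \<tau> (deg L \<nu>) = \<nu>"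
    by (auto simp: MCE_def paths_of_degree_def)
  then show "pre \<mu> \<tau> \<and> pre \<nu> \<tau> \<and> deg L \<tau> = deg_join (deg L \<mu>) (deg L \<nu>)"
    using initial_pre(1)[OF *(1)] le_deg_join by metis
next
  assume "pre \<mu> \<tau> \<and> pre \<nu> \<tau> \<and> deg L \<tau> = deg_join (deg L \<mu>) (deg L \<nu>)"
  then show "\<tau> \<in> MCE L \<mu> \<nu>"
    by (auto simp: MCE_def paths_of_degree_def initial_eqI dest: pre_mor)
qed

text \<open>Any common extension, cut at the join of the two degrees, becomes a minimal one, since
  both paths survive the cut.\<close>

lemma MCE_below:
  assumes "pre \<mu> \<tau>" "pre \<nu> \<tau>"
  obtains \<tau>' where "\<tau>' \<in> MCE L \<mu> \<nu>" "pre \<tau>' \<tau>"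
proof -
  obtain \<tau>' where "pre \<tau>' \<tau>" "deg L \<tau>' = deg_join (deg L \<mu>) (deg L \<nu>)"
    using pre_exists[of \<tau> "deg_join (deg L \<mu>) (deg L \<nu>)"] assms
    by (metis deg_join_least pre_deg pre_mor)
  then show thesis
    using that pre_of_deg_le[of _ \<tau> \<tau>'] assms le_deg_join by (metis MCE_iff)
qed

section \<open>Vertices and edges\<close>

lemma vertex_iff: "v \<in> vertices L \<longleftrightarrow> v \<in> mor L \<and> deg L v = 0"
  by (auto simp: vertices_def paths_of_degree_def)

lemma vertex_rng: "v \<in> vertices L \<Longrightarrow> rng L v = v \<and> src L v = v"
  by (auto simp: vertices_eq_identities rng_rng src_rng)

lemma rng_vertex: "\<mu> \<in> mor L \<Longrightarrow> rng L \<mu> \<in> vertices L"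
  by (simp add: vertices_eq_identities)

lemma edge_mor: "e \<in> edges L \<Longrightarrow> e \<in> mor L"
  by (auto simp: edges_def paths_of_degree_def)

lemma edge_deg: "e \<in> edges L \<Longrightarrow> \<exists>i. deg L e = axis i 1"
  by (auto simp: edges_def paths_of_degree_def)

lemma axis_le_iff: "axis i (1::nat) \<le> m \<longleftrightarrow> 1 \<le> m $ i"
  by (auto simp: less_eq_vec_def axis_def)

lemma pre_edge:
  assumes "pre e f" "e \<in> edges L" "f \<in> edges L"
  shows "e = f"
proof -
  obtain i j where ij: "deg L e = axis i 1" "deg L f = axis j 1"
    using edge_deg assms by meson
  have "1 \<le> axis j (1::nat) $ i"
    using pre_deg[OF assms(1)] unfolding ij axis_le_iff .
  then have "i = j" by (cases "i = j") (auto simp: axis_def)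
  then have "deg L e = deg L f" using ij by simp
  then show "e = f"
    using pre_deg_unique[OF assms(1) pre_refl] pre_mor[OF assms(1)] by simp
qed

lemma edge_not_pre_vertex:
  assumes "e \<in> edges L" "v \<in> vertices L"
  shows "\<not> pre e v"
proof
  assume "pre e v"
  obtain i where i: "deg L e = axis i 1"
    using edge_deg assms(1) by blast
  have "deg L v = 0" using assms(2) by (simp add: vertex_iff)
  then show False
    using pre_deg[OF \<open>pre e v\<close>] unfolding i axis_le_iff by simp
qed

lemma first_edge:
  assumes "\<mu> \<in> mor L" "deg L \<mu> \<noteq> 0"
  obtains e \<nu> where "e \<in> edges L" "\<nu> \<in> mor L" "src L e = rng L \<nu>" "\<mu> = cmp L e \<nu>"
proof -
  obtain i where "deg L \<mu> $ i \<noteq> 0" using assms(2) by (auto simp: vec_eq_iff)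
  then have "axis i 1 \<le> deg L \<mu>" unfolding axis_le_iff by simp
  then obtain e where "pre e \<mu>" "deg L e = axis i 1"
    using pre_exists assms(1) by blast
  then show thesis
    using that by (auto simp: edges_def paths_of_degree_def elim!: preE)
qed

lemma FE_edges_facts:
  assumes "E \<in> FE_edges L"
  shows "finite E" "E \<noteq> {}" "E \<subseteq> edges L" "range_of L E \<in> vertices L"
    "\<And>e. e \<in> E \<Longrightarrow> rng L e = range_of L E"
proof -
  obtain v where v: "finite E" "E \<subseteq> edges L" "v \<in> vertices L" "E \<subseteq> into L v (mor L)" "exhaustive L v E"
    using assms by (auto simp: FE_edges_def FE_def)
  show "finite E" "E \<subseteq> edges L" by fact+
  have "v \<in> into L v (mor L)" using v(3) by (auto simp: into_def vertex_iff vertex_rng)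
  then show "E \<noteq> {}" using v(5) by (auto simp: exhaustive_def)
  moreover have rv: "rng L e = v" if "e \<in> E" for e using v(4) that by (auto simp: into_def)
  ultimately have "rng L ` E = {v}" by auto
  then have "range_of L E = v" by (simp add: range_of_def)
  then show "range_of L E \<in> vertices L" "\<And>e. e \<in> E \<Longrightarrow> rng L e = range_of L E"
    using v rv by auto
qed

end

section \<open>Path filters\<close>

context k_graph
begin

lemma pre_cancel:
  assumes "\<mu> \<in> mor L" "\<nu> \<in> mor L" "src L \<mu> = rng L \<nu>" "\<tau> \<in> mor L" "src L \<mu> = rng L \<tau>"
    and "pre (cmp L \<mu> \<nu>) (cmp L \<mu> \<tau>)"
  shows "pre \<nu> \<tau>"
proof -
  obtain \<sigma> where \<sigma>: "\<sigma> \<in> mor L" "src L (cmp L \<mu> \<nu>) = rng L \<sigma>" "cmp L \<mu> \<tau> = cmp L (cmp L \<mu> \<nu>) \<sigma>"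
    using assms(6) by (auto elim: preE)
  have s: "src L \<nu> = rng L \<sigma>" using \<sigma>(2) assms by (simp add: src_cmp)
  have "cmp L \<mu> \<tau> = cmp L \<mu> (cmp L \<nu> \<sigma>)"
    using \<sigma>(3) cmp_assoc[OF assms(1,2) \<sigma>(1) assms(3) s] by simp
  then have "\<tau> = cmp L \<nu> \<sigma>"
    by (rule cancel[rotated 5])
      (use assms \<sigma> s in \<open>simp_all add: cmp_closed rng_cmp\<close>)
  then show ?thesis using preI[OF assms(2) \<sigma>(1) s] by simp
qed

text \<open>A finite or infinite path is encoded by the set of its initial segments.\<close>

definition path_filter :: "'a set \<Rightarrow> bool" where
  "path_filter x \<longleftrightarrow> x \<noteq> {} \<and> x \<subseteq> mor L \<and> (\<forall>\<mu> \<in> x. \<forall>\<nu>. pre \<nu> \<mu> \<longrightarrow> \<nu> \<in> x) \<and>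
     (\<forall>\<mu> \<in> x. \<forall>\<nu> \<in> x. \<exists>\<tau> \<in> x. pre \<mu> \<tau> \<and> pre \<nu> \<tau>)"

text \<open>Directedness gives all members of a filter the same range, so the choice of a member is
  immaterial.\<close>

definition filter_rng :: "'a set \<Rightarrow> 'a" where
  "filter_rng x = rng L (SOME \<mu>. \<mu> \<in> x)"

text \<open>The products \<mu>\<tau> are not closed under prefixes, and for k > 1 it does not
  suffice to add the prefixes of \<mu>, since \<mu>\<tau> may begin with paths that are not
  comparable with \<mu>.\<close>

definition act :: "'a \<Rightarrow> 'a set \<Rightarrow> 'a set" where
  "act \<mu> x = {\<nu>. \<exists>\<tau> \<in> x. pre \<nu> (cmp L \<mu> \<tau>)}"

definition shift :: "'a \<Rightarrow> 'a set \<Rightarrow> 'a set" where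
  "shift \<mu> x = {\<nu> \<in> mor L. src L \<mu> = rng L \<nu> \<and> cmp L \<mu> \<nu> \<in> x}"

lemma path_filter_mor: "path_filter x \<Longrightarrow> \<mu> \<in> x \<Longrightarrow> \<mu> \<in> mor L"
  by (auto simp: path_filter_def)

lemma path_filter_down: "path_filter x \<Longrightarrow> \<mu> \<in> x \<Longrightarrow> pre \<nu> \<mu> \<Longrightarrow> \<nu> \<in> x"
  by (auto simp: path_filter_def)

lemma path_filter_directed:
  assumes "path_filter x" "\<mu> \<in> x" "\<nu> \<in> x"
  obtains \<tau> where "\<tau> \<in> x" "pre \<mu> \<tau>" "pre \<nu> \<tau>"
  using assms unfolding path_filter_def by blast

lemma filter_rng_eq:
  assumes "path_filter x" "\<mu> \<in> x"
  shows "rng L \<mu> = filter_rng x"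
proof -
  have "(SOME \<nu>. \<nu> \<in> x) \<in> x" using assms(2) by (rule someI)
  with assms obtain \<tau> where "pre \<mu> \<tau>" "pre (SOME \<nu>. \<nu> \<in> x) \<tau>"
    by (meson path_filter_directed)
  then show ?thesis by (simp add: filter_rng_def pre_rng)
qed

lemma filter_rng_in:
  assumes "path_filter x"
  shows "filter_rng x \<in> x"
proof -
  obtain \<mu> where \<mu>: "\<mu> \<in> x" using assms by (auto simp: path_filter_def)
  have m: "\<mu> \<in> mor L" using path_filter_mor[OF assms \<mu>] .
  have "pre (rng L \<mu>) (cmp L (rng L \<mu>) \<mu>)"
    using m by (intro preI) (simp_all add: rng_closed src_rng)
  then show ?thesis
    using path_filter_down[OF assms \<mu>] filter_rng_eq[OF assms \<mu>] cmp_rng[OF m] by metis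
qed

lemma path_filter_deg_unique:
  assumes "path_filter x" "\<mu> \<in> x" "\<nu> \<in> x" "deg L \<mu> = deg L \<nu>"
  shows "\<mu> = \<nu>"
  using assms by (meson path_filter_directed pre_deg_unique)

lemma path_filter_act:
  assumes x: "path_filter x" and \<mu>: "\<mu> \<in> mor L" "src L \<mu> = filter_rng x"
  shows "path_filter (act \<mu> x)" "\<mu> \<in> act \<mu> x" "filter_rng (act \<mu> x) = rng L \<mu>"
proof -
  have s: "src L \<mu> = rng L \<tau>" "\<tau> \<in> mor L" if "\<tau> \<in> x" for \<tau>
    using \<mu> filter_rng_eq[OF x that] path_filter_mor[OF x that] by simp_all
  show 1: "\<mu> \<in> act \<mu> x"
    using filter_rng_in[OF x] s preI[OF \<mu>(1)] unfolding act_def by blast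
  show 2: "path_filter (act \<mu> x)"
    unfolding path_filter_def
  proof (intro conjI ballI allI impI)
    show "act \<mu> x \<noteq> {}" using 1 by blast
    show "act \<mu> x \<subseteq> mor L" using pre_mor by (auto simp: act_def)
    show "\<nu>' \<in> act \<mu> x" if "\<nu> \<in> act \<mu> x" "pre \<nu>' \<nu>" for \<nu> \<nu>'
      using that pre_trans unfolding act_def by blast
    fix \<nu>1 \<nu>2 assume "\<nu>1 \<in> act \<mu> x" "\<nu>2 \<in> act \<mu> x"
    then obtain \<tau>1 \<tau>2 where \<tau>: "\<tau>1 \<in> x" "pre \<nu>1 (cmp L \<mu> \<tau>1)" "\<tau>2 \<in> x" "pre \<nu>2 (cmp L \<mu> \<tau>2)"
      unfolding act_def by blast
    obtain \<tau> where t: "\<tau> \<in> x" "pre \<tau>1 \<tau>" "pre \<tau>2 \<tau>"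
      using path_filter_directed[OF x \<tau>(1,3)] .
    have "pre \<nu>1 (cmp L \<mu> \<tau>)" "pre \<nu>2 (cmp L \<mu> \<tau>)"
      using \<tau> t s \<mu>(1) pre_trans pre_cmp_right by metis+
    moreover have "cmp L \<mu> \<tau> \<in> act \<mu> x"
      using t(1) s[OF t(1)] \<mu>(1) pre_refl cmp_closed unfolding act_def by blast
    ultimately show "\<exists>\<tau>\<in>act \<mu> x. pre \<nu>1 \<tau> \<and> pre \<nu>2 \<tau>" by blast
  qed
  show "filter_rng (act \<mu> x) = rng L \<mu>"
    using filter_rng_eq[OF 2 1] by simp
qed

lemma cmp_in_act_iff:
  assumes x: "path_filter x" and \<mu>: "\<mu> \<in> mor L" "src L \<mu> = filter_rng x"
    and \<nu>: "\<nu> \<in> mor L" "src L \<mu> = rng L \<nu>"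
  shows "cmp L \<mu> \<nu> \<in> act \<mu> x \<longleftrightarrow> \<nu> \<in> x"
proof
  assume "\<nu> \<in> x"
  then show "cmp L \<mu> \<nu> \<in> act \<mu> x"
    using \<mu> \<nu> pre_refl cmp_closed unfolding act_def by blast
next
  assume "cmp L \<mu> \<nu> \<in> act \<mu> x"
  then obtain \<tau> where \<tau>: "\<tau> \<in> x" "pre (cmp L \<mu> \<nu>) (cmp L \<mu> \<tau>)" unfolding act_def by blast
  have t: "\<tau> \<in> mor L" "src L \<mu> = rng L \<tau>"
    using path_filter_mor[OF x \<tau>(1)] filter_rng_eq[OF x \<tau>(1)] \<mu> by simp_all
  have "pre \<nu> \<tau>" using pre_cancel \<mu> \<nu> t \<tau>(2) by blast
  then show "\<nu> \<in> x" using path_filter_down[OF x \<tau>(1)] by blast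
qed

lemma shift_act:
  assumes x: "path_filter x" and \<mu>: "\<mu> \<in> mor L" "src L \<mu> = filter_rng x"
  shows "shift \<mu> (act \<mu> x) = x"
proof (rule Set.set_eqI)
  fix \<nu>
  have "\<nu> \<in> mor L \<and> src L \<mu> = rng L \<nu>" if "\<nu> \<in> x"
    using that path_filter_mor[OF x] filter_rng_eq[OF x] \<mu>(2) by simp
  then show "\<nu> \<in> shift \<mu> (act \<mu> x) \<longleftrightarrow> \<nu> \<in> x"
    using cmp_in_act_iff[OF x \<mu>, of \<nu>] unfolding shift_def by blast
qed

lemma path_filter_shift:
  assumes x: "path_filter x" and \<mu>: "\<mu> \<in> x"
  shows "path_filter (shift \<mu> x)" "filter_rng (shift \<mu> x) = src L \<mu>" "act \<mu> (shift \<mu> x) = x"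
proof -
  have m: "\<mu> \<in> mor L" using path_filter_mor[OF x \<mu>] .
  \<comment> \<open>The members of x that begin with \<mu> are cofinal in x. This yields both the
    directedness of the shifted filter and the recovery of x from it.\<close>
  have above: "\<exists>\<tau> \<in> shift \<mu> x. pre \<nu> (cmp L \<mu> \<tau>)" if \<nu>: "\<nu> \<in> x" for \<nu>
  proof -
    obtain \<tau> where \<tau>: "\<tau> \<in> x" "pre \<mu> \<tau>" "pre \<nu> \<tau>"
      using path_filter_directed[OF x \<mu> \<nu>] .
    then show ?thesis by (auto simp: shift_def elim!: preE[of \<mu>])
  qed
  have s: "src L \<mu> \<in> shift \<mu> x"
    using m \<mu> by (simp add: shift_def src_closed rng_src cmp_src)
  show 1: "path_filter (shift \<mu> x)"
    unfolding path_filter_def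
  proof (intro conjI ballI allI impI)
    show "shift \<mu> x \<noteq> {}" using s by blast
    show "shift \<mu> x \<subseteq> mor L" by (auto simp: shift_def)
    show "\<nu>' \<in> shift \<mu> x" if "\<nu> \<in> shift \<mu> x" "pre \<nu>' \<nu>" for \<nu> \<nu>'
    proof -
      have "pre (cmp L \<mu> \<nu>') (cmp L \<mu> \<nu>)"
        using that m by (intro pre_cmp_right) (auto simp: shift_def pre_rng)
      then show ?thesis
        using that path_filter_down[OF x] pre_mor[OF that(2)] pre_rng[OF that(2)]
        by (auto simp: shift_def)
    qed
    fix \<nu>1 \<nu>2 assume \<nu>: "\<nu>1 \<in> shift \<mu> x" "\<nu>2 \<in> shift \<mu> x"
    then have "cmp L \<mu> \<nu>1 \<in> x" "cmp L \<mu> \<nu>2 \<in> x" by (simp_all add: shift_def)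
    then obtain \<tau> where \<tau>: "\<tau> \<in> x" "pre (cmp L \<mu> \<nu>1) \<tau>" "pre (cmp L \<mu> \<nu>2) \<tau>"
      by (rule path_filter_directed[OF x])
    obtain \<rho> where \<rho>: "\<rho> \<in> shift \<mu> x" "pre \<tau> (cmp L \<mu> \<rho>)" using above[OF \<tau>(1)] by blast
    have *: "pre \<nu> \<rho>" if "\<nu> \<in> shift \<mu> x" "pre (cmp L \<mu> \<nu>) (cmp L \<mu> \<rho>)" for \<nu>
      using pre_cancel m that \<rho>(1) unfolding shift_def by blast
    show "\<exists>\<tau>\<in>shift \<mu> x. pre \<nu>1 \<tau> \<and> pre \<nu>2 \<tau>"
      using * \<nu> \<tau> \<rho> pre_trans by blast
  qed
  show 2: "filter_rng (shift \<mu> x) = src L \<mu>"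
    using filter_rng_eq[OF 1 s] m by (simp add: rng_src)
  show "act \<mu> (shift \<mu> x) = x"
  proof
    show "act \<mu> (shift \<mu> x) \<subseteq> x"
      using path_filter_down[OF x] unfolding act_def shift_def by blast
    show "x \<subseteq> act \<mu> (shift \<mu> x)" using above unfolding act_def by blast
  qed
qed

lemma act_cmp:
  assumes x: "path_filter x" and "\<mu> \<in> mor L" "\<nu> \<in> mor L" "src L \<mu> = rng L \<nu>" "src L \<nu> = filter_rng x"
  shows "act (cmp L \<mu> \<nu>) x = act \<mu> (act \<nu> x)"
proof -
  have assoc: "cmp L (cmp L \<mu> \<nu>) \<tau> = cmp L \<mu> (cmp L \<nu> \<tau>)" "pre (cmp L \<nu> \<tau>) (cmp L \<nu> \<tau>)"
    if "\<tau> \<in> x" for \<tau>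
    using assms filter_rng_eq[OF x that] path_filter_mor[OF x that]
    by (simp_all add: cmp_assoc pre_refl cmp_closed)
  have "pre (cmp L \<mu> \<rho>) (cmp L \<mu> (cmp L \<nu> \<tau>))" if "\<tau> \<in> x" "pre \<rho> (cmp L \<nu> \<tau>)" for \<rho> \<tau>
    using assms that filter_rng_eq[OF x that(1)] path_filter_mor[OF x that(1)] pre_rng[OF that(2)]
    by (intro pre_cmp_right) (simp_all add: rng_cmp)
  note mono = this
  show ?thesis
  proof (rule Set.set_eqI)
    fix \<rho>
    show "\<rho> \<in> act (cmp L \<mu> \<nu>) x \<longleftrightarrow> \<rho> \<in> act \<mu> (act \<nu> x)"
    proof
      assume "\<rho> \<in> act (cmp L \<mu> \<nu>) x"
      then obtain \<tau> where "\<tau> \<in> x" "pre \<rho> (cmp L \<mu> (cmp L \<nu> \<tau>))"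
        using assoc(1) by (auto simp: act_def)
      then show "\<rho> \<in> act \<mu> (act \<nu> x)" using assoc(2) unfolding act_def by blast
    next
      assume "\<rho> \<in> act \<mu> (act \<nu> x)"
      then obtain \<tau> \<rho>' where \<tau>: "\<tau> \<in> x" "pre \<rho>' (cmp L \<nu> \<tau>)" "pre \<rho> (cmp L \<mu> \<rho>')"
        by (auto simp: act_def)
      then have "pre \<rho> (cmp L (cmp L \<mu> \<nu>) \<tau>)"
        using pre_trans[OF \<tau>(3) mono[OF \<tau>(1,2)]] assoc(1)[OF \<tau>(1)] by simp
      then show "\<rho> \<in> act (cmp L \<mu> \<nu>) x" using \<tau>(1) unfolding act_def by blast
    qed
  qed
qed

lemma act_vertex:
  assumes x: "path_filter x" and "v = filter_rng x"
  shows "act v x = x"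
proof -
  have v: "cmp L v \<tau> = \<tau>" "\<tau> \<in> mor L" if "\<tau> \<in> x" for \<tau>
    using filter_rng_eq[OF x that] path_filter_mor[OF x that] assms(2) cmp_rng by metis+
  then show ?thesis
    unfolding act_def using path_filter_down[OF x] pre_refl by auto blast
qed

section \<open>Compatibility and its invariance under deletion and prepending\<close>

definition compatible :: "'a set set \<Rightarrow> 'a set \<Rightarrow> bool" where
  "compatible \<E> x \<longleftrightarrow> path_filter x \<and>
     (\<forall>\<alpha> \<in> x. \<forall>E \<in> \<E>. range_of L E = src L \<alpha> \<longrightarrow> (\<exists>e \<in> E. cmp L \<alpha> e \<in> x))"

lemma compatible_shift:
  assumes eff: "efficient L \<E>" and x: "compatible \<E> x" and \<mu>: "\<mu> \<in> x"
  shows "compatible \<E> (shift \<mu> x)"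
  unfolding compatible_def
proof (intro conjI ballI impI)
  have px: "path_filter x" using x by (simp add: compatible_def)
  show "path_filter (shift \<mu> x)" using path_filter_shift[OF px \<mu>] by blast
  have m: "\<mu> \<in> mor L" using path_filter_mor[OF px \<mu>] .
  fix \<alpha> E assume \<alpha>: "\<alpha> \<in> shift \<mu> x" and E: "E \<in> \<E>" "range_of L E = src L \<alpha>"
  have a: "\<alpha> \<in> mor L" "src L \<mu> = rng L \<alpha>" "cmp L \<mu> \<alpha> \<in> x" using \<alpha> by (auto simp: shift_def)
  then have "range_of L E = src L (cmp L \<mu> \<alpha>)" using E m by (simp add: src_cmp)
  then obtain e where e: "e \<in> E" "cmp L (cmp L \<mu> \<alpha>) e \<in> x"
    using x a E(1) unfolding compatible_def by blast
  have "E \<in> FE_edges L" using eff E(1) by (auto simp: efficient_def)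
  then have "e \<in> mor L" "rng L e = src L \<alpha>"
    using FE_edges_facts[of E] e E(2) edge_mor by auto
  then have "cmp L \<alpha> e \<in> shift \<mu> x"
    using a e m by (simp add: shift_def cmp_assoc cmp_closed rng_cmp)
  then show "\<exists>e\<in>E. cmp L \<alpha> e \<in> shift \<mu> x" using e by blast
qed

lemma efficient_FE: "efficient L \<E> \<Longrightarrow> E \<in> \<E> \<Longrightarrow> E \<in> FE_edges L"
  by (auto simp: efficient_def)

lemma efficient_mor:
  assumes "efficient L \<E>" "E \<in> \<E>" "e \<in> E"
  shows "e \<in> edges L" "e \<in> mor L" "rng L e = range_of L E"
  using FE_edges_facts[OF efficient_FE[OF assms(1,2)]] assms(3) edge_mor by auto

lemma range_of_unique:
  assumes "efficient L \<E>" "E \<in> \<E>" "\<And>e. e \<in> E \<Longrightarrow> rng L e = v"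
  shows "range_of L E = v"
  using FE_edges_facts[OF efficient_FE[OF assms(1,2)]] assms(3) by fastforce

text \<open>The iterated form of (E2), with a path in place of the edge \<open>f\<close>.\<close>

lemma efficient_extend:
  assumes eff: "efficient L \<E>"
    and "E \<in> \<E>" "\<beta> \<in> mor L" "rng L \<beta> = range_of L E" "\<And>e. e \<in> E \<Longrightarrow> \<not> pre e \<beta>"
  shows "\<exists>F \<in> \<E>. range_of L F = src L \<beta> \<and> (\<forall>f \<in> F. \<exists>e \<in> E. pre e (cmp L \<beta> f))"
  using assms(2-)
\<comment> \<open>The first edge of \<beta> is dealt with by (E2) and removed, so the induction runs
  over the total degree.\<close>
proof (induction "\<Sum>i\<in>UNIV. deg L \<beta> $ i" arbitrary: \<beta> E rule: less_induct)
  case less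
  note E = efficient_mor[OF eff less.prems(1)]
  show ?case
  proof (cases "deg L \<beta> = 0")
    case True
    then have "\<beta> \<in> vertices L" using less.prems by (simp add: vertex_iff)
    then have b: "rng L \<beta> = \<beta>" "src L \<beta> = \<beta>" using vertex_rng by auto
    have "pre f (cmp L \<beta> f)" if "f \<in> E" for f
      using cmp_rng[OF E(2)[OF that]] E(3)[OF that] less.prems(3) b pre_refl[OF E(2)[OF that]] by simp
    then show ?thesis using less.prems b by (intro bexI[of _ E]) auto
  next
    case False
    then obtain f \<beta>' where f: "f \<in> edges L" "\<beta>' \<in> mor L" "src L f = rng L \<beta>'" "\<beta> = cmp L f \<beta>'"
      using first_edge less.prems(2) by metis
    have fm: "f \<in> mor L" using edge_mor[OF f(1)] .
    have "pre f \<beta>" using f fm preI by simp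
    then have "f \<notin> E" using less.prems(4) by blast
    moreover have "rng L f = range_of L E"
      using less.prems(3) f fm by (simp add: rng_cmp)
    ultimately have "f \<in> into L (range_of L E) (edges L) - E"
      using f(1) by (simp add: into_def)
    then obtain F1 where F1: "F1 \<in> \<E>" "F1 \<subseteq> Ext L f E"
      using eff less.prems(1) unfolding efficient_def by meson
    have F1': "\<exists>e \<in> E. pre e (cmp L f g)" "g \<in> mor L" "rng L g = src L f" if "g \<in> F1" for g
      using that F1(2) by (auto simp: Ext_def MCE_iff into_def)
    have r1: "range_of L F1 = src L f"
      using range_of_unique[OF eff F1(1)] F1'(3) by blast
    \<comment> \<open>The hypothesis is inherited by the shorter path: a member of \<open>F1\<close>
      heading \<beta>' would put a member of E at the head of \<beta>.\<close>
    have "\<not> pre g \<beta>'" if g: "g \<in> F1" for g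
    proof
      assume "pre g \<beta>'"
      then have "pre (cmp L f g) \<beta>" using pre_cmp_right fm F1'(3)[OF g] f by simp
      then show False using F1'(1)[OF g] pre_trans less.prems(4) by blast
    qed
    moreover have "(\<Sum>i\<in>UNIV. deg L \<beta>' $ i) < (\<Sum>i\<in>UNIV. deg L \<beta> $ i)"
    proof -
      obtain i where i: "deg L f = axis i 1" using edge_deg[OF f(1)] by blast
      have "deg L \<beta> = axis i 1 + deg L \<beta>'" using f fm i by (simp add: deg_cmp)
      then show ?thesis by (simp add: sum.distrib axis_def)
    qed
    ultimately obtain F where F: "F \<in> \<E>" "range_of L F = src L \<beta>'"
      "\<forall>h \<in> F. \<exists>g \<in> F1. pre g (cmp L \<beta>' h)"
      using less.hyps[of \<beta>' F1] F1(1) f r1 by auto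
    have sb: "src L \<beta>' = src L \<beta>" using f fm by (simp add: src_cmp)
    have "\<exists>e \<in> E. pre e (cmp L \<beta> h)" if h: "h \<in> F" for h
    proof -
      have hm: "h \<in> mor L" "rng L h = src L \<beta>'"
        using efficient_mor[OF eff F(1) h] F(2) by simp_all
      obtain g where g: "g \<in> F1" "pre g (cmp L \<beta>' h)" using F(3) h by blast
      have "pre (cmp L f g) (cmp L f (cmp L \<beta>' h))"
        using g fm F1'(3) by (intro pre_cmp_right) simp_all
      then have "pre (cmp L f g) (cmp L \<beta> h)"
        using f fm hm by (simp add: cmp_assoc)
      then show ?thesis using F1'(1)[OF g(1)] pre_trans by blast
    qed
    then show ?thesis using F sb by auto
  qed
qed

text \<open>A requirement at the end of a segment \<alpha> of \<mu>x need not concern a vertex of x.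
  A common extension of \<alpha> and \<mu> does end on x; unless the requirement is met on the way,
  \<open>efficient_extend\<close> carries it to that end, where x satisfies it.\<close>

lemma compatible_act:
  assumes eff: "efficient L \<E>" and x: "compatible \<E> x"
    and \<mu>: "\<mu> \<in> mor L" "src L \<mu> = filter_rng x"
  shows "compatible \<E> (act \<mu> x)"
  unfolding compatible_def
proof (intro conjI ballI impI)
  have px: "path_filter x" using x by (simp add: compatible_def)
  show pax: "path_filter (act \<mu> x)" using path_filter_act[OF px \<mu>] by blast
  fix \<alpha> E assume \<alpha>: "\<alpha> \<in> act \<mu> x" and E: "E \<in> \<E>" "range_of L E = src L \<alpha>"
  have am: "\<alpha> \<in> mor L" using path_filter_mor[OF pax \<alpha>] .
  obtain \<tau>' where \<tau>': "\<tau>' \<in> act \<mu> x" "pre \<alpha> \<tau>'" "pre \<mu> \<tau>'"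
    using path_filter_directed[OF pax \<alpha> path_filter_act(2)[OF px \<mu>]] .
  then obtain \<nu> where n: "\<nu> \<in> mor L" "src L \<mu> = rng L \<nu>" "\<tau>' = cmp L \<mu> \<nu>" by (auto elim: preE)
  then have nx: "\<nu> \<in> x" using \<tau>'(1) cmp_in_act_iff[OF px \<mu>] by simp
  obtain \<beta> where b: "\<beta> \<in> mor L" "src L \<alpha> = rng L \<beta>" "\<tau>' = cmp L \<alpha> \<beta>"
    using \<tau>'(2) by (auto elim: preE)
  have sb: "src L \<beta> = src L \<nu>"
    using b n am \<mu> by (metis src_cmp)
  show "\<exists>e\<in>E. cmp L \<alpha> e \<in> act \<mu> x"
  proof (cases "\<exists>e \<in> E. pre e \<beta>")
    case True
    then obtain e where e: "e \<in> E" "pre e \<beta>" by blast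
    have "pre (cmp L \<alpha> e) \<tau>'"
      using pre_cmp_right[OF e(2) am] b pre_rng[OF e(2)] by simp
    then show ?thesis using path_filter_down[OF pax \<tau>'(1)] e(1) by blast
  next
    case False
    then obtain F where F: "F \<in> \<E>" "range_of L F = src L \<beta>" "\<forall>f \<in> F. \<exists>e \<in> E. pre e (cmp L \<beta> f)"
      using efficient_extend[OF eff E(1) b(1)] E(2) b(2) by auto
    then obtain f where f: "f \<in> F" "cmp L \<nu> f \<in> x"
      using x nx sb unfolding compatible_def by metis
    have fm: "f \<in> mor L" "rng L f = src L \<beta>"
      using efficient_mor[OF eff F(1) f(1)] F(2) by simp_all
    obtain e where e: "e \<in> E" "pre e (cmp L \<beta> f)" using F(3) f(1) by blast
    have "cmp L \<mu> (cmp L \<nu> f) \<in> act \<mu> x"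
      using f(2) cmp_in_act_iff[OF px \<mu>] n fm sb by (simp add: cmp_closed rng_cmp)
    moreover have "cmp L \<mu> (cmp L \<nu> f) = cmp L \<alpha> (cmp L \<beta> f)"
      using n b fm sb \<mu> am by (metis cmp_assoc)
    moreover have "pre (cmp L \<alpha> e) (cmp L \<alpha> (cmp L \<beta> f))"
      using pre_cmp_right[OF e(2) am] b pre_rng[OF e(2)] fm by (simp add: rng_cmp)
    ultimately show ?thesis using path_filter_down[OF pax] e(1) by metis
  qed
qed

end

section \<open>Filters avoiding a set of edges\<close>

context k_graph
begin

text \<open>The last clause says that no member of \<open>\<E>\<close> forces the paths in the representation that
  extend \<open>\<mu>\<close> to meet \<open>D\<close>.\<close>

definition good :: "'a set set \<Rightarrow> 'a set \<Rightarrow> 'a \<Rightarrow> bool" where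
  "good \<E> D \<mu> \<longleftrightarrow> \<mu> \<in> mor L \<and> (\<forall>e \<in> D. \<not> pre e \<mu>) \<and>
     \<not> (\<exists>F \<in> \<E>. range_of L F = src L \<mu> \<and> (\<forall>f \<in> F. \<exists>e \<in> D. pre e (cmp L \<mu> f)))"

text \<open>An edge d that begins \<mu>ef but not \<mu>e must have the colour of f, because the
  degree of \<mu>e vanishes in the direction of d. The edge that factorization moves to the front of
  ef has that colour as well, so \<mu> followed by it is already long enough to begin with
  d.\<close>

lemma pre_edge_cmp:
  assumes \<mu>: "\<mu> \<in> mor L" and e: "e \<in> edges L" "src L \<mu> = rng L e"
    and f: "f \<in> edges L" "src L e = rng L f"
    and d: "d \<in> edges L" "\<not> pre d (cmp L \<mu> e)" "pre d (cmp L (cmp L \<mu> e) f)"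
  shows "initial L (cmp L e f) (deg L f) \<in> edges L"
    and "rng L (initial L (cmp L e f) (deg L f)) = src L \<mu>"
    and "pre d (cmp L \<mu> (initial L (cmp L e f) (deg L f)))"
proof -
  define g where "g = initial L (cmp L e f) (deg L f)"
  have em: "e \<in> mor L" and fm: "f \<in> mor L" using e f edge_mor by auto
  have ef: "cmp L e f \<in> mor L" using em fm f by (simp add: cmp_closed)
  have dle: "deg L f \<le> deg L (cmp L e f)" using em fm f by (simp add: deg_cmp less_eq_vec_def)
  have g: "pre g (cmp L e f)" "deg L g = deg L f"
    unfolding g_def using initial_pre[OF ef dle] by auto
  obtain i where i: "deg L d = axis i 1" using edge_deg[OF d(1)] by blast
  obtain j where j: "deg L f = axis j 1" using edge_deg[OF f(1)] by blast
  have me: "cmp L \<mu> e \<in> mor L" "src L (cmp L \<mu> e) = rng L f"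
    using \<mu> em e f by (simp_all add: cmp_closed src_cmp)
  have pm: "pre (cmp L \<mu> e) (cmp L (cmp L \<mu> e) f)" using preI me fm by blast
  have "\<not> deg L d \<le> deg L (cmp L \<mu> e)"
    using pre_of_deg_le[OF d(3) pm] d(2) by blast
  then have "deg L (cmp L \<mu> e) $ i = 0" unfolding i axis_le_iff by simp
  moreover have "1 \<le> deg L (cmp L (cmp L \<mu> e) f) $ i"
    using pre_deg[OF d(3)] unfolding i axis_le_iff .
  ultimately have "1 \<le> axis j (1::nat) $ i"
    using me fm j by (simp add: deg_cmp)
  then have "i = j" by (cases "i = j") (auto simp: axis_def)
  then have gd: "deg L g = deg L d" using g(2) i j by simp
  then show "g \<in> edges L"
    using i pre_mor[OF g(1)] by (auto simp: edges_def paths_of_degree_def)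
  have rg: "src L \<mu> = rng L g" using pre_rng[OF g(1)] em fm f e by (simp add: rng_cmp)
  then show "rng L g = src L \<mu>" by simp
  have gm: "g \<in> mor L" using pre_mor[OF g(1)] by simp
  have "pre (cmp L \<mu> g) (cmp L (cmp L \<mu> e) f)"
    using pre_cmp_right[OF g(1) \<mu> rg] \<mu> em fm e f by (simp add: cmp_assoc)
  moreover have "deg L d \<le> deg L (cmp L \<mu> g)"
    using gd \<mu> gm rg by (simp add: deg_cmp less_eq_vec_def)
  ultimately show "pre d (cmp L \<mu> g)" using pre_of_deg_le[OF d(3)] by blast
qed

text \<open>If every extension \<open>\<mu>e\<close> with \<open>e \<in> E\<close> were bad, (E3) would allow one to trade the members of
  \<open>E\<close> one by one for edges leading into \<open>D\<close>, so that \<open>\<mu>\<close> itself would be bad.\<close>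

lemma good_extend:
  assumes eff: "efficient L \<E>" and D: "D \<subseteq> edges L" and \<mu>: "good \<E> D \<mu>"
    and E: "E \<in> \<E>" "range_of L E = src L \<mu>"
  shows "\<exists>e \<in> E. good \<E> D (cmp L \<mu> e)"
proof (rule ccontr)
  assume bad: "\<not> (\<exists>e \<in> E. good \<E> D (cmp L \<mu> e))"
  \<comment> \<open>C consists of the edges at the end of \<mu> that lead into D at once; a member
    of \<E> inside C would make \<mu> bad.\<close>
  define C where "C = {g \<in> edges L. rng L g = src L \<mu> \<and> (\<exists>d \<in> D. pre d (cmp L \<mu> g))}"
  have m: "\<mu> \<in> mor L" using \<mu> by (simp add: good_def)
  note Em = efficient_mor[OF eff E(1)]
  \<comment> \<open>As e is not in C, the path \<mu>e does not meet D, so it can be bad only through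
    some F in \<E>; moving the edges of F in front of e puts them into C.\<close>
  have ex: "\<exists>F \<in> \<E>. range_of L F = src L e \<and>
      (\<forall>f \<in> F. initial L (cmp L e f) (deg L f) \<in> C)" if e: "e \<in> E" "e \<notin> C" for e
  proof -
    have es: "src L \<mu> = rng L e" using Em(3)[OF e(1)] E(2) by simp
    have me: "cmp L \<mu> e \<in> mor L" "src L (cmp L \<mu> e) = src L e"
      using m Em(2)[OF e(1)] es by (simp_all add: cmp_closed src_cmp)
    have nd: "\<not> pre d (cmp L \<mu> e)" if "d \<in> D" for d
      using that e Em(1)[OF e(1)] es unfolding C_def by auto
    then obtain F where F: "F \<in> \<E>" "range_of L F = src L e"
      "\<forall>f \<in> F. \<exists>d \<in> D. pre d (cmp L (cmp L \<mu> e) f)"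
      using bad e(1) me unfolding good_def by auto
    have "initial L (cmp L e f) (deg L f) \<in> C" if f: "f \<in> F" for f
    proof -
      obtain d where d: "d \<in> D" "pre d (cmp L (cmp L \<mu> e) f)" using F(3) f by blast
      have fe: "f \<in> edges L" "src L e = rng L f"
        using efficient_mor[OF eff F(1) f] F(2) by simp_all
      show ?thesis
        using pre_edge_cmp[OF m Em(1)[OF e(1)] es fe _ nd[OF d(1)] d(2)] D d(1)
        unfolding C_def by blast
    qed
    then show ?thesis using F by blast
  qed
  \<comment> \<open>The induction counts the members of G outside C. Each of them lies in E, so (E3)
    can remove one of them while bringing in only edges of C; a G inside C would contradict that
    \<mu> is good.\<close>
  have "False" if "G \<in> \<E>" "range_of L G = src L \<mu>" "G \<subseteq> E \<union> C" for G
    using that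
  proof (induction "card (G - C)" arbitrary: G rule: less_induct)
    case less
    have fin: "finite G"
      using FE_edges_facts(1)[OF efficient_FE[OF eff less.prems(1)]] .
    have "\<not> G \<subseteq> C"
      using \<mu> less.prems unfolding good_def C_def by blast
    then obtain e where e: "e \<in> G" "e \<notin> C" "e \<in> E" using less.prems(3) by blast
    obtain F where F: "F \<in> \<E>" "range_of L F = src L e"
      "\<forall>f \<in> F. initial L (cmp L e f) (deg L f) \<in> C" using ex[OF e(3,2)] by blast
    then have "F \<in> sets_at L (src L e) \<E>" by (simp add: sets_at_def)
    then obtain G' where G': "G' \<in> \<E>"
      "G' \<subseteq> (G - {e}) \<union> (\<lambda>f. initial L (cmp L e f) (deg L f)) ` F"
      using eff less.prems(1) e(1) unfolding efficient_def by meson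
    then have sub: "G' \<subseteq> (G - {e}) \<union> C" using F(3) by fastforce
    have "range_of L G' = src L \<mu>"
    proof (rule range_of_unique[OF eff G'(1)])
      fix g assume "g \<in> G'"
      then show "rng L g = src L \<mu>"
        using sub efficient_mor(3)[OF eff less.prems(1)] less.prems(2) unfolding C_def by auto
    qed
    moreover have "card (G' - C) < card (G - C)"
      using sub e fin by (intro psubset_card_mono) auto
    ultimately show False
      using less.hyps[OF _ G'(1)] sub less.prems(3) by blast
  qed
  then show False using E by blast
qed

text \<open>As for prepending, \<open>efficient_extend\<close> first moves the requirement from the
  end of \<alpha> to the end of \<mu>, unless \<mu> meets it already; there
  \<open>good_extend\<close> chooses an edge that keeps the path good.\<close>

lemma good_step:
  assumes eff: "efficient L \<E>" and D: "D \<subseteq> edges L" and \<mu>: "good \<E> D \<mu>"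
    and E: "E \<in> \<E>" "range_of L E = src L \<alpha>" and \<alpha>: "pre \<alpha> \<mu>"
  shows "\<exists>\<nu>. good \<E> D \<nu> \<and> pre \<mu> \<nu> \<and> (\<exists>e \<in> E. pre (cmp L \<alpha> e) \<nu>)"
proof -
  have m: "\<mu> \<in> mor L" using \<mu> by (simp add: good_def)
  obtain \<beta> where b: "\<alpha> \<in> mor L" "\<beta> \<in> mor L" "src L \<alpha> = rng L \<beta>" "\<mu> = cmp L \<alpha> \<beta>"
    using \<alpha> by (rule preE)
  show ?thesis
  proof (cases "\<exists>e \<in> E. pre e \<beta>")
    case True
    then obtain e where "e \<in> E" "pre e \<beta>" by blast
    moreover from this have "pre (cmp L \<alpha> e) \<mu>"
      using pre_cmp_right[of e \<beta> \<alpha>] b pre_rng[of e \<beta>] by simp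
    ultimately show ?thesis using \<mu> pre_refl[OF m] by blast
  next
    case False
    then obtain F where F: "F \<in> \<E>" "range_of L F = src L \<beta>" "\<forall>f \<in> F. \<exists>e \<in> E. pre e (cmp L \<beta> f)"
      using efficient_extend[OF eff E(1) b(2)] E(2) b(3) by auto
    have "src L \<mu> = src L \<beta>" using b by (simp add: src_cmp)
    then obtain f where f: "f \<in> F" "good \<E> D (cmp L \<mu> f)"
      using good_extend[OF eff D \<mu> F(1)] F(2) by auto
    have fm: "f \<in> mor L" "rng L f = src L \<beta>"
      using efficient_mor[OF eff F(1) f(1)] F(2) by simp_all
    obtain e where e: "e \<in> E" "pre e (cmp L \<beta> f)" using F(3) f(1) by blast
    have "pre (cmp L \<alpha> e) (cmp L \<alpha> (cmp L \<beta> f))"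
      using pre_cmp_right[OF e(2) b(1)] pre_rng[OF e(2)] b fm by (simp add: rng_cmp)
    then have "pre (cmp L \<alpha> e) (cmp L \<mu> f)" using b fm by (simp add: cmp_assoc)
    moreover have "pre \<mu> (cmp L \<mu> f)"
      using preI[OF m fm(1)] \<open>src L \<mu> = src L \<beta>\<close> fm(2) by simp
    ultimately show ?thesis using f(2) e(1) by blast
  qed
qed

text \<open>At a vertex, prepending changes nothing, and an edge begins another edge only if the two
  coincide; so badness would mean that a member of \<E> lies inside D.\<close>

lemma good_vertex:
  assumes eff: "efficient L \<E>" and v: "v \<in> vertices L" and D: "D \<subseteq> into L v (edges L)"
    and nF: "\<not> (\<exists>F \<in> \<E>. F \<subseteq> D)"
  shows "good \<E> D v"
  unfolding good_def
proof (intro conjI ballI notI)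
  have De: "e \<in> edges L" if "e \<in> D" for e using D that by (auto simp: into_def)
  show "v \<in> mor L" using v by (simp add: vertex_iff)
  show False if "e \<in> D" "pre e v" for e using that De edge_not_pre_vertex v by blast
  assume "\<exists>F \<in> \<E>. range_of L F = src L v \<and> (\<forall>f \<in> F. \<exists>e \<in> D. pre e (cmp L v f))"
  then obtain F where F: "F \<in> \<E>" "range_of L F = src L v" "\<forall>f \<in> F. \<exists>e \<in> D. pre e (cmp L v f)"
    by blast
  have "f \<in> D" if f: "f \<in> F" for f
  proof -
    have fe: "f \<in> edges L" "f \<in> mor L" "rng L f = v"
      using efficient_mor[OF eff F(1) f] F(2) vertex_rng[OF v] by simp_all
    then have "cmp L v f = f" using cmp_rng by metis
    then obtain e where "e \<in> D" "pre e f" using F(3) f by auto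
    then show ?thesis using pre_edge De fe(1) by blast
  qed
  then show False using nF F(1) by blast
qed

lemma countable_efficient:
  assumes "efficient L \<E>"
  shows "countable \<E>"
proof (rule countable_subset)
  show "\<E> \<subseteq> {E. E \<subseteq> mor L \<and> finite E}"
    using efficient_mor(2)[OF assms] FE_edges_facts(1)[OF efficient_FE[OF assms]] by blast
  show "countable {E. E \<subseteq> mor L \<and> finite E}"
    using countable_Collect_finite_subset[OF countable_mor] by (simp add: conj_commute)
qed

lemma compatible_exists:
  assumes eff: "efficient L \<E>" and v: "v \<in> vertices L" and D: "D \<subseteq> into L v (edges L)"
    and nF: "\<not> (\<exists>F \<in> \<E>. F \<subseteq> D)"
  shows "\<exists>x. compatible \<E> x \<and> filter_rng x = v \<and> x \<inter> D = {}"
proof -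
  have De: "D \<subseteq> edges L" using D by (auto simp: into_def)
  define Q where "Q = mor L \<times> \<E>"
  have Q: "countable Q"
    unfolding Q_def using countable_mor countable_efficient[OF eff] by blast
  \<comment> \<open>Only the first component of the decoded pair selects the requirement, so each
    one recurs at arbitrarily late stages, after the segment it refers to has been reached.\<close>
  define q where "q n = from_nat_into Q (fst (prod_decode n))" for n
  \<comment> \<open>The premises make a request void when it does not apply yet; they also cover an
    empty \<open>Q\<close>, whose enumeration returns an arbitrary pair.\<close>
  define hit where "hit n \<mu> \<nu> \<longleftrightarrow> (\<forall>\<alpha> E. q n = (\<alpha>, E) \<longrightarrow> E \<in> \<E> \<longrightarrow> range_of L E = src L \<alpha> \<longrightarrow>
      pre \<alpha> \<mu> \<longrightarrow> (\<exists>e \<in> E. pre (cmp L \<alpha> e) \<nu>))" for n \<mu> \<nu>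
  have "\<exists>c. \<forall>n. (good \<E> D (c n) \<and> pre v (c n)) \<and> (pre (c n) (c (Suc n)) \<and> hit n (c n) (c (Suc n)))"
  proof (rule dependent_nat_choice)
    show "\<exists>\<mu>. good \<E> D \<mu> \<and> pre v \<mu>"
      using good_vertex[OF eff v D nF] pre_refl v vertex_iff by blast
    fix \<mu> n assume \<mu>: "good \<E> D \<mu> \<and> pre v \<mu>"
    then have m: "pre \<mu> \<mu>" using pre_refl by (simp add: good_def)
    obtain \<alpha> E where qn: "q n = (\<alpha>, E)" by fastforce
    show "\<exists>\<nu>. (good \<E> D \<nu> \<and> pre v \<nu>) \<and> pre \<mu> \<nu> \<and> hit n \<mu> \<nu>"
    proof (cases "E \<in> \<E> \<and> range_of L E = src L \<alpha> \<and> pre \<alpha> \<mu>")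
      case True
      then obtain \<nu> where "good \<E> D \<nu>" "pre \<mu> \<nu>" "\<exists>e \<in> E. pre (cmp L \<alpha> e) \<nu>"
        using good_step[OF eff De] \<mu> by blast
      moreover have "pre v \<nu>" using \<mu> \<open>pre \<mu> \<nu>\<close> pre_trans by blast
      ultimately show ?thesis using qn unfolding hit_def by auto
    next
      case False
      then have "hit n \<mu> \<mu>" using qn unfolding hit_def by auto
      then show ?thesis using \<mu> m by blast
    qed
  qed
  then obtain c where c: "\<And>n. good \<E> D (c n)" "\<And>n. pre v (c n)" "\<And>n. pre (c n) (c (Suc n))"
    "\<And>n. hit n (c n) (c (Suc n))" by blast
  have mono: "pre (c m) (c n)" if "m \<le> n" for m n
    using that
  proof (induction n rule: dec_induct)
    case base
    then show ?case using c(1) pre_refl by (simp add: good_def)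
  next
    case (step n)
    then show ?case using c(3) pre_trans by blast
  qed
  define x where "x = {\<mu>. \<exists>n. pre \<mu> (c n)}"
  have cx: "c n \<in> x" for n using mono[of n n] by (auto simp: x_def)
  have px: "path_filter x"
    unfolding path_filter_def
  proof (intro conjI ballI allI impI)
    show "x \<noteq> {}" using cx by blast
    show "x \<subseteq> mor L" using pre_mor by (auto simp: x_def)
    show "\<nu> \<in> x" if "\<mu> \<in> x" "pre \<nu> \<mu>" for \<mu> \<nu> using that pre_trans unfolding x_def by blast
    fix \<mu> \<nu> assume "\<mu> \<in> x" "\<nu> \<in> x"
    then obtain m n where "pre \<mu> (c m)" "pre \<nu> (c n)" unfolding x_def by blast
    then have "pre \<mu> (c (max m n))" "pre \<nu> (c (max m n))"
      using mono[of m "max m n"] mono[of n "max m n"] pre_trans by auto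
    then show "\<exists>\<tau>\<in>x. pre \<mu> \<tau> \<and> pre \<nu> \<tau>" using cx by blast
  qed
  have "v \<in> x" using c(2) unfolding x_def by blast
  then have "filter_rng x = v" using filter_rng_eq[OF px] vertex_rng[OF v] by force
  moreover have "x \<inter> D = {}" using c(1) unfolding x_def good_def by blast
  moreover have "\<exists>e \<in> E. cmp L \<alpha> e \<in> x"
    if \<alpha>: "\<alpha> \<in> x" and E: "E \<in> \<E>" "range_of L E = src L \<alpha>" for \<alpha> E
  proof -
    obtain n0 where n0: "pre \<alpha> (c n0)" using \<alpha> unfolding x_def by blast
    have "(\<alpha>, E) \<in> Q" using path_filter_mor[OF px \<alpha>] E(1) by (simp add: Q_def)
    then obtain k where k: "from_nat_into Q k = (\<alpha>, E)"
      using from_nat_into_surj[OF Q] by blast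
    \<comment> \<open>This stage handles (\<alpha>, E) and comes no earlier than \<open>n0\<close>,
      so \<alpha> is already a prefix of \<open>c n\<close>.\<close>
    define n where "n = prod_encode (k, n0)"
    have "q n = (\<alpha>, E)" using k by (simp add: q_def n_def)
    moreover have "pre \<alpha> (c n)"
      using n0 mono[of n0 n] pre_trans le_prod_encode_2[of n0 k] unfolding n_def by blast
    ultimately obtain e where "e \<in> E" "pre (cmp L \<alpha> e) (c (Suc n))"
      using c(4)[of n] E unfolding hit_def by blast
    then show ?thesis unfolding x_def by blast
  qed
  ultimately show ?thesis using px unfolding compatible_def by blast
qed

end

section \<open>Gap products in Toeplitz-Cuntz-Krieger families\<close>

context cstar_algebra
begin

lemma mult_zero_right: "x \<in> carrier A \<Longrightarrow> x \<otimes> \<zero> = \<zero>"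
  using mult_r_distr[of \<zero> \<zero> x] mult_closed[of x \<zero>] by (simp add: M.add.l_cancel_one')

lemma mult_zero_left: "x \<in> carrier A \<Longrightarrow> \<zero> \<otimes> x = \<zero>"
  using mult_l_distr[of \<zero> \<zero> x] mult_closed[of \<zero> x] by simp

lemma star_zero: "star A \<zero> = \<zero>"
  using star_add[of \<zero> \<zero>] star_closed[of \<zero>] by simp

lemma mult_minus_right:
  assumes "x \<in> carrier A" "y \<in> carrier A" "z \<in> carrier A"
  shows "x \<otimes> (y \<ominus> z) = x \<otimes> y \<ominus> x \<otimes> z"
proof -
  have "x \<otimes> (\<ominus> z) = \<ominus> (x \<otimes> z)"
    using mult_r_distr[of "\<ominus> z" z x] assms mult_closed mult_zero_right
    by (intro M.minus_equality[symmetric]) (simp_all add: M.l_neg)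
  then show ?thesis using assms mult_closed by (simp add: a_minus_def mult_r_distr)
qed

lemma mult_minus_left:
  assumes "x \<in> carrier A" "y \<in> carrier A" "z \<in> carrier A"
  shows "(y \<ominus> z) \<otimes> x = y \<otimes> x \<ominus> z \<otimes> x"
proof -
  have "(\<ominus> z) \<otimes> x = \<ominus> (z \<otimes> x)"
    using mult_l_distr[of "\<ominus> z" z x] assms mult_closed mult_zero_left
    by (intro M.minus_equality[symmetric]) (simp_all add: M.l_neg)
  then show ?thesis using assms mult_closed by (simp add: a_minus_def mult_l_distr)
qed

lemma mult_finsum_mult:
  assumes "finite I" "f \<in> I \<rightarrow> carrier A" "a \<in> carrier A" "b \<in> carrier A"
  shows "a \<otimes> (\<Oplus>i\<in>I. f i) \<otimes> b = (\<Oplus>i\<in>I. a \<otimes> f i \<otimes> b)"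
  using assms
proof (induction I)
  case empty
  then show ?case by (simp add: mult_zero_left mult_zero_right)
next
  case (insert i I)
  then have f: "f i \<in> carrier A" "f \<in> I \<rightarrow> carrier A" by auto
  then have g: "(\<lambda>i. a \<otimes> f i \<otimes> b) \<in> I \<rightarrow> carrier A"
    using insert.prems by (auto intro!: mult_closed)
  show ?case
    using insert f g by (simp add: mult_r_distr mult_l_distr mult_closed)
qed

lemma star_finsum:
  assumes "finite I" "f \<in> I \<rightarrow> carrier A"
  shows "star A (\<Oplus>i\<in>I. f i) = (\<Oplus>i\<in>I. star A (f i))"
  using assms
proof (induction I)
  case empty
  then show ?case by (simp add: star_zero)
next
  case (insert i I)
  then have f: "f i \<in> carrier A" "f \<in> I \<rightarrow> carrier A" by auto
  then have g: "(\<lambda>i. star A (f i)) \<in> I \<rightarrow> carrier A" by (auto intro!: star_closed)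
  show ?case using insert f g by (simp add: star_add star_closed)
qed

end

section \<open>Range projections and gap products\<close>

locale tck_family = cstar_algebra A + k_graph L
  for A :: "'b cstar" (structure) and L :: "('a, 'k::finite) kgraph" +
  fixes T :: "'a \<Rightarrow> 'b"
  assumes fin_aligned: "finitely_aligned L"
    and TCK: "TCK_family L A T"
begin

lemma T_closed: "\<mu> \<in> mor L \<Longrightarrow> T \<mu> \<in> carrier A"
  using TCK by (auto simp: TCK_family_def partial_isometry_def)

lemma T_cmp: "\<lbrakk>\<mu> \<in> mor L; \<nu> \<in> mor L; src L \<mu> = rng L \<nu>\<rbrakk> \<Longrightarrow> T \<mu> \<otimes> T \<nu> = T (cmp L \<mu> \<nu>)"
  using TCK by (auto simp: TCK_family_def)

lemma T_vertex: "v \<in> vertices L \<Longrightarrow> star A (T v) = T v \<and> T v \<otimes> T v = T v"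
  using TCK by (auto simp: TCK_family_def projection_def)

definition rp :: "'a \<Rightarrow> 'b" where "rp \<mu> = T \<mu> \<otimes> star A (T \<mu>)"

lemma rp_closed: "\<mu> \<in> mor L \<Longrightarrow> rp \<mu> \<in> carrier A"
  by (simp add: rp_def mult_closed T_closed star_closed)

lemma star_rp: "\<mu> \<in> mor L \<Longrightarrow> star A (rp \<mu>) = rp \<mu>"
  by (simp add: rp_def star_mult T_closed star_closed star_star)

lemma vertex_rp:
  assumes "\<mu> \<in> mor L"
  shows "T (rng L \<mu>) \<otimes> rp \<mu> = rp \<mu>" and "rp \<mu> \<otimes> T (rng L \<mu>) = rp \<mu>"
proof -
  have v: "rng L \<mu> \<in> mor L" "T (rng L \<mu>) \<in> carrier A"
    using assms rng_closed T_closed by auto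
  have "T (rng L \<mu>) \<otimes> T \<mu> = T \<mu>"
    using T_cmp[OF v(1) assms] assms by (simp add: src_rng cmp_rng)
  then show *: "T (rng L \<mu>) \<otimes> rp \<mu> = rp \<mu>"
    using assms v unfolding rp_def by (simp add: T_closed star_closed mult_assoc[symmetric])
  have "star A (T (rng L \<mu>) \<otimes> rp \<mu>) = rp \<mu>" using * star_rp[OF assms] by simp
  then show "rp \<mu> \<otimes> T (rng L \<mu>) = rp \<mu>"
    using assms v T_vertex[OF rng_vertex[OF assms]]
    by (simp add: star_mult rp_closed star_rp)
qed

text \<open>By (TCK3) the product of two range projections is a sum of range projections of common
  extensions, hence self-adjoint; taking adjoints exchanges the factors.\<close>

lemma rp_commute:
  assumes \<mu>: "\<mu> \<in> mor L" and \<nu>: "\<nu> \<in> mor L"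
  shows "rp \<mu> \<otimes> rp \<nu> = rp \<nu> \<otimes> rp \<mu>"
proof -
  define f where "f p = T (fst p) \<otimes> star A (T (snd p))" for p
  have Lm: "fst p \<in> mor L" "snd p \<in> mor L" "src L \<mu> = rng L (fst p)" "src L \<nu> = rng L (snd p)"
    "cmp L \<mu> (fst p) = cmp L \<nu> (snd p)" if "p \<in> Lmin L \<mu> \<nu>" for p
    using that by (auto simp: Lmin_def)
  have fin: "finite (Lmin L \<mu> \<nu>)" using fin_aligned \<mu> \<nu> by (simp add: finitely_aligned_def)
  have f: "f \<in> Lmin L \<mu> \<nu> \<rightarrow> carrier A"
    using Lm by (auto simp: f_def intro!: mult_closed T_closed star_closed)
  have c: "T \<mu> \<in> carrier A" "T \<nu> \<in> carrier A" using \<mu> \<nu> T_closed by auto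
  note sc = star_closed[OF c(1)] star_closed[OF c(2)]
  have "rp \<mu> \<otimes> rp \<nu> = T \<mu> \<otimes> (star A (T \<mu>) \<otimes> T \<nu>) \<otimes> star A (T \<nu>)"
    using c sc by (simp add: rp_def mult_assoc mult_closed)
  also have "star A (T \<mu>) \<otimes> T \<nu> = (\<Oplus>p\<in>Lmin L \<mu> \<nu>. f p)"
    using TCK \<mu> \<nu> by (simp add: TCK_family_def f_def)
  also have "T \<mu> \<otimes> \<dots> \<otimes> star A (T \<nu>) = (\<Oplus>p\<in>Lmin L \<mu> \<nu>. T \<mu> \<otimes> f p \<otimes> star A (T \<nu>))"
    using fin f c sc by (intro mult_finsum_mult) auto
  also have "\<dots> = (\<Oplus>p\<in>Lmin L \<mu> \<nu>. rp (cmp L \<mu> (fst p)))"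
  proof (rule M.finsum_cong')
    show "(\<lambda>p. rp (cmp L \<mu> (fst p))) \<in> Lmin L \<mu> \<nu> \<rightarrow> carrier A"
      using Lm \<mu> by (auto intro!: rp_closed cmp_closed)
    fix p assume p: "p \<in> Lmin L \<mu> \<nu>"
    note q = Lm[OF p]
    have t: "T (fst p) \<in> carrier A" "T (snd p) \<in> carrier A" using q T_closed by auto
    have "T \<mu> \<otimes> f p \<otimes> star A (T \<nu>) = (T \<mu> \<otimes> T (fst p)) \<otimes> (star A (T (snd p)) \<otimes> star A (T \<nu>))"
      using c sc t star_closed by (simp add: f_def mult_assoc mult_closed)
    also have "\<dots> = T (cmp L \<mu> (fst p)) \<otimes> star A (T (cmp L \<nu> (snd p)))"
      using q \<mu> \<nu> c t by (simp add: T_cmp star_mult[symmetric])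
    also have "\<dots> = rp (cmp L \<mu> (fst p))" by (simp add: rp_def q(5))
    finally show "T \<mu> \<otimes> f p \<otimes> star A (T \<nu>) = rp (cmp L \<mu> (fst p))" .
  qed simp
  finally have eq: "rp \<mu> \<otimes> rp \<nu> = (\<Oplus>p\<in>Lmin L \<mu> \<nu>. rp (cmp L \<mu> (fst p)))" .
  have g: "rp (cmp L \<mu> (fst p)) \<in> carrier A" "star A (rp (cmp L \<mu> (fst p))) = rp (cmp L \<mu> (fst p))"
    if "p \<in> Lmin L \<mu> \<nu>" for p
    using cmp_closed[OF \<mu> Lm(1,3)[OF that]] by (simp_all add: rp_closed star_rp)
  have "star A (rp \<mu> \<otimes> rp \<nu>) = (\<Oplus>p\<in>Lmin L \<mu> \<nu>. star A (rp (cmp L \<mu> (fst p))))"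
    unfolding eq using fin g(1) by (intro star_finsum) auto
  also have "\<dots> = rp \<mu> \<otimes> rp \<nu>"
    unfolding eq using g by (intro M.finsum_cong') auto
  finally show ?thesis using \<mu> \<nu> by (simp add: star_mult rp_closed star_rp)
qed

definition gap :: "'a \<Rightarrow> 'a \<Rightarrow> 'b" where "gap v e = T v \<ominus> rp e"

lemma gap_closed: "v \<in> vertices L \<Longrightarrow> e \<in> mor L \<Longrightarrow> gap v e \<in> carrier A"
  by (simp add: gap_def T_closed rp_closed vertex_iff)

lemma gap_commute:
  assumes v: "v \<in> vertices L" and e: "e \<in> into L v (mor L)" and f: "f \<in> into L v (mor L)"
  shows "gap v e \<otimes> gap v f = gap v f \<otimes> gap v e"
proof -
  have ef: "e \<in> mor L" "f \<in> mor L" "rng L e = v" "rng L f = v" using e f by (auto simp: into_def)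
  have c: "T v \<in> carrier A" "rp e \<in> carrier A" "rp f \<in> carrier A"
    using v ef by (auto simp: T_closed rp_closed vertex_iff)
  have "gap v f \<otimes> T v = T v \<otimes> gap v f" "gap v f \<otimes> rp e = rp e \<otimes> gap v f"
    unfolding gap_def using c vertex_rp[of e] vertex_rp[of f] rp_commute[of e f] ef
    by (simp_all add: mult_minus_left mult_minus_right)
  then show ?thesis
    using c gap_closed[OF v ef(2)] unfolding gap_def[of v e]
    by (simp add: mult_minus_left mult_minus_right)
qed

text \<open>The algebra is not assumed commutative, so the recursion for \<open>foldD\<close> rests
  on the factors of a gap product commuting among themselves.\<close>

lemma LCD_gap:
  assumes v: "v \<in> vertices L"
  shows "LCD (into L v (mor L)) (carrier A) (\<lambda>e x. gap v e \<otimes> x)"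
proof
  fix e f z assume e: "e \<in> into L v (mor L)" and f: "f \<in> into L v (mor L)" and z: "z \<in> carrier A"
  then have c: "gap v e \<in> carrier A" "gap v f \<in> carrier A"
    using gap_closed[OF v] by (auto simp: into_def)
  show "gap v e \<otimes> (gap v f \<otimes> z) = gap v f \<otimes> (gap v e \<otimes> z)"
    using gap_commute[OF v e f] c z by (simp add: mult_assoc[symmetric])
next
  fix e z assume "e \<in> into L v (mor L)" "z \<in> carrier A"
  then show "gap v e \<otimes> z \<in> carrier A"
    using gap_closed[OF v] by (auto simp: into_def intro: mult_closed)
qed

lemma gap_prod_alt: "gap_prod A T v E = foldD (carrier A) (\<lambda>e x. gap v e \<otimes> x) (T v) E"
  by (simp add: gap_prod_def gap_def rp_def)

lemma gap_prod_empty: "v \<in> vertices L \<Longrightarrow> gap_prod A T v {} = T v"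
  by (simp add: gap_prod_alt T_closed vertex_iff)

lemma gap_prod_insert:
  assumes "v \<in> vertices L" "finite E" "insert e E \<subseteq> into L v (mor L)" "e \<notin> E"
  shows "gap_prod A T v (insert e E) = gap v e \<otimes> gap_prod A T v E"
  unfolding gap_prod_alt using assms
  by (intro LCD.foldD_insert[OF LCD_gap]) (auto simp: T_closed vertex_iff)

lemma gap_prod_closed:
  assumes "v \<in> vertices L" "finite E" "E \<subseteq> into L v (mor L)"
  shows "gap_prod A T v E \<in> carrier A"
  unfolding gap_prod_alt using assms
  by (intro LCD.foldD_closed[OF LCD_gap]) (auto simp: T_closed vertex_iff)

text \<open>The remaining factors are multiplied on one at a time, and a product that has become
  zero stays zero.\<close>

lemma gap_prod_mono_zero:
  assumes "v \<in> vertices L" "finite E" "E \<subseteq> into L v (mor L)" "F \<subseteq> E" "gap_prod A T v F = \<zero>"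
  shows "gap_prod A T v E = \<zero>"
proof -
  have "gap_prod A T v (F \<union> G) = \<zero>" if "finite G" "G \<subseteq> E" for G
    using that
  proof (induction G)
    case empty
    then show ?case using assms by simp
  next
    case (insert e G)
    then have e: "e \<in> into L v (mor L)" using assms(3) by auto
    show ?case
    proof (cases "e \<in> F \<union> G")
      case True
      then show ?thesis using insert by (simp add: insert_absorb)
    next
      case False
      have fin: "finite (F \<union> G)" using assms insert finite_subset by blast
      have "gap_prod A T v (insert e (F \<union> G)) = gap v e \<otimes> gap_prod A T v (F \<union> G)"
        using assms insert False fin by (intro gap_prod_insert) auto
      also have "\<dots> = \<zero>"
        using insert e gap_closed[OF assms(1)] by (auto simp: mult_zero_right into_def)
      finally show ?thesis by simp
    qed
  qed
  from this[OF assms(2)] show ?thesis using assms(4) by (simp add: Un_absorb1)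
qed

end

lemma star_hom_zero:
  assumes A: "cstar_algebra A" and B: "cstar_algebra B" and hom: "star_hom A B \<pi>"
  shows "\<pi> \<zero>\<^bsub>A\<^esub> = \<zero>\<^bsub>B\<^esub>"
proof -
  interpret A: cstar_algebra A by fact
  interpret B: cstar_algebra B by fact
  have "\<pi> \<zero>\<^bsub>A\<^esub> \<in> carrier B"
    using hom A.M.zero_closed unfolding star_hom_def by blast
  moreover have "\<pi> (\<zero>\<^bsub>A\<^esub> \<oplus>\<^bsub>A\<^esub> \<zero>\<^bsub>A\<^esub>) = \<pi> \<zero>\<^bsub>A\<^esub> \<oplus>\<^bsub>B\<^esub> \<pi> \<zero>\<^bsub>A\<^esub>"
    using hom A.M.zero_closed unfolding star_hom_def by blast
  ultimately show ?thesis by simp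
qed

text \<open>A gap product is built from the family by the algebra operations alone, so a nonzero gap
  product in the target forces a nonzero one in the source.\<close>

lemma star_hom_gap_prod:
  assumes A: "tck_family A L s" and B: "tck_family B L T"
    and hom: "star_hom A B \<pi>" and \<pi>: "\<And>\<mu>. \<mu> \<in> mor L \<Longrightarrow> \<pi> (s \<mu>) = T \<mu>"
    and v: "v \<in> vertices L" and E: "finite E" "E \<subseteq> into L v (mor L)"
  shows "\<pi> (gap_prod A s v E) = gap_prod B T v E"
proof -
  interpret A: tck_family A L s by fact
  interpret B: tck_family B L T by fact
  have h: "\<pi> x \<in> carrier B" "\<pi> (star A x) = star B (\<pi> x)" if "x \<in> carrier A" for x
    using hom that by (auto simp: star_hom_def)
  have h2: "\<pi> (x \<oplus>\<^bsub>A\<^esub> y) = \<pi> x \<oplus>\<^bsub>B\<^esub> \<pi> y" "\<pi> (x \<otimes>\<^bsub>A\<^esub> y) = \<pi> x \<otimes>\<^bsub>B\<^esub> \<pi> y"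
    if "x \<in> carrier A" "y \<in> carrier A" for x y
    using hom that by (auto simp: star_hom_def)
  have h0: "\<pi> \<zero>\<^bsub>A\<^esub> = \<zero>\<^bsub>B\<^esub>"
    by (rule star_hom_zero[OF A.cstar_algebra_axioms B.cstar_algebra_axioms hom])
  have hm: "\<pi> (x \<ominus>\<^bsub>A\<^esub> y) = \<pi> x \<ominus>\<^bsub>B\<^esub> \<pi> y" if "x \<in> carrier A" "y \<in> carrier A" for x y
  proof -
    have "\<ominus>\<^bsub>B\<^esub> \<pi> y = \<pi> (\<ominus>\<^bsub>A\<^esub> y)"
      using that h(1) h2(1)[of "\<ominus>\<^bsub>A\<^esub> y" y] h0
      by (intro B.M.minus_equality) (simp_all add: A.M.l_neg)
    then show ?thesis using that h2(1) by (simp add: a_minus_def)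
  qed
  have gap: "\<pi> (A.gap v e) = B.gap v e" if "e \<in> mor L" for e
    using that v by (simp add: A.gap_def B.gap_def A.rp_def B.rp_def hm h2 h \<pi> A.T_closed
        A.mult_closed A.star_closed A.vertex_iff)
  show ?thesis
    using E
  proof (induction E)
    case empty
    then show ?case using v by (simp add: A.gap_prod_empty B.gap_prod_empty \<pi> A.vertex_iff)
  next
    case (insert e E)
    then have "e \<in> mor L" by (auto simp: into_def)
    with insert v show ?case
      by (simp add: A.gap_prod_insert B.gap_prod_insert h2 gap A.gap_closed A.gap_prod_closed)
  qed
qed

section \<open>The path representation\<close>

text \<open>Closure under prepending and deleting initial segments is what the Toeplitz relations
  ask of the set X; compatibility enters only with the members of \<E>. The numbering \<iota> places
  X inside \<open>nat\<close>, where the test algebra lives.\<close>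

locale path_representation = k_graph L for L :: "('a, 'k::finite) kgraph" +
  fixes X :: "'a set set" and \<iota> :: "'a set \<Rightarrow> nat"
  assumes fin_aligned: "finitely_aligned L"
    and filter_X: "x \<in> X \<Longrightarrow> path_filter x"
    and act_X: "\<lbrakk>x \<in> X; \<mu> \<in> mor L; src L \<mu> = filter_rng x\<rbrakk> \<Longrightarrow> act \<mu> x \<in> X"
    and shift_X: "\<lbrakk>x \<in> X; \<mu> \<in> x\<rbrakk> \<Longrightarrow> shift \<mu> x \<in> X"
    and inj_\<iota>: "inj_on \<iota> X"
begin

definition act_rel :: "'a \<Rightarrow> (nat \<times> nat) set" where
  "act_rel \<mu> = {(\<iota> x, \<iota> (act \<mu> x)) | x. x \<in> X \<and> filter_rng x = src L \<mu>}"

lemma act_relI: "x \<in> X \<Longrightarrow> filter_rng x = src L \<mu> \<Longrightarrow> (\<iota> x, \<iota> (act \<mu> x)) \<in> act_rel \<mu>"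
  by (auto simp: act_rel_def)

lemma act_relE:
  assumes "(m, n) \<in> act_rel \<mu>"
  obtains x where "x \<in> X" "filter_rng x = src L \<mu>" "m = \<iota> x" "n = \<iota> (act \<mu> x)"
  using assms by (auto simp: act_rel_def)

lemma \<iota>_eq_iff: "x \<in> X \<Longrightarrow> y \<in> X \<Longrightarrow> \<iota> x = \<iota> y \<longleftrightarrow> x = y"
  using inj_on_eq_iff[OF inj_\<iota>] by blast

lemma act_inj:
  assumes "x \<in> X" "y \<in> X" "\<mu> \<in> mor L" "filter_rng x = src L \<mu>" "filter_rng y = src L \<mu>"
    and "act \<mu> x = act \<mu> y"
  shows "x = y"
proof -
  have "x = shift \<mu> (act \<mu> x)"
    using shift_act[OF filter_X[OF assms(1)] assms(3) assms(4)[symmetric]] by (rule sym)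
  also have "\<dots> = y"
    unfolding assms(6) by (rule shift_act[OF filter_X[OF assms(2)] assms(3) assms(5)[symmetric]])
  finally show ?thesis .
qed

lemma mem_act: "x \<in> X \<Longrightarrow> \<mu> \<in> mor L \<Longrightarrow> filter_rng x = src L \<mu> \<Longrightarrow> \<mu> \<in> act \<mu> x"
  by (rule path_filter_act(2)[OF filter_X]) simp_all

lemma act_rel_inj:
  assumes "\<mu> \<in> mor L"
  shows "partial_inj (act_rel \<mu>)"
proof (rule partial_injI)
  fix m n n' assume "(m, n) \<in> act_rel \<mu>" "(m, n') \<in> act_rel \<mu>"
  then show "n = n'" by (auto elim!: act_relE simp: \<iota>_eq_iff)
next
  fix m m' n assume "(m, n) \<in> act_rel \<mu>" "(m', n) \<in> act_rel \<mu>"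
  then obtain x y where "x \<in> X" "filter_rng x = src L \<mu>" "m = \<iota> x" "n = \<iota> (act \<mu> x)"
    "y \<in> X" "filter_rng y = src L \<mu>" "m' = \<iota> y" "n = \<iota> (act \<mu> y)"
    by (auto elim!: act_relE)
  then show "m = m'" using act_inj[of x y \<mu>] \<iota>_eq_iff act_X assms by simp
qed

lemma act_rel_vertex:
  assumes "v \<in> vertices L"
  shows "act_rel v = Id_on (\<iota> ` {x \<in> X. filter_rng x = v})"
proof -
  have "src L v = v" using vertex_rng[OF assms] by simp
  moreover have "act v x = x" if "x \<in> X" "filter_rng x = v" for x
    using act_vertex[OF filter_X[OF that(1)], of v] that(2) by simp
  ultimately show ?thesis unfolding act_rel_def by auto
qed

lemma act_rel_cmp:
  assumes "\<mu> \<in> mor L" "\<nu> \<in> mor L" "src L \<mu> = rng L \<nu>"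
  shows "act_rel \<nu> O act_rel \<mu> = act_rel (cmp L \<mu> \<nu>)"
proof -
  have *: "act \<nu> x \<in> X" "filter_rng (act \<nu> x) = src L \<mu>" "act (cmp L \<mu> \<nu>) x = act \<mu> (act \<nu> x)"
    if "x \<in> X" "filter_rng x = src L \<nu>" for x
    using that assms act_X path_filter_act(3)[OF filter_X] act_cmp[OF filter_X] by simp_all
  have s: "src L (cmp L \<mu> \<nu>) = src L \<nu>" using assms by (simp add: src_cmp)
  show ?thesis
  proof (intro equalityI subrelI)
    fix m n assume "(m, n) \<in> act_rel \<nu> O act_rel \<mu>"
    then obtain x y where "x \<in> X" "filter_rng x = src L \<nu>" "m = \<iota> x" "\<iota> (act \<nu> x) = \<iota> y"
      "y \<in> X" "n = \<iota> (act \<mu> y)"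
      by (auto elim!: act_relE)
    then show "(m, n) \<in> act_rel (cmp L \<mu> \<nu>)"
      using * \<iota>_eq_iff[of "act \<nu> x" y] act_relI[of x "cmp L \<mu> \<nu>"] s by simp
  next
    fix m n assume "(m, n) \<in> act_rel (cmp L \<mu> \<nu>)"
    then obtain x where "x \<in> X" "filter_rng x = src L \<nu>" "m = \<iota> x" "n = \<iota> (act (cmp L \<mu> \<nu>) x)"
      using s by (auto elim!: act_relE)
    then show "(m, n) \<in> act_rel \<nu> O act_rel \<mu>"
      using * act_relI[of x \<nu>] act_relI[of "act \<nu> x" \<mu>] by auto
  qed
qed

text \<open>This computes the range projection of \<mu>: a filter that contains \<mu> is \<mu>
  prepended to its own shift, and every filter of the form \<mu>x contains \<mu>.\<close>

lemma act_rel_range: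
  assumes "\<mu> \<in> mor L"
  shows "(act_rel \<mu>)\<inverse> O act_rel \<mu> = Id_on (\<iota> ` {x \<in> X. \<mu> \<in> x})"
proof (intro equalityI subrelI)
  fix m n assume "(m, n) \<in> (act_rel \<mu>)\<inverse> O act_rel \<mu>"
  then obtain k where "(k, m) \<in> act_rel \<mu>" "(k, n) \<in> act_rel \<mu>" by auto
  moreover from this have "m = n" using act_rel_inj[OF assms]
    unfolding partial_inj_def single_valued_def by blast
  ultimately show "(m, n) \<in> Id_on (\<iota> ` {x \<in> X. \<mu> \<in> x})"
    using mem_act act_X assms by (auto elim!: act_relE)
next
  fix m n assume "(m, n) \<in> Id_on (\<iota> ` {x \<in> X. \<mu> \<in> x})"
  then obtain x where x: "x \<in> X" "\<mu> \<in> x" "m = \<iota> x" "n = \<iota> x" by auto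
  note f = path_filter_shift[OF filter_X[OF x(1)] x(2)]
  have "(\<iota> (shift \<mu> x), \<iota> x) \<in> act_rel \<mu>"
    using act_relI[OF shift_X[OF x(1,2)] f(2)] f(3) by simp
  then show "(m, n) \<in> (act_rel \<mu>)\<inverse> O act_rel \<mu>" using x by blast
qed

lemma Lmin_facts:
  assumes "p \<in> Lmin L \<mu> \<nu>"
  shows "fst p \<in> mor L" "snd p \<in> mor L" "src L \<mu> = rng L (fst p)" "src L \<nu> = rng L (snd p)"
    "cmp L \<mu> (fst p) = cmp L \<nu> (snd p)"
    "deg L (cmp L \<mu> (fst p)) = deg_join (deg L \<mu>) (deg L \<nu>)"
  using assms by (auto simp: Lmin_def MCE_iff)

text \<open>This is (TCK3) for relations. If \<mu>x = \<nu>y, the common filter contains a minimal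
  common extension \<mu>a = \<nu>b; deleting it leaves a filter w with x = aw and y = bw.\<close>

lemma act_rel_Lmin:
  assumes \<mu>: "\<mu> \<in> mor L" and \<nu>: "\<nu> \<in> mor L"
  shows "act_rel \<nu> O (act_rel \<mu>)\<inverse> =
    (\<Union>p\<in>Lmin L \<mu> \<nu>. (act_rel (snd p))\<inverse> O act_rel (fst p))"
proof (intro equalityI subrelI)
  fix m n assume "(m, n) \<in> act_rel \<nu> O (act_rel \<mu>)\<inverse>"
  then obtain k where "(m, k) \<in> act_rel \<nu>" "(n, k) \<in> act_rel \<mu>" by auto
  then obtain x y where x: "x \<in> X" "filter_rng x = src L \<mu>" "n = \<iota> x"
    and y: "y \<in> X" "filter_rng y = src L \<nu>" "m = \<iota> y" and "\<iota> (act \<nu> y) = \<iota> (act \<mu> x)"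
    by (auto elim!: act_relE)
  then have eq: "act \<nu> y = act \<mu> x" using \<iota>_eq_iff act_X \<mu> \<nu> by simp
  define z where "z = act \<mu> x"
  have zX: "z \<in> X" unfolding z_def using act_X x \<mu> by simp
  note fz = filter_X[OF zX]
  have mz: "\<mu> \<in> z" "\<nu> \<in> z"
    using mem_act[OF x(1) \<mu> x(2)] mem_act[OF y(1) \<nu> y(2)] eq by (simp_all add: z_def)
  obtain \<tau> where \<tau>: "\<tau> \<in> z" "pre \<mu> \<tau>" "pre \<nu> \<tau>" using path_filter_directed[OF fz mz] .
  obtain \<rho> where \<rho>: "\<rho> \<in> MCE L \<mu> \<nu>" "pre \<rho> \<tau>" using MCE_below[OF \<tau>(2,3)] .
  have \<rho>z: "\<rho> \<in> z" using path_filter_down[OF fz \<tau>(1) \<rho>(2)] .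
  obtain a where a: "a \<in> mor L" "src L \<mu> = rng L a" "\<rho> = cmp L \<mu> a"
    using \<rho>(1) unfolding MCE_iff by (auto elim: preE)
  obtain b where b: "b \<in> mor L" "src L \<nu> = rng L b" "\<rho> = cmp L \<nu> b"
    using \<rho>(1) unfolding MCE_iff by (auto elim: preE)
  have p: "(a, b) \<in> Lmin L \<mu> \<nu>" using a b \<rho>(1) by (auto simp: Lmin_def)
  define w where "w = shift \<rho> z"
  have wX: "w \<in> X" unfolding w_def using shift_X zX \<rho>z by simp
  have wr: "filter_rng w = src L \<rho>" "act \<rho> w = z"
    unfolding w_def using path_filter_shift[OF fz \<rho>z] by simp_all
  have sr: "src L \<rho> = src L a" "src L \<rho> = src L b"
    using a \<mu> b \<nu> by (metis src_cmp)+
  have aw: "act a w \<in> X" "filter_rng (act a w) = src L \<mu>"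
    using act_X wX a wr sr path_filter_act(3)[OF filter_X[OF wX]] by simp_all
  have bw: "act b w \<in> X" "filter_rng (act b w) = src L \<nu>"
    using act_X wX b wr sr path_filter_act(3)[OF filter_X[OF wX]] by simp_all
  have "act \<mu> (act a w) = z"
    using act_cmp[OF filter_X[OF wX] \<mu> a(1,2)] a(3) sr wr by simp
  then have xa: "x = act a w"
    using act_inj[OF x(1) aw(1) \<mu> x(2) aw(2)] by (simp add: z_def)
  have "act \<nu> (act b w) = z"
    using act_cmp[OF filter_X[OF wX] \<nu> b(1,2)] b(3) sr wr by simp
  then have yb: "y = act b w"
    using act_inj[OF y(1) bw(1) \<nu> y(2) bw(2)] eq by (simp add: z_def)
  have "(\<iota> w, n) \<in> act_rel a" "(\<iota> w, m) \<in> act_rel b"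
    using act_relI[OF wX, of a] act_relI[OF wX, of b] wr sr x y xa yb by simp_all
  then show "(m, n) \<in> (\<Union>p\<in>Lmin L \<mu> \<nu>. (act_rel (snd p))\<inverse> O act_rel (fst p))"
    using p by force
next
  fix m n assume "(m, n) \<in> (\<Union>p\<in>Lmin L \<mu> \<nu>. (act_rel (snd p))\<inverse> O act_rel (fst p))"
  then obtain p k where p: "p \<in> Lmin L \<mu> \<nu>"
    and km: "(k, m) \<in> act_rel (snd p)" and kn: "(k, n) \<in> act_rel (fst p)"
    by auto
  note q = Lmin_facts[OF p]
  obtain x where x: "x \<in> X" "k = \<iota> x" "filter_rng x = src L (fst p)" "n = \<iota> (act (fst p) x)"
    using kn by (rule act_relE)
  obtain y where y: "y \<in> X" "k = \<iota> y" "filter_rng y = src L (snd p)" "m = \<iota> (act (snd p) y)"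
    using km by (rule act_relE)
  have "y = x" using x y \<iota>_eq_iff by simp
  note y = y[unfolded this] and f = filter_X[OF x(1)]
  have "act (snd p) x \<in> X" "act (fst p) x \<in> X"
    using act_X x y q by simp_all
  moreover have "filter_rng (act (snd p) x) = src L \<nu>" "filter_rng (act (fst p) x) = src L \<mu>"
    using path_filter_act(3)[OF f q(2)] path_filter_act(3)[OF f q(1)] x(3) y(3) q(3,4) by simp_all
  ultimately have "(m, \<iota> (act \<nu> (act (snd p) x))) \<in> act_rel \<nu>" "(n, \<iota> (act \<mu> (act (fst p) x))) \<in> act_rel \<mu>"
    using x(4) y(4) act_relI by simp_all
  moreover have "act \<nu> (act (snd p) x) = act \<mu> (act (fst p) x)"
    using act_cmp[OF f \<nu> q(2) q(4)] act_cmp[OF f \<mu> q(1) q(3)] q(5) x(3) y(3) by metis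
  ultimately show "(m, n) \<in> act_rel \<nu> O (act_rel \<mu>)\<inverse>" by auto
qed

text \<open>The first component has the same degree for all pairs, the join of the degrees of \<mu>
  and \<nu> minus that of \<mu>, and a filter contains at most one path of each degree. The second
  component follows by cancelling \<nu>.\<close>

lemma act_rel_Lmin_disjoint:
  assumes \<mu>: "\<mu> \<in> mor L" and \<nu>: "\<nu> \<in> mor L" and p: "p \<in> Lmin L \<mu> \<nu>" and q: "q \<in> Lmin L \<mu> \<nu>"
    and R: "Range ((act_rel (snd p))\<inverse> O act_rel (fst p)) \<inter> Range ((act_rel (snd q))\<inverse> O act_rel (fst q)) \<noteq> {}"
  shows "p = q"
proof -
  note pf = Lmin_facts[OF p] and qf = Lmin_facts[OF q]
  obtain n k l where "(k, n) \<in> act_rel (fst p)" "(l, n) \<in> act_rel (fst q)" using R by auto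
  then obtain x y where x: "x \<in> X" "filter_rng x = src L (fst p)" "n = \<iota> (act (fst p) x)"
    and y: "y \<in> X" "filter_rng y = src L (fst q)" "n = \<iota> (act (fst q) y)"
    by (auto elim!: act_relE)
  have z: "act (fst p) x \<in> X" using x act_X pf by simp
  have "act (fst p) x = act (fst q) y" using x y act_X pf qf \<iota>_eq_iff by simp
  then have mem: "fst p \<in> act (fst p) x" "fst q \<in> act (fst p) x"
    using mem_act[OF x(1) pf(1) x(2)] mem_act[OF y(1) qf(1) y(2)] by simp_all
  have "deg L \<mu> + deg L (fst p) = deg L \<mu> + deg L (fst q)"
    using pf qf \<mu> deg_cmp by metis
  then have 1: "fst p = fst q"
    using path_filter_deg_unique[OF filter_X[OF z] mem] by simp
  then have "cmp L \<nu> (snd p) = cmp L \<nu> (snd q)" using pf(5) qf(5) by simp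
  then have "snd p = snd q"
    by (rule cancel[OF \<nu> pf(2) pf(4) qf(2) qf(4)])
  with 1 show ?thesis by (simp add: prod_eq_iff)
qed

section \<open>The Toeplitz-Cuntz-Krieger relations for the shift operators\<close>

definition rep :: "'a \<Rightarrow> test" where "rep \<mu> = enc (rel_op (act_rel \<mu>))"

lemma star_rep: "\<mu> \<in> mor L \<Longrightarrow> star ell2_cstar (rep \<mu>) = enc (rel_op ((act_rel \<mu>)\<inverse>))"
  by (simp add: rep_def adj_rel_op act_rel_inj)

lemma rep_star_rep:
  assumes "\<mu> \<in> mor L" "\<nu> \<in> mor L"
  shows "rep \<mu> \<otimes>\<^bsub>ell2_cstar\<^esub> star ell2_cstar (rep \<nu>) = enc (rel_op ((act_rel \<nu>)\<inverse> O act_rel \<mu>))"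
  using assms by (simp add: star_rep) (simp add: rep_def rel_op_compose act_rel_inj partial_inj_converse)

lemma vertex_mor: "v \<in> vertices L \<Longrightarrow> v \<in> mor L"
  by (simp add: vertex_iff)

lemma TCK_rep: "TCK_family L ell2_cstar rep"
  unfolding TCK_family_def
proof (intro conjI ballI impI)
  fix \<mu> assume \<mu>: "\<mu> \<in> mor L"
  note R = act_rel_inj[OF \<mu>]
  have "act_rel \<mu> O (act_rel \<mu>)\<inverse> O act_rel \<mu> = act_rel \<mu>"
    by (rule partial_inj_triple[OF R])
  then have "rep \<mu> \<otimes>\<^bsub>ell2_cstar\<^esub> star ell2_cstar (rep \<mu>) \<otimes>\<^bsub>ell2_cstar\<^esub> rep \<mu> = rep \<mu>"
    using R by (simp add: rep_star_rep \<mu>)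
      (simp add: rep_def rel_op_compose partial_inj_comp partial_inj_converse)
  then show "partial_isometry ell2_cstar (rep \<mu>)"
    using R by (simp add: partial_isometry_def rep_def rel_op_in_ell2_ops)
next
  fix v assume v: "v \<in> vertices L"
  note R = act_rel_inj[OF vertex_mor[OF v]]
  have "(act_rel v)\<inverse> = act_rel v" "act_rel v O act_rel v = act_rel v"
    unfolding act_rel_vertex[OF v] by auto
  then show "projection ell2_cstar (rep v)"
    using R by (simp add: projection_def rep_def adj_rel_op rel_op_in_ell2_ops rel_op_compose)
next
  fix v w assume v: "v \<in> vertices L" and w: "w \<in> vertices L" and vw: "v \<noteq> w"
  have "act_rel w O act_rel v = {}"
    unfolding act_rel_vertex[OF v] act_rel_vertex[OF w] using vw \<iota>_eq_iff by (auto simp: Id_on_def)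
  then show "rep v \<otimes>\<^bsub>ell2_cstar\<^esub> rep w = \<zero>\<^bsub>ell2_cstar\<^esub>"
    using v w by (simp add: rep_def rel_op_compose act_rel_inj vertex_mor)
next
  fix \<mu> \<nu> assume "\<mu> \<in> mor L" "\<nu> \<in> mor L" "src L \<mu> = rng L \<nu>"
  then show "rep \<mu> \<otimes>\<^bsub>ell2_cstar\<^esub> rep \<nu> = rep (cmp L \<mu> \<nu>)"
    by (simp add: rep_def rel_op_compose act_rel_inj act_rel_cmp)
next
  fix \<mu> \<nu> assume \<mu>: "\<mu> \<in> mor L" and \<nu>: "\<nu> \<in> mor L"
  define S where "S p = (act_rel (snd p))\<inverse> O act_rel (fst p)" for p
  have fin: "finite (Lmin L \<mu> \<nu>)" using fin_aligned \<mu> \<nu> by (simp add: finitely_aligned_def)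
  have U: "act_rel \<nu> O (act_rel \<mu>)\<inverse> = (\<Union>p\<in>Lmin L \<mu> \<nu>. S p)"
    unfolding S_def by (rule act_rel_Lmin[OF \<mu> \<nu>])
  have inj: "partial_inj (\<Union>p\<in>Lmin L \<mu> \<nu>. S p)"
    unfolding U[symmetric] using \<mu> \<nu> by (intro partial_inj_comp partial_inj_converse act_rel_inj)
  have S: "partial_inj (S p)" if "p \<in> Lmin L \<mu> \<nu>" for p
    using partial_inj_subset[OF inj] that by blast
  have "star ell2_cstar (rep \<mu>) \<otimes>\<^bsub>ell2_cstar\<^esub> rep \<nu> = enc (rel_op (act_rel \<nu> O (act_rel \<mu>)\<inverse>))"
    using \<mu> \<nu> by (simp add: star_rep) (simp add: rep_def rel_op_compose act_rel_inj partial_inj_converse)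
  also have "\<dots> = enc (\<Sum>p\<in>Lmin L \<mu> \<nu>. rel_op (S p))"
    unfolding U
    by (subst rel_op_UNION[OF fin inj])
      (use act_rel_Lmin_disjoint[OF \<mu> \<nu>] in \<open>simp_all add: S_def\<close>)
  also have "\<dots> = (\<Oplus>\<^bsub>ell2_cstar\<^esub>p\<in>Lmin L \<mu> \<nu>. enc (rel_op (S p)))"
    using S by (intro ell2_cstar_finsum[symmetric] fin rel_op_in_ell2_ops)
  also have "\<dots> = (\<Oplus>\<^bsub>ell2_cstar\<^esub>p\<in>Lmin L \<mu> \<nu>. rep (fst p) \<otimes>\<^bsub>ell2_cstar\<^esub> star ell2_cstar (rep (snd p)))"
  proof (rule abelian_monoid.finsum_cong')
    show "abelian_monoid ell2_cstar"
      using abelian_group_ell2_cstar by (rule abelian_group.axioms)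
    have *: "rep (fst p) \<otimes>\<^bsub>ell2_cstar\<^esub> star ell2_cstar (rep (snd p)) = enc (rel_op (S p))"
      if "p \<in> Lmin L \<mu> \<nu>" for p
      unfolding S_def using Lmin_facts[OF that] by (intro rep_star_rep)
    then show "enc (rel_op (S p)) = rep (fst p) \<otimes>\<^bsub>ell2_cstar\<^esub> star ell2_cstar (rep (snd p))"
      if "p \<in> Lmin L \<mu> \<nu>" for p using that by simp
    show "(\<lambda>p. rep (fst p) \<otimes>\<^bsub>ell2_cstar\<^esub> star ell2_cstar (rep (snd p))) \<in> Lmin L \<mu> \<nu> \<rightarrow> carrier ell2_cstar"
      using rel_op_in_ell2_ops[OF S] by (simp add: Pi_iff *)
  qed simp
  finally show "star ell2_cstar (rep \<mu>) \<otimes>\<^bsub>ell2_cstar\<^esub> rep \<nu> =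
      (\<Oplus>\<^bsub>ell2_cstar\<^esub>p\<in>Lmin L \<mu> \<nu>. rep (fst p) \<otimes>\<^bsub>ell2_cstar\<^esub> star ell2_cstar (rep (snd p)))" .
qed

lemma tck_family_rep: "tck_family ell2_cstar L rep"
  by (intro tck_family.intro tck_family_axioms.intro cstar_algebra_ell2_cstar k_graph_axioms
      fin_aligned TCK_rep)

text \<open>Each factor removes the filters that contain its edge, and products of diagonal
  projections correspond to intersections of index sets.\<close>

lemma gap_prod_rep:
  assumes v: "v \<in> vertices L" and E: "finite E" "E \<subseteq> into L v (mor L)"
  shows "gap_prod ell2_cstar rep v E =
    enc (rel_op (Id_on (\<iota> ` {x \<in> X. filter_rng x = v \<and> x \<inter> E = {}})))"
  using E
proof (induction E)
  interpret B: tck_family ell2_cstar L rep by (rule tck_family_rep)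
  {
    case empty
    show ?case
      by (simp add: B.gap_prod_empty[OF v]) (simp add: rep_def act_rel_vertex[OF v])
  next
    case (insert e E)
    let ?V = "\<lambda>E. {x \<in> X. filter_rng x = v \<and> x \<inter> E = {}}"
    have e: "e \<in> mor L" "rng L e = v" using insert.prems by (auto simp: into_def)
    \<comment> \<open>A filter that contains e has the range of e, which is v, so the projection to
      be subtracted lies below the other one.\<close>
    have sub: "{x \<in> X. e \<in> x} \<subseteq> {x \<in> X. filter_rng x = v}"
      using e filter_rng_eq[OF filter_X] by auto
    let ?P = "Id_on (\<iota> ` {x \<in> X. filter_rng x = v})" and ?R = "Id_on (\<iota> ` {x \<in> X. e \<in> x})"
    have "B.gap v e = enc (rel_op ?P - rel_op ?R)"
      unfolding B.gap_def B.rp_def rep_star_rep[OF e(1) e(1)] act_rel_range[OF e(1)]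
      by (simp add: rep_def act_rel_vertex[OF v] rel_op_in_ell2_ops partial_inj_Id_on)
    also have "rel_op ?P - rel_op ?R = rel_op (?P - ?R)"
      by (rule rel_op_diff[OF partial_inj_Id_on]) (unfold Id_on_def, use sub in blast)
    also have "?P - ?R = Id_on (\<iota> ` ?V {e})"
      using \<iota>_eq_iff by (auto simp: Id_on_def)
    finally have gap: "B.gap v e = enc (rel_op (Id_on (\<iota> ` ?V {e})))" .
    have "\<iota> ` ?V E \<inter> \<iota> ` ?V {e} = \<iota> ` (?V E \<inter> ?V {e})"
      by (rule inj_on_image_Int[OF inj_\<iota>, symmetric]) auto
    also have "?V E \<inter> ?V {e} = ?V (insert e E)" by auto
    finally have "Id_on (\<iota> ` ?V E) O Id_on (\<iota> ` ?V {e}) = Id_on (\<iota> ` ?V (insert e E))"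
      by (simp only: Id_on_comp)
    then show ?case
      using insert by (simp add: B.gap_prod_insert[OF v] gap rel_op_compose partial_inj_Id_on)
  }
qed

end

section \<open>Orbits of compatible filters\<close>

context k_graph
begin

text \<open>The filters that agree with \<open>x\<close> up to finite initial segments: they are countably many, so
  that \<open>\<ell>\<^sup>2\<close> over them embeds into \<open>\<ell>\<^sup>2(\<nat>)\<close>.\<close>

definition orbit :: "'a set \<Rightarrow> 'a set set" where
  "orbit x = {act \<mu> (shift \<nu> x) | \<mu> \<nu>. \<mu> \<in> mor L \<and> \<nu> \<in> x \<and> src L \<mu> = src L \<nu>}"

lemma countable_orbit:
  assumes "path_filter x"
  shows "countable (orbit x)"
proof (rule countable_subset)
  show "orbit x \<subseteq> (\<lambda>(\<mu>, \<nu>). act \<mu> (shift \<nu> x)) ` (mor L \<times> mor L)"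
    using path_filter_mor[OF assms] by (force simp: orbit_def)
  show "countable ((\<lambda>(\<mu>, \<nu>). act \<mu> (shift \<nu> x)) ` (mor L \<times> mor L))"
    using countable_mor by blast
qed

lemma orbitE:
  assumes x: "path_filter x" and "y \<in> orbit x"
  obtains \<mu> \<nu> where "\<mu> \<in> mor L" "\<nu> \<in> x" "src L \<mu> = src L \<nu>" "y = act \<mu> (shift \<nu> x)"
    "path_filter (shift \<nu> x)" "filter_rng (shift \<nu> x) = src L \<mu>"
  using assms path_filter_shift[OF x] unfolding orbit_def by auto

lemma orbit_self:
  assumes "path_filter x"
  shows "x \<in> orbit x"
proof -
  have "filter_rng x \<in> x" by (rule filter_rng_in[OF assms])
  then show ?thesis
    using path_filter_shift(3)[OF assms] path_filter_mor[OF assms] unfolding orbit_def by blast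
qed

lemma orbit_compatible:
  assumes eff: "efficient L \<E>" and x: "compatible \<E> x" and y: "y \<in> orbit x"
  shows "compatible \<E> y"
proof -
  have px: "path_filter x" using x by (simp add: compatible_def)
  show ?thesis
    using y
  proof (rule orbitE[OF px])
    fix \<mu> \<nu>
    assume "\<mu> \<in> mor L" "\<nu> \<in> x" "y = act \<mu> (shift \<nu> x)" "filter_rng (shift \<nu> x) = src L \<mu>"
    then show ?thesis using compatible_act[OF eff compatible_shift[OF eff x]] by metis
  qed
qed

lemma orbit_act:
  assumes x: "path_filter x" and y: "y \<in> orbit x" and \<mu>: "\<mu> \<in> mor L" "src L \<mu> = filter_rng y"
  shows "act \<mu> y \<in> orbit x"
proof -
  obtain \<alpha> \<nu> where a: "\<alpha> \<in> mor L" "\<nu> \<in> x" "src L \<alpha> = src L \<nu>" "y = act \<alpha> (shift \<nu> x)"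
    and f: "path_filter (shift \<nu> x)" "filter_rng (shift \<nu> x) = src L \<alpha>"
    using orbitE[OF x y] by metis
  have "src L \<mu> = rng L \<alpha>" using path_filter_act(3)[OF f(1) a(1) f(2)[symmetric]] \<mu>(2) a(4) by simp
  then have "act \<mu> y = act (cmp L \<mu> \<alpha>) (shift \<nu> x)" "cmp L \<mu> \<alpha> \<in> mor L" "src L (cmp L \<mu> \<alpha>) = src L \<nu>"
    using act_cmp[OF f(1) \<mu>(1) a(1) _ f(2)[symmetric]] \<mu>(1) a by (simp_all add: cmp_closed src_cmp)
  then show ?thesis using a(2) unfolding orbit_def by blast
qed

lemma shift_shift:
  assumes "\<mu> \<in> mor L" "\<nu> \<in> mor L" "src L \<mu> = rng L \<nu>"
  shows "shift \<nu> (shift \<mu> x) = shift (cmp L \<mu> \<nu>) x"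
proof (rule Set.set_eqI)
  fix \<tau>
  have "src L (cmp L \<mu> \<nu>) = src L \<nu>" using assms by (rule src_cmp)
  moreover have "cmp L \<nu> \<tau> \<in> mor L \<and> src L \<mu> = rng L (cmp L \<nu> \<tau>) \<and>
      cmp L (cmp L \<mu> \<nu>) \<tau> = cmp L \<mu> (cmp L \<nu> \<tau>)" if "\<tau> \<in> mor L" "src L \<nu> = rng L \<tau>"
    using assms that cmp_closed rng_cmp cmp_assoc by simp
  ultimately show "\<tau> \<in> shift \<nu> (shift \<mu> x) \<longleftrightarrow> \<tau> \<in> shift (cmp L \<mu> \<nu>) x"
    unfolding shift_def by auto
qed

text \<open>The segment \<mu> to be deleted may be incomparable with the prepended \<alpha>. Both
  extend to some \<tau> = \<alpha>\<kappa> = \<mu>\<beta> in y; once \<kappa> too is deleted from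
  the tail of x, prepending \<beta> gives the shift of y.\<close>

lemma orbit_shift:
  assumes x: "path_filter x" and y: "y \<in> orbit x" and \<mu>: "\<mu> \<in> y"
  shows "shift \<mu> y \<in> orbit x"
proof -
  obtain \<alpha> \<nu> where a: "\<alpha> \<in> mor L" "\<nu> \<in> x" "src L \<alpha> = src L \<nu>" "y = act \<alpha> (shift \<nu> x)"
    and f: "path_filter (shift \<nu> x)" "filter_rng (shift \<nu> x) = src L \<alpha>"
    using orbitE[OF x y] by metis
  define z where "z = shift \<nu> x"
  note z = f[folded z_def] and yz = a(4)[folded z_def]
  have py: "path_filter y" "\<alpha> \<in> y"
    using path_filter_act[OF z(1) a(1) z(2)[symmetric]] yz by simp_all
  have nm: "\<nu> \<in> mor L" and mm: "\<mu> \<in> mor L"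
    using path_filter_mor[OF x a(2)] path_filter_mor[OF py(1) \<mu>] .
  obtain \<tau> where \<tau>: "\<tau> \<in> y" "pre \<mu> \<tau>" "pre \<alpha> \<tau>"
    using path_filter_directed[OF py(1) \<mu> py(2)] .
  obtain \<kappa> where k: "\<kappa> \<in> mor L" "src L \<alpha> = rng L \<kappa>" "\<tau> = cmp L \<alpha> \<kappa>" using \<tau>(3) by (auto elim: preE)
  obtain \<beta> where b: "\<beta> \<in> mor L" "src L \<mu> = rng L \<beta>" "\<tau> = cmp L \<mu> \<beta>" using \<tau>(2) by (auto elim: preE)
  have kz: "\<kappa> \<in> z"
    using cmp_in_act_iff[OF z(1) a(1) z(2)[symmetric] k(1,2)] \<tau>(1) k(3) yz by simp
  define w where "w = shift \<kappa> z"
  have w: "path_filter w" "filter_rng w = src L \<kappa>" "act \<kappa> w = z"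
    unfolding w_def using path_filter_shift[OF z(1) kz] by simp_all
  have sb: "src L \<beta> = src L \<kappa>" using k b a(1) mm by (metis src_cmp)
  have "y = act \<tau> w"
    using act_cmp[OF w(1) a(1) k(1,2) w(2)[symmetric]] w(3) yz k(3) by simp
  also have "\<dots> = act \<mu> (act \<beta> w)"
    using act_cmp[OF w(1) mm b(1,2)] sb w(2) b(3) by simp
  finally have "y = act \<mu> (act \<beta> w)" .
  moreover have "path_filter (act \<beta> w)" "filter_rng (act \<beta> w) = src L \<mu>"
    using path_filter_act[OF w(1) b(1)] sb w(2) b(2) by simp_all
  ultimately have "shift \<mu> y = act \<beta> w" using shift_act mm by simp
  moreover have nk: "src L \<nu> = rng L \<kappa>" using a(3) k(2) by simp
  then have "w = shift (cmp L \<nu> \<kappa>) x"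
    unfolding w_def z_def by (intro shift_shift nm k(1))
  moreover have "cmp L \<nu> \<kappa> \<in> x" using kz by (simp add: z_def shift_def)
  moreover have "src L \<beta> = src L (cmp L \<nu> \<kappa>)" using sb nm k(1) nk by (simp add: src_cmp)
  ultimately show ?thesis using b(1) unfolding orbit_def by blast
qed

lemma orbit_representation:
  assumes "finitely_aligned L" "path_filter x"
    and "\<And>y. y \<in> orbit x \<Longrightarrow> path_filter y"
  shows "path_representation L (orbit x) (to_nat_on (orbit x))"
  by unfold_locales
    (use assms orbit_act orbit_shift countable_orbit in \<open>auto intro: inj_on_to_nat_on\<close>)

text \<open>The basis vector of the chosen path x survives the gap projection of E, as x avoids E.
  The relations for \<E> hold because every path of the orbit is compatible, and compatibility at
  its range provides an edge of each F based there.\<close>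

lemma relative_CK_family_nonzero_gap:
  assumes fa: "finitely_aligned L" and eff: "efficient L \<E>" and v: "v \<in> vertices L"
    and E: "finite E" "E \<subseteq> into L v (edges L)" and nF: "\<not> (\<exists>F \<in> \<E>. F \<subseteq> E)"
  shows "\<exists>T. relative_CK_family L \<E> ell2_cstar T \<and> gap_prod ell2_cstar T v E \<noteq> \<zero>\<^bsub>ell2_cstar\<^esub>"
proof -
  obtain x where x: "compatible \<E> x" "filter_rng x = v" "x \<inter> E = {}"
    using compatible_exists[OF eff v E(2) nF] by blast
  have px: "path_filter x" using x(1) by (simp add: compatible_def)
  have comp: "compatible \<E> y" if "y \<in> orbit x" for y
    using orbit_compatible[OF eff x(1) that] .
  interpret path_representation L "orbit x" "to_nat_on (orbit x)"
    by (rule orbit_representation[OF fa px]) (use comp in \<open>simp add: compatible_def\<close>)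
  have "gap_prod ell2_cstar rep (range_of L F) F = \<zero>\<^bsub>ell2_cstar\<^esub>" if F: "F \<in> \<E>" for F
  proof -
    note FE = FE_edges_facts[OF efficient_FE[OF eff F]]
    have "y \<inter> F \<noteq> {}" if y: "y \<in> orbit x" "filter_rng y = range_of L F" for y
    proof -
      have py: "path_filter y" using comp[OF y(1)] by (simp add: compatible_def)
      have "range_of L F \<in> y" using filter_rng_in[OF py] y(2) by simp
      moreover have "src L (range_of L F) = range_of L F" using vertex_rng[OF FE(4)] by simp
      ultimately obtain f where f: "f \<in> F" "cmp L (range_of L F) f \<in> y"
        using comp[OF y(1)] F unfolding compatible_def by metis
      have "cmp L (range_of L F) f = f"
        using cmp_rng[OF efficient_mor(2)[OF eff F f(1)]] FE(5)[OF f(1)] by simp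
      then show ?thesis using f by auto
    qed
    then have V: "{y \<in> orbit x. filter_rng y = range_of L F \<and> y \<inter> F = {}} = {}" by blast
    have "F \<subseteq> into L (range_of L F) (mor L)"
      using efficient_mor(2,3)[OF eff F] by (auto simp: into_def)
    then show ?thesis by (simp only: gap_prod_rep[OF FE(4) FE(1)] V) simp
  qed
  then have "relative_CK_family L \<E> ell2_cstar rep"
    using TCK_rep by (simp add: relative_CK_family_def)
  moreover have "gap_prod ell2_cstar rep v E \<noteq> \<zero>\<^bsub>ell2_cstar\<^esub>"
  proof -
    let ?n = "to_nat_on (orbit x) x"
    let ?V = "Id_on (to_nat_on (orbit x) ` {y \<in> orbit x. filter_rng y = v \<and> y \<inter> E = {}})"
    have "(?n, ?n) \<in> ?V" using orbit_self[OF px] x by auto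
    then have "rel_op ?V \<noteq> 0" by (rule rel_op_nonzero[OF partial_inj_Id_on])
    moreover have "E \<subseteq> into L v (mor L)" using E(2) edge_mor by (auto simp: into_def)
    ultimately show ?thesis using gap_prod_rep[OF v E(1)] by simp
  qed
  ultimately show ?thesis by blast
qed

text \<open>A finite set of edges at v that contains an exhaustive set at v is itself exhaustive, so
  membership in \<open>FE_edges L\<close> comes for free.\<close>

lemma edge_satiation_iff:
  assumes eff: "efficient L \<E>" and v: "v \<in> vertices L"
    and E: "finite E" "E \<subseteq> into L v (edges L)"
  shows "E \<in> edge_satiation L \<E> \<longleftrightarrow> (\<exists>F \<in> \<E>. F \<subseteq> E)"
proof
  assume "\<exists>F \<in> \<E>. F \<subseteq> E"
  then obtain F where F: "F \<in> \<E>" "F \<subseteq> E" by blast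
  note FE = FE_edges_facts[OF efficient_FE[OF eff F(1)]]
  have Ee: "e \<in> edges L" "rng L e = v" "e \<in> mor L" if "e \<in> E" for e
    using E(2) that edge_mor by (auto simp: into_def)
  obtain u where u: "u \<in> vertices L" "F \<subseteq> into L u (mor L)" "exhaustive L u F"
    using efficient_FE[OF eff F(1)] by (auto simp: FE_edges_def FE_def)
  obtain f where "f \<in> F" using FE(2) by blast
  then have "u = v" using u(2) Ee(2) F(2) by (auto simp: into_def)
  have Ev: "E \<subseteq> into L v (mor L)" using Ee by (auto simp: into_def)
  have "exhaustive L v E"
    unfolding exhaustive_def
  proof (intro conjI ballI)
    fix \<mu> assume "\<mu> \<in> into L v (mor L)"
    then obtain \<nu> where "\<nu> \<in> F" "Lmin L \<mu> \<nu> \<noteq> {}"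
      using u(3) \<open>u = v\<close> unfolding exhaustive_def by blast
    then show "\<exists>\<nu>\<in>E. Lmin L \<mu> \<nu> \<noteq> {}" using F(2) by blast
  qed (rule Ev)
  moreover have "v \<notin> E"
    using edge_not_pre_vertex[OF Ee(1) v] pre_refl[OF Ee(3)] by blast
  ultimately have "E \<in> FE L" unfolding FE_def using E(1) v Ev by blast
  then have "E \<in> FE_edges L" using Ee(1) by (auto simp: FE_edges_def)
  then show "E \<in> edge_satiation L \<E>" using F by (auto simp: edge_satiation_def)
qed (auto simp: edge_satiation_def)

end

theorem proposition4p5:
  fixes L :: "('a, 'k::finite) kgraph"
    and \<E> :: "'a set set"
    and A :: "'b cstar"
    and s :: "'a \<Rightarrow> 'b"
  assumes "k_graph L"
    and "finitely_aligned L"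
    and "efficient L \<E>"
    and "universal_family L \<E> A s"
  shows "(\<forall>v \<in> vertices L. s v \<noteq> \<zero>\<^bsub>A\<^esub>) \<and>
    (\<forall>v \<in> vertices L. \<forall>E. finite E \<and> E \<subseteq> into L v (edges L) \<longrightarrow>
       (E \<in> edge_satiation L \<E> \<longleftrightarrow> gap_prod A s v E = \<zero>\<^bsub>A\<^esub>))"
proof -
  interpret k_graph L by fact
  have A: "cstar_algebra A" and CK: "relative_CK_family L \<E> A s"
    and univ: "\<And>(B :: test cstar) T. cstar_algebra B \<Longrightarrow> relative_CK_family L \<E> B T \<Longrightarrow>
      \<exists>\<pi>. star_hom A B \<pi> \<and> (\<forall>\<mu> \<in> mor L. \<pi> (s \<mu>) = T \<mu>)"
    using assms(4) by (auto simp: universal_family_def)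
  interpret A: tck_family A L s
    using A CK by (intro tck_family.intro tck_family_axioms.intro k_graph_axioms assms(2))
      (simp_all add: relative_CK_family_def)
  have main: "E \<in> edge_satiation L \<E> \<longleftrightarrow> gap_prod A s v E = \<zero>\<^bsub>A\<^esub>"
    if v: "v \<in> vertices L" and E: "finite E" "E \<subseteq> into L v (edges L)" for v E
  proof -
    have Em: "E \<subseteq> into L v (mor L)" using E(2) edge_mor by (auto simp: into_def)
    show ?thesis
      unfolding edge_satiation_iff[OF assms(3) v E]
    proof
      assume "\<exists>F \<in> \<E>. F \<subseteq> E"
      then obtain F where F: "F \<in> \<E>" "F \<subseteq> E" by blast
      have "range_of L F = v"
        by (rule range_of_unique[OF assms(3) F(1)]) (use F(2) E(2) in \<open>auto simp: into_def\<close>)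
      then have "gap_prod A s v F = \<zero>\<^bsub>A\<^esub>"
        using CK F(1) by (auto simp: relative_CK_family_def)
      then show "gap_prod A s v E = \<zero>\<^bsub>A\<^esub>"
        by (rule A.gap_prod_mono_zero[OF v E(1) Em F(2)])
    next
      assume 0: "gap_prod A s v E = \<zero>\<^bsub>A\<^esub>"
      show "\<exists>F \<in> \<E>. F \<subseteq> E"
      proof (rule ccontr)
        assume "\<not> (\<exists>F \<in> \<E>. F \<subseteq> E)"
        then obtain T where T: "relative_CK_family L \<E> ell2_cstar T"
          and n0: "gap_prod ell2_cstar T v E \<noteq> \<zero>\<^bsub>ell2_cstar\<^esub>"
          using relative_CK_family_nonzero_gap[OF assms(2,3) v E] by blast
        interpret B: tck_family ell2_cstar L T
          using T by (intro tck_family.intro tck_family_axioms.intro k_graph_axioms assms(2)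
              cstar_algebra_ell2_cstar) (simp add: relative_CK_family_def)
        \<comment> \<open>The homomorphism supplied by universality would have to send the vanishing
          gap product in A to a nonzero one.\<close>
        obtain \<pi> where \<pi>: "star_hom A ell2_cstar \<pi>" "\<And>\<mu>. \<mu> \<in> mor L \<Longrightarrow> \<pi> (s \<mu>) = T \<mu>"
          using univ[OF cstar_algebra_ell2_cstar T] by blast
        have "gap_prod ell2_cstar T v E = \<pi> \<zero>\<^bsub>A\<^esub>"
          using star_hom_gap_prod[OF A.tck_family_axioms B.tck_family_axioms \<pi> v E(1) Em] 0 by simp
        also have "\<dots> = \<zero>\<^bsub>ell2_cstar\<^esub>"
          by (rule star_hom_zero[OF A cstar_algebra_ell2_cstar \<pi>(1)])
        finally show False using n0 by simp
      qed
    qed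
  qed
  moreover have "s v \<noteq> \<zero>\<^bsub>A\<^esub>" if v: "v \<in> vertices L" for v
  proof -
    \<comment> \<open>Members of \<open>FE_edges L\<close> are nonempty, as the vertex itself must
      have a common extension with one of their elements.\<close>
    have "{} \<notin> edge_satiation L \<E>"
      using FE_edges_facts(2)[of "{}"] by (auto simp: edge_satiation_def)
    then show ?thesis
      using main[OF v, of "{}"] A.gap_prod_empty[OF v] by simp
  qed
  ultimately show ?thesis by blast
qed

end
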